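(* Over ${\sf RCA}_0$ the following are equivalent. (1) $\Pi^1_1$-${\sf CA}_0$: if $\varphi(n)$ is a $\Pi^1_1$ formula, then there is a set $Z$ such that for all $n$, $n\in Z$ iff $\varphi(n)$. (2) $\widehat{\sf WF}$: if $\langle T_i\rangle_{i\in\mathbb N}$ is a sequence of trees, then there is a set $Z$ such that for all $n$, $n\in Z$ iff $T_n$ has no infinite path. (3) $\widehat{\sf WF}_L$: statement (2) restricted to sequences of trees with leaf sets $\langle T_i,\mathrm{leaf}(T_i)\rangle_{i\in\mathbb N}$. (4) ${\sf PK}$: every tree has a perfect kernel. (5) ${\sf PK}_L$: statement (4) restricted to trees $T$ for which $\mathrm{leaf}(T)$ exists.
   Context: A tree is a set of finite sequences of natural numbers closed under initial subsequences; $\mathrm{leaf}(T)$ is the set of elements of $T$ with no proper extension in $T$. A subtree $S$ of $T$ is perfect if every element of $S$ has two incompatible extensions in $S$; the perfect kernel of $T$ is the union of all perfect subtrees of $T$ (a tree "has a perfect kernel" if this union exists as a set). *)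

theory Defs
  imports Main
begin

section \<open>The language of second-order arithmetic\<close>

text \<open>Number variables and set variables are both named by natural numbers, in separate name spaces.\<close>

datatype trm = NVar nat | Zero | One | Add trm trm | Mul trm trm

datatype fm =
    Eq trm trm
  | Less trm trm
  | Mem trm nat
  | Neg fm
  | Conj fm fm
  | Disj fm fm
  | Imp fm fm
  | Iff fm fm
  | AllN nat fm
  | ExN nat fm
  | AllS nat fm
  | ExS nat fm

primrec num_vars :: "trm \<Rightarrow> nat set" where
  "num_vars (NVar x) = {x}"
| "num_vars Zero = {}"
| "num_vars One = {}"
| "num_vars (Add s t) = num_vars s \<union> num_vars t"
| "num_vars (Mul s t) = num_vars s \<union> num_vars t"

primrec arithmetical :: "fm \<Rightarrow> bool" where
  "arithmetical (Eq s t) = True"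
| "arithmetical (Less s t) = True"
| "arithmetical (Mem t X) = True"
| "arithmetical (Neg \<phi>) = arithmetical \<phi>"
| "arithmetical (Conj \<phi> \<psi>) = (arithmetical \<phi> \<and> arithmetical \<psi>)"
| "arithmetical (Disj \<phi> \<psi>) = (arithmetical \<phi> \<and> arithmetical \<psi>)"
| "arithmetical (Imp \<phi> \<psi>) = (arithmetical \<phi> \<and> arithmetical \<psi>)"
| "arithmetical (Iff \<phi> \<psi>) = (arithmetical \<phi> \<and> arithmetical \<psi>)"
| "arithmetical (AllN x \<phi>) = arithmetical \<phi>"
| "arithmetical (ExN x \<phi>) = arithmetical \<phi>"
| "arithmetical (AllS X \<phi>) = False"
| "arithmetical (ExS X \<phi>) = False"

text \<open>Formulas all of whose quantifiers are bounded number quantifiers, \<open>\<forall>x<t\<close> or \<open>\<exists>x<t\<close>,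
  where \<open>x\<close> does not occur in \<open>t\<close>.\<close>

inductive Sigma00 :: "fm \<Rightarrow> bool" where
  "Sigma00 (Eq s t)"
| "Sigma00 (Less s t)"
| "Sigma00 (Mem t X)"
| "Sigma00 \<phi> \<Longrightarrow> Sigma00 (Neg \<phi>)"
| "Sigma00 \<phi> \<Longrightarrow> Sigma00 \<psi> \<Longrightarrow> Sigma00 (Conj \<phi> \<psi>)"
| "Sigma00 \<phi> \<Longrightarrow> Sigma00 \<psi> \<Longrightarrow> Sigma00 (Disj \<phi> \<psi>)"
| "Sigma00 \<phi> \<Longrightarrow> Sigma00 \<psi> \<Longrightarrow> Sigma00 (Imp \<phi> \<psi>)"
| "Sigma00 \<phi> \<Longrightarrow> Sigma00 \<psi> \<Longrightarrow> Sigma00 (Iff \<phi> \<psi>)"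
| "Sigma00 \<phi> \<Longrightarrow> x \<notin> num_vars t \<Longrightarrow> Sigma00 (AllN x (Imp (Less (NVar x) t) \<phi>))"
| "Sigma00 \<phi> \<Longrightarrow> x \<notin> num_vars t \<Longrightarrow> Sigma00 (ExN x (Conj (Less (NVar x) t) \<phi>))"

definition Sigma01 :: "fm \<Rightarrow> bool" where
  "Sigma01 \<phi> \<longleftrightarrow> (\<exists>x \<theta>. \<phi> = ExN x \<theta> \<and> Sigma00 \<theta>)"

definition Pi01 :: "fm \<Rightarrow> bool" where
  "Pi01 \<phi> \<longleftrightarrow> (\<exists>x \<theta>. \<phi> = AllN x \<theta> \<and> Sigma00 \<theta>)"

definition Pi11 :: "fm \<Rightarrow> bool" where
  "Pi11 \<phi> \<longleftrightarrow> (\<exists>X \<theta>. \<phi> = AllS X \<theta> \<and> arithmetical \<theta>)"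


section \<open>Structures and satisfaction\<close>

text \<open>
  A structure for the language: number variables range over the whole type \<open>'a\<close> (possibly a
  nonstandard model of arithmetic), set variables over an arbitrary collection \<open>Sets\<close> of
  subsets of it (Henkin semantics).  By the completeness theorem, a sentence is provable in a
  theory iff it holds in all structures satisfying the theory.
\<close>

record 'a l2_structure =
  Sets :: "'a set set"
  l2_zero :: 'a ("\<zero>\<index>")
  l2_one :: 'a ("\<one>\<index>")
  l2_add :: "'a \<Rightarrow> 'a \<Rightarrow> 'a" (infixl "\<oplus>\<index>" 65)
  l2_mul :: "'a \<Rightarrow> 'a \<Rightarrow> 'a" (infixl "\<otimes>\<index>" 70)
  l2_less :: "'a \<Rightarrow> 'a \<Rightarrow> bool" (infix "\<prec>\<index>" 50)

locale L2 =
  fixes M :: "'a l2_structure" (structure)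
begin

primrec val :: "(nat \<Rightarrow> 'a) \<Rightarrow> trm \<Rightarrow> 'a" where
  "val e (NVar x) = e x"
| "val e Zero = \<zero>"
| "val e One = \<one>"
| "val e (Add s t) = val e s \<oplus> val e t"
| "val e (Mul s t) = val e s \<otimes> val e t"

primrec sat :: "(nat \<Rightarrow> 'a) \<Rightarrow> (nat \<Rightarrow> 'a set) \<Rightarrow> fm \<Rightarrow> bool" where
  "sat e E (Eq s t) \<longleftrightarrow> val e s = val e t"
| "sat e E (Less s t) \<longleftrightarrow> val e s \<prec> val e t"
| "sat e E (Mem t X) \<longleftrightarrow> val e t \<in> E X"
| "sat e E (Neg \<phi>) \<longleftrightarrow> \<not> sat e E \<phi>"
| "sat e E (Conj \<phi> \<psi>) \<longleftrightarrow> sat e E \<phi> \<and> sat e E \<psi>"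
| "sat e E (Disj \<phi> \<psi>) \<longleftrightarrow> sat e E \<phi> \<or> sat e E \<psi>"
| "sat e E (Imp \<phi> \<psi>) \<longleftrightarrow> (sat e E \<phi> \<longrightarrow> sat e E \<psi>)"
| "sat e E (Iff \<phi> \<psi>) \<longleftrightarrow> (sat e E \<phi> \<longleftrightarrow> sat e E \<psi>)"
| "sat e E (AllN x \<phi>) \<longleftrightarrow> (\<forall>a. sat (e(x := a)) E \<phi>)"
| "sat e E (ExN x \<phi>) \<longleftrightarrow> (\<exists>a. sat (e(x := a)) E \<phi>)"
| "sat e E (AllS X \<phi>) \<longleftrightarrow> (\<forall>A\<in>Sets M. sat e (E(X := A)) \<phi>)"
| "sat e E (ExS X \<phi>) \<longleftrightarrow> (\<exists>A\<in>Sets M. sat e (E(X := A)) \<phi>)"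


section \<open>Axiom systems\<close>

definition basic_axioms :: bool where
  "basic_axioms \<longleftrightarrow>
     (\<forall>n. n \<oplus> \<one> \<noteq> \<zero>) \<and>
     (\<forall>m n. m \<oplus> \<one> = n \<oplus> \<one> \<longrightarrow> m = n) \<and>
     (\<forall>m. m \<oplus> \<zero> = m) \<and>
     (\<forall>m n. m \<oplus> (n \<oplus> \<one>) = (m \<oplus> n) \<oplus> \<one>) \<and>
     (\<forall>m. m \<otimes> \<zero> = \<zero>) \<and>
     (\<forall>m n. m \<otimes> (n \<oplus> \<one>) = (m \<otimes> n) \<oplus> m) \<and>
     (\<forall>m. \<not> m \<prec> \<zero>) \<and>
     (\<forall>m n. m \<prec> n \<oplus> \<one> \<longleftrightarrow> m \<prec> n \<or> m = n)"

text \<open>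
  In the schemes below, \<open>v\<close> is the distinguished number variable of the formula, and the
  assignments \<open>e\<close> and \<open>E\<close> supply arbitrary number and set parameters.  The set asserted to
  exist is not the value of any variable of the formula, so the usual proviso that it does not
  occur free holds automatically.
\<close>

definition Sigma01_IND :: bool where
  "Sigma01_IND \<longleftrightarrow>
     (\<forall>\<phi> v e E. Sigma01 \<phi> \<longrightarrow> range E \<subseteq> Sets M \<longrightarrow>
        sat (e(v := \<zero>)) E \<phi> \<longrightarrow>
        (\<forall>n. sat (e(v := n)) E \<phi> \<longrightarrow> sat (e(v := n \<oplus> \<one>)) E \<phi>) \<longrightarrow>
        (\<forall>n. sat (e(v := n)) E \<phi>))"

definition Delta01_CA :: bool where
  "Delta01_CA \<longleftrightarrow>
     (\<forall>\<phi> \<psi> v e E. Sigma01 \<phi> \<longrightarrow> Pi01 \<psi> \<longrightarrow> range E \<subseteq> Sets M \<longrightarrow>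
        (\<forall>n. sat (e(v := n)) E \<phi> \<longleftrightarrow> sat (e(v := n)) E \<psi>) \<longrightarrow>
        (\<exists>Z\<in>Sets M. \<forall>n. n \<in> Z \<longleftrightarrow> sat (e(v := n)) E \<phi>))"

definition RCA0 :: bool where
  "RCA0 \<longleftrightarrow> Sets M \<noteq> {} \<and> basic_axioms \<and> Sigma01_IND \<and> Delta01_CA"

definition Pi11_CA :: bool where
  "Pi11_CA \<longleftrightarrow>
     (\<forall>\<phi> v e E. Pi11 \<phi> \<longrightarrow> range E \<subseteq> Sets M \<longrightarrow>
        (\<exists>Z\<in>Sets M. \<forall>n. n \<in> Z \<longleftrightarrow> sat (e(v := n)) E \<phi>))"


section \<open>Coding of pairs, finite sets and finite sequences by numbers\<close>

text \<open>
  The standard codings in \<open>RCA\<^sub>0\<close>.  A triple \<open>(k, (m, n))\<close> represents the finite set of all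
  \<open>i < k\<close> such that \<open>m (i + 1) + 1\<close> divides \<open>n\<close>; the code of a finite set is the least triple
  representing it, so that a finite set has exactly one code.
\<close>

definition pair :: "'a \<Rightarrow> 'a \<Rightarrow> 'a" ("\<langle>_, _\<rangle>") where
  "\<langle>i, j\<rangle> = (i \<oplus> j) \<otimes> (i \<oplus> j) \<oplus> i"

definition divides :: "'a \<Rightarrow> 'a \<Rightarrow> bool" where
  "divides a b \<longleftrightarrow> (\<exists>q. b = a \<otimes> q)"

definition is_triple :: "'a \<Rightarrow> bool" where
  "is_triple c \<longleftrightarrow> (\<exists>k m n. c = \<langle>k, \<langle>m, n\<rangle>\<rangle>)"

definition elem :: "'a \<Rightarrow> 'a \<Rightarrow> bool" where
  "elem i c \<longleftrightarrow>
     (\<exists>k m n. c = \<langle>k, \<langle>m, n\<rangle>\<rangle> \<and> i \<prec> k \<and> divides (m \<otimes> (i \<oplus> \<one>) \<oplus> \<one>) n)"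

definition is_finset :: "'a \<Rightarrow> bool" where
  "is_finset c \<longleftrightarrow> is_triple c \<and>
     (\<forall>d. d \<prec> c \<and> is_triple d \<longrightarrow> (\<exists>i. elem i d \<noteq> elem i c))"

text \<open>A finite sequence is a finite set of pairs \<open>\<langle>i, j\<rangle>\<close> (\<open>j\<close> being the entry at position
  \<open>i\<close>) that is a function with domain \<open>{i. i \<prec> l}\<close>.\<close>

definition entry :: "'a \<Rightarrow> 'a \<Rightarrow> 'a \<Rightarrow> bool" where
  "entry s i j \<longleftrightarrow> elem \<langle>i, j\<rangle> s"

definition has_length :: "'a \<Rightarrow> 'a \<Rightarrow> bool" where
  "has_length s l \<longleftrightarrow> (\<forall>i. i \<prec> l \<longleftrightarrow> (\<exists>j. entry s i j))"

definition is_seq :: "'a \<Rightarrow> bool" where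
  "is_seq s \<longleftrightarrow> is_finset s \<and>
     (\<forall>n. elem n s \<longrightarrow> (\<exists>i j. n = \<langle>i, j\<rangle>)) \<and>
     (\<forall>i j k. entry s i j \<and> entry s i k \<longrightarrow> j = k) \<and>
     (\<exists>l. has_length s l)"

definition initseg :: "'a \<Rightarrow> 'a \<Rightarrow> bool" (infix "\<sqsubseteq>" 50) where
  "s \<sqsubseteq> t \<longleftrightarrow> is_seq s \<and> is_seq t \<and> (\<forall>i j. entry s i j \<longrightarrow> entry t i j)"

definition compatible :: "'a \<Rightarrow> 'a \<Rightarrow> bool" where
  "compatible s t \<longleftrightarrow> s \<sqsubseteq> t \<or> t \<sqsubseteq> s"


section \<open>Trees, paths and perfect kernels\<close>

definition is_tree :: "'a set \<Rightarrow> bool" where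
  "is_tree T \<longleftrightarrow> (\<forall>s\<in>T. is_seq s) \<and> (\<forall>s\<in>T. \<forall>t. t \<sqsubseteq> s \<longrightarrow> t \<in> T)"

definition leaf :: "'a set \<Rightarrow> 'a set" where
  "leaf T = {s \<in> T. \<not> (\<exists>t\<in>T. s \<sqsubseteq> t \<and> t \<noteq> s)}"

definition is_fun :: "'a set \<Rightarrow> bool" where
  "is_fun f \<longleftrightarrow> (\<forall>n\<in>f. \<exists>i j. n = \<langle>i, j\<rangle>) \<and> (\<forall>i. \<exists>!j. \<langle>i, j\<rangle> \<in> f)"

text \<open>\<open>f\<close> is an infinite path through \<open>T\<close> if for each \<open>k\<close> its restriction to \<open>{i. i \<prec> k}\<close>
  is in \<open>T\<close>.\<close>

definition is_path :: "'a set \<Rightarrow> 'a set \<Rightarrow> bool" where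
  "is_path f T \<longleftrightarrow> is_fun f \<and>
     (\<forall>k. \<exists>s\<in>T. has_length s k \<and> (\<forall>i j. entry s i j \<longrightarrow> \<langle>i, j\<rangle> \<in> f))"

definition has_path :: "'a set \<Rightarrow> bool" where
  "has_path T \<longleftrightarrow> (\<exists>f\<in>Sets M. is_path f T)"

definition perfect :: "'a set \<Rightarrow> bool" where
  "perfect S \<longleftrightarrow> (\<forall>s\<in>S. \<exists>t\<in>S. \<exists>u\<in>S. s \<sqsubseteq> t \<and> s \<sqsubseteq> u \<and> \<not> compatible t u)"

definition perfect_kernel :: "'a set \<Rightarrow> 'a set" where
  "perfect_kernel T = \<Union> {S \<in> Sets M. is_tree S \<and> S \<subseteq> T \<and> perfect S}"

text \<open>A sequence of sets is coded by the single set of all \<open>\<langle>n, i\<rangle>\<close> with \<open>n\<close> in the \<open>i\<close>-th set.\<close>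

definition row :: "'a set \<Rightarrow> 'a \<Rightarrow> 'a set" where
  "row A i = {n. \<langle>n, i\<rangle> \<in> A}"

definition WF_hat :: bool where
  "WF_hat \<longleftrightarrow>
     (\<forall>T\<in>Sets M. (\<forall>i. is_tree (row T i)) \<longrightarrow>
        (\<exists>Z\<in>Sets M. \<forall>n. n \<in> Z \<longleftrightarrow> \<not> has_path (row T n)))"

definition WF_hat_L :: bool where
  "WF_hat_L \<longleftrightarrow>
     (\<forall>T\<in>Sets M. \<forall>L\<in>Sets M. (\<forall>i. is_tree (row T i) \<and> row L i = leaf (row T i)) \<longrightarrow>
        (\<exists>Z\<in>Sets M. \<forall>n. n \<in> Z \<longleftrightarrow> \<not> has_path (row T n)))"

definition PK :: bool where
  "PK \<longleftrightarrow> (\<forall>T\<in>Sets M. is_tree T \<longrightarrow> perfect_kernel T \<in> Sets M)"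

definition PK_L :: bool where
  "PK_L \<longleftrightarrow>
     (\<forall>T\<in>Sets M. is_tree T \<and> leaf T \<in> Sets M \<longrightarrow> perfect_kernel T \<in> Sets M)"

end

end

theory Submission
  imports Defs
begin

text \<open>
  Comprehension for \<open>\<Pi>\<^sup>1\<^sub>1\<close> formulas yields the set of well-founded trees of a sequence and the perfect
  kernel of a tree, since both are defined by a single set quantifier.  Conversely, well-foundedness
  of trees \<open>T\<^sub>n\<close> with leaf sets, where \<open>T\<^sub>n\<close> has a path iff \<open>\<exists>m. \<theta>(n, m)\<close>, gives arithmetical
  comprehension.  This produces leaf sets for arbitrary trees, and it turns \<open>\<exists>X. \<theta>(n, X)\<close>, with
  \<open>\<theta>\<close> arithmetical, into the existence of a function \<open>f\<close> all of whose finite restrictions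
  satisfy a \<open>\<Sigma>\<^sup>0\<^sub>0\<close> condition, that is, into the existence of a path through a tree.  Finally, perfect
  kernels decide well-foundedness: pair the entries of the elements of \<open>T\<^sub>n\<close> with arbitrary bits and
  prefix them with \<open>n\<close>; then \<open>T\<^sub>n\<close> has a path iff \<open>\<langle>n\<rangle>\<close> belongs to the perfect kernel of the
  resulting tree, and the leaves of that tree are computed from those of the \<open>T\<^sub>n\<close>.

  All of this takes place in a possibly nonstandard structure, so the arithmetic of \<open>RCA\<^sub>0\<close> and the
  coding of finite sets (by divisibility) and finite sequences have to be carried out from the axioms.
\<close>

text \<open>The bits are there because a single path does not split: once every entry may carry
  either of two bits, the sequences along one path form a perfect subtree. Conversely, a perfect
  tree has no dead ends, so a path is found in it by always passing to the proper extension with the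
  least code. The prefix \<open>n\<close> merges a whole sequence of trees into one tree, so that a
  single kernel answers the question for all \<open>n\<close> at once. Arithmetical comprehension
  has to come first because being a leaf is a \<open>\<Pi>\<^sup>0\<^sub>1\<close> condition, so
  that leaf sets need not exist, and because the number quantifiers of \<open>\<theta>\<close> must
  be removed before a finite approximation can refute an attempt. Only
  \<open>\<Sigma>\<^sup>0\<^sub>1\<close> induction and \<open>\<Delta>\<^sup>0\<^sub>1\<close>
  comprehension are available. This dictates the form of most statements: the predicate of every
  induction and the graph of every function must be placed in the right class.\<close>

definition push :: "'b \<Rightarrow> (nat \<Rightarrow> 'b) \<Rightarrow> nat \<Rightarrow> 'b" where
  "push a e = case_nat a e"

abbreviation shift :: "(nat \<Rightarrow> 'b) \<Rightarrow> nat \<Rightarrow> 'b" where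
  "shift e \<equiv> \<lambda>j. e (Suc j)"

lemma push_simps [simp]: "push a e 0 = a" "push a e (Suc i) = e i"
  by (simp_all add: push_def)

lemma push_eta [simp]: "push (e 0) (shift e) = e"
  by (rule ext) (simp add: push_def split: nat.split)

lemma range_push: "range (push x r) = insert x (range r)"
  by (auto simp: image_iff) (metis push_simps nat.exhaust)+

lemma comp_push: "(\<lambda>i. e (push x r i)) = push (e x) (\<lambda>i. e (r i))"
  by (rule ext) (simp add: push_def split: nat.split)

text \<open>Finite support is what later allows an environment to be coded by one number; it also
  leaves the positions from \<open>N\<close> on free for other purposes.\<close>

definition depends_below :: "nat \<Rightarrow> ((nat \<Rightarrow> 'b) \<Rightarrow> 'c) \<Rightarrow> bool" where
  "depends_below N f \<longleftrightarrow> (\<forall>e e'. (\<forall>i<N. e i = e' i) \<longrightarrow> f e = f e')"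

lemma depends_belowD: "depends_below N f \<Longrightarrow> (\<And>i. i < N \<Longrightarrow> e i = e' i) \<Longrightarrow> f e = f e'"
  unfolding depends_below_def by simp

lemma depends_below_binary:
  assumes "depends_below N f" "depends_below N' g"
  shows "depends_below (max N N') (\<lambda>e. k (f e) (g e))"
  unfolding depends_below_def
proof (intro allI impI)
  fix e e' :: "nat \<Rightarrow> 'a" assume *: "\<forall>i<max N N'. e i = e' i"
  have "f e = f e'" by (rule depends_belowD[OF assms(1)]) (simp add: *)
  moreover have "g e = g e'" by (rule depends_belowD[OF assms(2)]) (simp add: *)
  ultimately show "k (f e) (g e) = k (f e') (g e')" by simp
qed

lemma depends_below_unary: "depends_below N f \<Longrightarrow> depends_below N (\<lambda>e. k (f e))"
  unfolding depends_below_def by metis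

text \<open>
  Definability is treated semantically: \<open>tm\<close>, \<open>d0\<close> and
  \<open>ar\<close> are the classes of functions and predicates given by terms, \<open>\<Sigma>\<^sup>0\<^sub>0\<close> formulas and
  arithmetical formulas, as functions of an environment \<open>e\<close> of numbers (in de Bruijn style, a
  quantifier pushes its variable to position \<open>0\<close>) and an environment \<open>V\<close> of sets.  Numbers
  and sets of the structure may occur as parameters, and substitution is composition of functions.
\<close>

locale rca = L2 M for M :: "'a l2_structure" (structure) +
  assumes rca0: RCA0
begin

section \<open>Semantic definability classes\<close>

inductive tm :: "((nat \<Rightarrow> 'a) \<Rightarrow> 'a) \<Rightarrow> bool" where
  tm_var: "tm (\<lambda>e. e i)"
| tm_const: "tm (\<lambda>e. c)"
| tm_add: "tm s \<Longrightarrow> tm t \<Longrightarrow> tm (\<lambda>e. s e \<oplus> t e)"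
| tm_mul: "tm s \<Longrightarrow> tm t \<Longrightarrow> tm (\<lambda>e. s e \<otimes> t e)"

inductive d0 :: "((nat \<Rightarrow> 'a) \<Rightarrow> (nat \<Rightarrow> 'a set) \<Rightarrow> bool) \<Rightarrow> bool" where
  d0_eq: "tm s \<Longrightarrow> tm t \<Longrightarrow> d0 (\<lambda>e V. s e = t e)"
| d0_less: "tm s \<Longrightarrow> tm t \<Longrightarrow> d0 (\<lambda>e V. s e \<prec> t e)"
| d0_mem: "tm t \<Longrightarrow> A \<in> Sets M \<Longrightarrow> d0 (\<lambda>e V. t e \<in> A)"
| d0_var: "tm t \<Longrightarrow> d0 (\<lambda>e V. t e \<in> V i)"
| d0_not: "d0 P \<Longrightarrow> d0 (\<lambda>e V. \<not> P e V)"
| d0_conj: "d0 P \<Longrightarrow> d0 Q \<Longrightarrow> d0 (\<lambda>e V. P e V \<and> Q e V)"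
| d0_bex_push: "tm t \<Longrightarrow> d0 P \<Longrightarrow> d0 (\<lambda>e V. \<exists>x. x \<prec> t e \<and> P (push x e) V)"

inductive ar :: "((nat \<Rightarrow> 'a) \<Rightarrow> (nat \<Rightarrow> 'a set) \<Rightarrow> bool) \<Rightarrow> bool" where
  ar_eq: "tm s \<Longrightarrow> tm t \<Longrightarrow> ar (\<lambda>e V. s e = t e)"
| ar_less: "tm s \<Longrightarrow> tm t \<Longrightarrow> ar (\<lambda>e V. s e \<prec> t e)"
| ar_mem: "tm t \<Longrightarrow> A \<in> Sets M \<Longrightarrow> ar (\<lambda>e V. t e \<in> A)"
| ar_var: "tm t \<Longrightarrow> ar (\<lambda>e V. t e \<in> V i)"
| ar_not: "ar P \<Longrightarrow> ar (\<lambda>e V. \<not> P e V)"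
| ar_conj: "ar P \<Longrightarrow> ar Q \<Longrightarrow> ar (\<lambda>e V. P e V \<and> Q e V)"
| ar_ex_push: "ar P \<Longrightarrow> ar (\<lambda>e V. \<exists>x. P (push x e) V)"

lemma tm_subst:
  assumes "tm t" and s: "\<And>i. tm (s i)"
  shows "tm (\<lambda>e. t (\<lambda>i. s i e))"
  using assms(1) by induction (auto intro: tm.intros s)

lemma tm_case: "tm a \<Longrightarrow> (\<And>j. tm (b j)) \<Longrightarrow> tm (case i of 0 \<Rightarrow> a | Suc j \<Rightarrow> b j)"
  by (cases i) simp_all

lemma tm_tl: "tm t \<Longrightarrow> tm (\<lambda>e. t (shift e))"
  by (rule tm_subst) (auto intro: tm.intros)

text \<open>The conclusion has a named bound variable so that it unifies with an unfolded
  definition; the premise reads that variable at position 0 of a shifted environment.\<close>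

lemma d0_bex:
  assumes "tm t" and "d0 (\<lambda>e V. P (e 0) (shift e) V)"
  shows "d0 (\<lambda>e V. \<exists>x. x \<prec> t e \<and> P x e V)"
  using d0_bex_push[OF assms] by simp

lemma ar_ex:
  assumes "ar (\<lambda>e V. P (e 0) (shift e) V)"
  shows "ar (\<lambda>e V. \<exists>x. P x e V)"
  using ar_ex_push[OF assms] by simp

lemma d0_subst_tm:
  assumes "d0 P" and "\<And>i. tm (s i)"
  shows "d0 (\<lambda>e V. P (\<lambda>i. s i e) V)"
  using assms
proof (induction arbitrary: s rule: d0.induct)
  case (d0_bex_push t P)
  \<comment> \<open>The substitution is lifted under the quantifier: position 0 is left to the bound
    variable.\<close>
  let ?s = "\<lambda>i. case i of 0 \<Rightarrow> (\<lambda>e. e 0) | Suc j \<Rightarrow> (\<lambda>e. s j (shift e))"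
  have "tm (?s i)" for i
    by (cases i) (auto intro: tm_var tm_tl d0_bex_push.prems)
  from d0_bex_push.IH[OF this]
  have 1: "d0 (\<lambda>e V. P (\<lambda>i. ?s i e) V)" .
  have "(\<lambda>i. ?s i e) = push (e 0) (\<lambda>i. s i (shift e))" for e :: "nat \<Rightarrow> 'a"
    by (rule ext) (simp add: push_def split: nat.split)
  then have "d0 (\<lambda>e V. P (push (e 0) (\<lambda>i. s i (shift e))) V)"
    using 1 by simp
  from d0_bex[OF tm_subst[OF d0_bex_push.hyps(1) d0_bex_push.prems] this]
  show ?case .
qed (simp_all add: d0.intros tm_subst)

lemma d0_tl: "d0 P \<Longrightarrow> d0 (\<lambda>e V. P (shift e) V)"
  by (rule d0_subst_tm) (auto intro: tm.intros)

text \<open>Set variables occur only in atoms, so they can be replaced by any sets whose membership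
  is \<open>\<Sigma>\<^sup>0\<^sub>0\<close> in the environment. Later the sets put in are
  components of another oracle, or a finite set coded by a number.\<close>

lemma d0_subst:
  assumes "d0 P" and "\<And>i. tm (s i)"
    and "\<And>i. d0 (\<lambda>e V. e 0 \<in> G i (shift e) V)"
  shows "d0 (\<lambda>e V. P (\<lambda>i. s i e) (\<lambda>i. G i e V))"
  using assms
proof (induction arbitrary: s G rule: d0.induct)
  case (d0_bex_push t P)
  let ?s = "\<lambda>i. case i of 0 \<Rightarrow> (\<lambda>e. e 0) | Suc j \<Rightarrow> (\<lambda>e. s j (shift e))"
  let ?G = "\<lambda>i e V. G i (shift e) V"
  have 0: "tm (?s i)" for i
    by (cases i) (auto intro: tm_var tm_tl d0_bex_push.prems)
  have "d0 (\<lambda>e V. e 0 \<in> ?G i (shift e) V)" for i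
    using d0_subst_tm[OF d0_bex_push.prems(2)[of i], where s = "\<lambda>i. case i of 0 \<Rightarrow> (\<lambda>e. e 0) | Suc j \<Rightarrow> (\<lambda>e. e (Suc (Suc j)))"]
    by (simp add: tm_case tm_var)
  from d0_bex_push.IH[OF 0 this]
  have 1: "d0 (\<lambda>e V. P (\<lambda>i. ?s i e) (\<lambda>i. ?G i e V))" .
  have "(\<lambda>i. ?s i e) = push (e 0) (\<lambda>i. s i (shift e))" for e :: "nat \<Rightarrow> 'a"
    by (rule ext) (simp add: push_def split: nat.split)
  then have "d0 (\<lambda>e V. P (push (e 0) (\<lambda>i. s i (shift e))) (\<lambda>i. ?G i e V))"
    using 1 by simp
  from d0_bex[OF tm_subst[OF d0_bex_push.hyps(1) d0_bex_push.prems(1)] this]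
  show ?case .
next
  case (d0_var t i)
  show ?case
    using d0_subst_tm[OF d0_var(3)[of i], where s = "\<lambda>i. case i of 0 \<Rightarrow> (\<lambda>e. t (\<lambda>i. s i e)) | Suc j \<Rightarrow> (\<lambda>e. e j)"]
    by (simp add: tm_case tm_var tm_subst d0_var)
qed (simp_all add: d0.intros tm_subst)

lemma d0_const_sets:
  assumes "d0 P" "\<And>i. W i \<in> Sets M" shows "d0 (\<lambda>e V. P e W)"
  by (rule d0_subst[OF assms(1) tm_var, where G = "\<lambda>i e V. W i"]) (auto intro: d0_mem tm_var assms)

lemma ar_d0: "d0 P \<Longrightarrow> ar P"
proof (induction rule: d0.induct)
  case (d0_bex_push t P)
  have "ar (\<lambda>e V. e 0 \<prec> t (shift e) \<and> P e V)"
    by (intro ar_conj ar_less d0_bex_push tm_var tm_tl)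
  from ar_ex_push[OF this] show ?case by simp
qed (simp_all add: ar.intros)

lemma d0_disj: "d0 P \<Longrightarrow> d0 Q \<Longrightarrow> d0 (\<lambda>e V. P e V \<or> Q e V)"
  using d0_not[OF d0_conj[OF d0_not[of P] d0_not[of Q]]] by simp

lemma d0_imp: "d0 P \<Longrightarrow> d0 Q \<Longrightarrow> d0 (\<lambda>e V. P e V \<longrightarrow> Q e V)"
  using d0_not[OF d0_conj[OF _ d0_not[of Q], of P]] by simp

lemma d0_iff: "d0 P \<Longrightarrow> d0 Q \<Longrightarrow> d0 (\<lambda>e V. P e V \<longleftrightarrow> Q e V)"
  using d0_conj[OF d0_imp[of P Q] d0_imp[of Q P]] by (simp add: iff_conv_conj_imp)

lemma d0_ball:
  assumes "tm t" and "d0 (\<lambda>e V. P (e 0) (shift e) V)"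
  shows "d0 (\<lambda>e V. \<forall>x. x \<prec> t e \<longrightarrow> P x e V)"
proof -
  have "d0 (\<lambda>e V. \<exists>x. x \<prec> t e \<and> \<not> P x e V)"
    by (rule d0_bex[OF assms(1)]) (rule d0_not[OF assms(2)])
  from d0_not[OF this] show ?thesis by simp
qed

lemma ar_disj: "ar P \<Longrightarrow> ar Q \<Longrightarrow> ar (\<lambda>e V. P e V \<or> Q e V)"
  using ar_not[OF ar_conj[OF ar_not[of P] ar_not[of Q]]] by simp

lemma ar_imp: "ar P \<Longrightarrow> ar Q \<Longrightarrow> ar (\<lambda>e V. P e V \<longrightarrow> Q e V)"
  using ar_not[OF ar_conj[OF _ ar_not[of Q], of P]] by simp

lemma ar_all:
  assumes "ar (\<lambda>e V. P (e 0) (shift e) V)"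
  shows "ar (\<lambda>e V. \<forall>x. P x e V)"
proof -
  have "ar (\<lambda>e V. \<exists>x. \<not> P x e V)"
    by (rule ar_ex) (rule ar_not[OF assms])
  from ar_not[OF this] show ?thesis by simp
qed

section \<open>Finite support of definable functions and predicates\<close>

lemma tm_finite_support: "tm t \<Longrightarrow> \<exists>N. depends_below N t"
proof (induction rule: tm.induct)
  case (tm_var i)
  show ?case by (rule exI[of _ "Suc i"]) (simp add: depends_below_def)
next
  case (tm_const c)
  show ?case by (rule exI[of _ 0]) (simp add: depends_below_def)
qed (auto intro: depends_below_binary)

lemma d0_finite_support: "d0 P \<Longrightarrow> \<exists>N. depends_below N P"
proof (induction rule: d0.induct)
  case (d0_bex_push t P)
  then obtain N' where N': "depends_below N' P" by blast
  obtain N where N: "depends_below N t" using tm_finite_support[OF d0_bex_push(1)] by blast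
  show ?case unfolding depends_below_def
  proof (intro exI[of _ "max N N'"] allI impI ext)
    fix e e' :: "nat \<Rightarrow> 'a" and V assume *: "\<forall>i<max N N'. e i = e' i"
    then have "t e = t e'" by (intro depends_belowD[OF N]) simp
    moreover have "P (push x e) = P (push x e')" for x
      using * by (intro depends_belowD[OF N']) (auto simp: push_def split: nat.split)
    ultimately show "(\<exists>x. x \<prec> t e \<and> P (push x e) V) = (\<exists>x. x \<prec> t e' \<and> P (push x e') V)"
      by simp
  qed
next
  case (d0_eq s t)
  then show ?case
    using depends_below_binary[of _ s _ t "\<lambda>x y V. x = y"] tm_finite_support by blast
next
  case (d0_less s t)
  then show ?case
    using depends_below_binary[of _ s _ t "\<lambda>x y V. x \<prec> y"] tm_finite_support by blast
next
  case (d0_mem t A)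
  then show ?case using depends_below_unary[of _ t "\<lambda>x V. x \<in> A"] tm_finite_support by blast
next
  case (d0_var t i)
  then show ?case using depends_below_unary[of _ t "\<lambda>x V. x \<in> V i"] tm_finite_support by blast
next
  case (d0_not P)
  then show ?case using depends_below_unary[of _ P "\<lambda>x V. \<not> x V"] by blast
next
  case (d0_conj P Q)
  then show ?case using depends_below_binary[of _ P _ Q "\<lambda>x y V. x V \<and> y V"] by blast
qed

section \<open>Translation into formulas\<close>

text \<open>The syntax has no constants for the elements of the structure, so a parameter
  \<open>c\<close> becomes the variable \<open>nu c\<close>, evaluated in environments that assign
  it the value \<open>c\<close>. The bound on \<open>num_vars\<close> serves the proviso on bounded
  quantifiers.\<close>

definition translates :: "((nat \<Rightarrow> 'a) \<Rightarrow> 'a) \<Rightarrow> 'a set \<Rightarrow> bool" where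
  "translates t N \<longleftrightarrow> (\<forall>r nu. \<exists>u. num_vars u \<subseteq> range r \<union> nu ` N \<and>
     (\<forall>e. (\<forall>c\<in>N. e (nu c) = c) \<longrightarrow> val e u = t (\<lambda>i. e (r i))))"

lemma translatesE:
  assumes "translates t N"
  obtains u where "num_vars u \<subseteq> range r \<union> nu ` N" "\<forall>e. (\<forall>c\<in>N. e (nu c) = c) \<longrightarrow> val e u = t (\<lambda>i. e (r i))"
  using assms unfolding translates_def by blast

lemma translates_binary:
  assumes "translates s N1" "translates t N2"
    and F: "\<And>u w. num_vars (F u w) = num_vars u \<union> num_vars w" "\<And>e u w. val e (F u w) = g (val e u) (val e w)"
  shows "translates (\<lambda>e. g (s e) (t e)) (N1 \<union> N2)"
  unfolding translates_def
proof (intro allI)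
  fix r nu
  obtain u1 where 1: "num_vars u1 \<subseteq> range r \<union> nu ` N1" "\<forall>e. (\<forall>c\<in>N1. e (nu c) = c) \<longrightarrow> val e u1 = s (\<lambda>i. e (r i))"
    by (rule translatesE[OF assms(1)])
  obtain u2 where 2: "num_vars u2 \<subseteq> range r \<union> nu ` N2" "\<forall>e. (\<forall>c\<in>N2. e (nu c) = c) \<longrightarrow> val e u2 = t (\<lambda>i. e (r i))"
    by (rule translatesE[OF assms(2)])
  show "\<exists>u. num_vars u \<subseteq> range r \<union> nu ` (N1 \<union> N2) \<and>
     (\<forall>e. (\<forall>c\<in>N1\<union>N2. e (nu c) = c) \<longrightarrow> val e u = g (s (\<lambda>i. e (r i))) (t (\<lambda>i. e (r i))))"
    using 1 2 by (intro exI[of _ "F u1 u2"]) (auto simp: F)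
qed

lemma tm_translates: "tm t \<Longrightarrow> \<exists>N. finite N \<and> translates t N"
proof (induction rule: tm.induct)
  case (tm_var i)
  show ?case unfolding translates_def
    by (rule exI[of _ "{}"]) (auto intro!: exI[of _ "NVar (r i)" for r :: "nat \<Rightarrow> nat"])
next
  case (tm_const c)
  show ?case unfolding translates_def
    by (rule exI[of _ "{c}"]) (auto intro!: exI[of _ "NVar (nu c)" for nu :: "'a \<Rightarrow> nat"])
next
  case (tm_add s t)
  then obtain N1 N2 where "finite N1" "translates s N1" "finite N2" "translates t N2" by blast
  then show ?case by (intro exI[of _ "N1 \<union> N2"] conjI translates_binary[where F = Add]) simp_all
next
  case (tm_mul s t)
  then obtain N1 N2 where "finite N1" "translates s N1" "finite N2" "translates t N2" by blast
  then show ?case by (intro exI[of _ "N1 \<union> N2"] conjI translates_binary[where F = Mul]) simp_all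
qed

abbreviation expresses where
  "expresses \<phi> N S nu sg r tau P \<equiv> \<forall>e E. (\<forall>c\<in>N. e (nu c) = c) \<longrightarrow> (\<forall>A\<in>S. E (sg A) = A) \<longrightarrow>
     sat e E \<phi> = P (\<lambda>i. e (r i)) (\<lambda>i. E (tau i))"

text \<open>
  \<open>realizes P K N S\<close>: the predicate \<open>P\<close> is expressed by a formula in the class \<open>K\<close>, where
  \<open>r\<close> and \<open>tau\<close> name the variables of \<open>P\<close>, and \<open>nu\<close> and \<open>sg\<close> name the number parameters
  in \<open>N\<close> and the set parameters in \<open>S\<close>.  The range of \<open>r\<close> is coinfinite to leave fresh names for
  the bound variables.
\<close>

definition realizes :: "((nat \<Rightarrow> 'a) \<Rightarrow> (nat \<Rightarrow> 'a set) \<Rightarrow> bool) \<Rightarrow> (fm \<Rightarrow> bool) \<Rightarrow> 'a set \<Rightarrow> 'a set set \<Rightarrow> bool" where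
  "realizes P K N S \<longleftrightarrow> (\<forall>r nu sg tau. infinite (- range r) \<longrightarrow> (\<exists>\<phi>. K \<phi> \<and> expresses \<phi> N S nu sg r tau P))"

lemma realizesD:
  assumes "realizes P K N S" "infinite (- range r)"
  obtains \<phi> where "K \<phi>" "expresses \<phi> N S nu sg r tau P"
  using assms(1)[unfolded realizes_def, rule_format, OF assms(2), of nu sg tau] that by blast

lemma realizes_rel:
  assumes "tm s" "tm t"
    and R: "\<And>u w e E. sat e E (R u w) = Q (val e u) (val e w)" "\<And>u w. K (R u w)"
  shows "\<exists>N S. finite N \<and> finite S \<and> S \<subseteq> Sets M \<and> realizes (\<lambda>e V. Q (s e) (t e)) K N S"
proof -
  obtain N1 N2 where N: "finite N1" "finite N2" and 1: "translates s N1" and 2: "translates t N2"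
    using assms(1,2)[THEN tm_translates] by blast
  have "realizes (\<lambda>e V. Q (s e) (t e)) K (N1 \<union> N2) {}"
    unfolding realizes_def
  proof (intro allI impI)
    fix r nu sg tau
    obtain u1 where "\<forall>e. (\<forall>c\<in>N1. e (nu c) = c) \<longrightarrow> val e u1 = s (\<lambda>i. e (r i))" by (rule translatesE[OF 1])
    moreover obtain u2 where "\<forall>e. (\<forall>c\<in>N2. e (nu c) = c) \<longrightarrow> val e u2 = t (\<lambda>i. e (r i))" by (rule translatesE[OF 2])
    ultimately show "\<exists>\<phi>. K \<phi> \<and>
     (\<forall>e E. (\<forall>c\<in>N1 \<union> N2. e (nu c) = c) \<longrightarrow> (\<forall>A\<in>{}. E (sg A) = A) \<longrightarrow>
        sat e E \<phi> = Q (s (\<lambda>i. e (r i))) (t (\<lambda>i. e (r i))))"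
      by (intro exI[of _ "R u1 u2"] conjI allI impI) (simp_all add: R)
  qed
  then show ?thesis using N by (intro exI[of _ "N1 \<union> N2"] exI[of _ "{}"] conjI) simp_all
qed

lemma realizes_mem:
  assumes "tm t" "A \<in> Sets M" "\<And>u X. K (Mem u X)"
  shows "\<exists>N S. finite N \<and> finite S \<and> S \<subseteq> Sets M \<and> realizes (\<lambda>e V. t e \<in> A) K N S"
proof -
  obtain N where N: "finite N" "translates t N" using tm_translates[OF assms(1)] by blast
  have "realizes (\<lambda>e V. t e \<in> A) K N {A}"
    unfolding realizes_def
  proof (intro allI impI)
    fix r nu sg tau
    obtain u where "\<forall>e. (\<forall>c\<in>N. e (nu c) = c) \<longrightarrow> val e u = t (\<lambda>i. e (r i))" by (rule translatesE[OF N(2)])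
    then show "\<exists>\<phi>. K \<phi> \<and>
     (\<forall>e E. (\<forall>c\<in>N. e (nu c) = c) \<longrightarrow> (\<forall>A\<in>{A}. E (sg A) = A) \<longrightarrow>
        sat e E \<phi> = (t (\<lambda>i. e (r i)) \<in> A))"
      using assms(3) by (intro exI[of _ "Mem u (sg A)"]) auto
  qed
  then show ?thesis using N assms by blast
qed

lemma realizes_var:
  assumes "tm t" "\<And>u X. K (Mem u X)"
  shows "\<exists>N S. finite N \<and> finite S \<and> S \<subseteq> Sets M \<and> realizes (\<lambda>e V. t e \<in> V j) K N S"
proof -
  obtain N where N: "finite N" "translates t N" using tm_translates[OF assms(1)] by blast
  have "realizes (\<lambda>e V. t e \<in> V j) K N {}"
    unfolding realizes_def
  proof (intro allI impI)
    fix r nu sg tau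
    obtain u where "\<forall>e. (\<forall>c\<in>N. e (nu c) = c) \<longrightarrow> val e u = t (\<lambda>i. e (r i))" by (rule translatesE[OF N(2)])
    then show "\<exists>\<phi>. K \<phi> \<and>
     (\<forall>e E. (\<forall>c\<in>N. e (nu c) = c) \<longrightarrow> (\<forall>A\<in>{}. E (sg A) = A) \<longrightarrow>
        sat e E \<phi> = (t (\<lambda>i. e (r i)) \<in> E (tau j)))"
      using assms(2) by (intro exI[of _ "Mem u (tau j)"]) auto
  qed
  then show ?thesis using N by blast
qed

lemma realizes_not:
  assumes "realizes P K N S" "\<And>\<phi>. K \<phi> \<Longrightarrow> K (Neg \<phi>)"
  shows "realizes (\<lambda>e V. \<not> P e V) K N S"
  unfolding realizes_def
proof (intro allI impI)
  fix r nu sg tau assume r: "infinite (- range (r :: nat \<Rightarrow> nat))"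
  obtain \<phi> where "K \<phi>"
    "expresses \<phi> N S nu sg r tau P"
    using realizesD[OF assms(1) r, where nu = nu and sg = sg and tau = tau] .
  then show "\<exists>\<phi>. K \<phi> \<and> (\<forall>e E. (\<forall>c\<in>N. e (nu c) = c) \<longrightarrow> (\<forall>A\<in>S. E (sg A) = A) \<longrightarrow>
        sat e E \<phi> = (\<not> P (\<lambda>i. e (r i)) (\<lambda>i. E (tau i))))"
    using assms(2) by (intro exI[of _ "Neg \<phi>"]) auto
qed

lemma realizes_conj:
  assumes "realizes P K N S" "realizes Q K N' S'" "\<And>\<phi> \<psi>. K \<phi> \<Longrightarrow> K \<psi> \<Longrightarrow> K (Conj \<phi> \<psi>)"
  shows "realizes (\<lambda>e V. P e V \<and> Q e V) K (N \<union> N') (S \<union> S')"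
  unfolding realizes_def
proof (intro allI impI)
  fix r nu sg tau assume r: "infinite (- range (r :: nat \<Rightarrow> nat))"
  obtain \<phi> where "K \<phi>"
    "expresses \<phi> N S nu sg r tau P"
    using realizesD[OF assms(1) r, where nu = nu and sg = sg and tau = tau] .
  moreover obtain \<psi> where "K \<psi>"
    "expresses \<psi> N' S' nu sg r tau Q"
    using realizesD[OF assms(2) r, where nu = nu and sg = sg and tau = tau] .
  ultimately
  show "\<exists>\<phi>. K \<phi> \<and> (\<forall>e E. (\<forall>c\<in>N \<union> N'. e (nu c) = c) \<longrightarrow> (\<forall>A\<in>S \<union> S'. E (sg A) = A) \<longrightarrow>
        sat e E \<phi> = (P (\<lambda>i. e (r i)) (\<lambda>i. E (tau i)) \<and> Q (\<lambda>i. e (r i)) (\<lambda>i. E (tau i))))"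
    using assms(3) by (intro exI[of _ "Conj \<phi> \<psi>"]) auto
qed

lemma fresh_var:
  assumes "infinite (- range (r :: nat \<Rightarrow> nat))" "finite (N :: 'b set)"
  obtains x where "x \<notin> range r" "x \<notin> nu ` N" "infinite (- range (push x r))"
proof -
  have "infinite (- range r - nu ` N)" using assms by simp
  then obtain x where x: "x \<in> - range r - nu ` N" using infinite_imp_nonempty by blast
  have "- range (push x r) = - range r - {x}" by (auto simp: range_push)
  with x show ?thesis using that assms by auto
qed

lemma realizes_ex:
  assumes "realizes P K N S" "\<And>x \<phi>. K \<phi> \<Longrightarrow> K (ExN x \<phi>)" "finite N"
  shows "realizes (\<lambda>e V. \<exists>x. P (push x e) V) K N S"
  unfolding realizes_def
proof (intro allI impI)
  fix r nu sg tau assume r: "infinite (- range (r :: nat \<Rightarrow> nat))"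
  obtain x where x: "x \<notin> range r" "x \<notin> nu ` N" "infinite (- range (push x r))"
    using fresh_var[OF r assms(3)] .
  obtain \<phi> where K: "K \<phi>"
    and sat: "expresses \<phi> N S nu sg (push x r) tau P"
    using realizesD[OF assms(1) x(3), where nu = nu and sg = sg and tau = tau] .
  show "\<exists>\<phi>. K \<phi> \<and> (\<forall>e E. (\<forall>c\<in>N. e (nu c) = c) \<longrightarrow> (\<forall>A\<in>S. E (sg A) = A) \<longrightarrow>
        sat e E \<phi> = (\<exists>x. P (push x (\<lambda>i. e (r i))) (\<lambda>i. E (tau i))))"
  proof (intro exI[of _ "ExN x \<phi>"] conjI allI impI)
    fix e E assume e: "\<forall>c\<in>N. e (nu c) = c" "\<forall>A\<in>S. E (sg A) = A"
    have "sat (e(x := a)) E \<phi> = P (push a (\<lambda>i. e (r i))) (\<lambda>i. E (tau i))" for a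
    proof -
      have *: "(\<lambda>i. (e(x := a)) (r i)) = (\<lambda>i. e (r i))" using x(1) by (auto intro!: ext)
      have "sat (e(x := a)) E \<phi> = P (\<lambda>i. (e(x := a)) (push x r i)) (\<lambda>i. E (tau i))"
        by (rule sat[rule_format]) (use e x(2) in auto)
      then show ?thesis unfolding comp_push * by simp
    qed
    then show "sat e E (ExN x \<phi>) = (\<exists>x. P (push x (\<lambda>i. e (r i))) (\<lambda>i. E (tau i)))" by simp
  qed (use K assms in auto)
qed

text \<open>The term \<open>t\<close> is translated in the environment without the new variable, and
  \<open>x\<close> avoids all names that may occur in the translation; this yields the proviso of
  \<open>Sigma00\<close>. The parameters of \<open>t\<close> enlarge the set of named
  numbers.\<close>

lemma realizes_bex:
  assumes "realizes P Sigma00 N S" "finite N" "tm t"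
  shows "\<exists>N'. finite N' \<and> realizes (\<lambda>e V. \<exists>x. x \<prec> t e \<and> P (push x e) V) Sigma00 N' S"
proof -
  obtain N1 where N1: "finite N1" "translates t N1" using tm_translates[OF assms(3)] by blast
  have "realizes (\<lambda>e V. \<exists>x. x \<prec> t e \<and> P (push x e) V) Sigma00 (N \<union> N1) S"
  unfolding realizes_def
  proof (intro allI impI)
    fix r nu sg tau assume r: "infinite (- range (r :: nat \<Rightarrow> nat))"
    have "finite (N \<union> N1)" using assms N1 by simp
    from r this obtain x where x: "x \<notin> range r" "x \<notin> nu ` (N \<union> N1)" "infinite (- range (push x r))"
      by (rule fresh_var)
    obtain u where u: "num_vars u \<subseteq> range r \<union> nu ` N1"
      "\<forall>e. (\<forall>c\<in>N1. e (nu c) = c) \<longrightarrow> val e u = t (\<lambda>i. e (r i))"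
      by (rule translatesE[OF N1(2)])
    obtain \<phi> where K: "Sigma00 \<phi>"
      and sat: "expresses \<phi> N S nu sg (push x r) tau P"
      using realizesD[OF assms(1) x(3), where nu = nu and sg = sg and tau = tau] .
    show "\<exists>\<phi>. Sigma00 \<phi> \<and> (\<forall>e E. (\<forall>c\<in>N \<union> N1. e (nu c) = c) \<longrightarrow> (\<forall>A\<in>S. E (sg A) = A) \<longrightarrow>
          sat e E \<phi> = (\<exists>x. x \<prec> t (\<lambda>i. e (r i)) \<and> P (push x (\<lambda>i. e (r i))) (\<lambda>i. E (tau i))))"
    proof (intro exI[of _ "ExN x (Conj (Less (NVar x) u) \<phi>)"] conjI allI impI)
      show "Sigma00 (ExN x (Conj (Less (NVar x) u) \<phi>))"
        by (rule Sigma00.intros) (use K x u in auto)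
      fix e E assume e: "\<forall>c\<in>N \<union> N1. e (nu c) = c" "\<forall>A\<in>S. E (sg A) = A"
      have *: "(\<lambda>i. (e(x := a)) (r i)) = (\<lambda>i. e (r i))" for a using x(1) by (auto intro!: ext)
      have "sat (e(x := a)) E \<phi> = P (push a (\<lambda>i. e (r i))) (\<lambda>i. E (tau i))" for a
      proof -
        have "sat (e(x := a)) E \<phi> = P (\<lambda>i. (e(x := a)) (push x r i)) (\<lambda>i. E (tau i))"
          by (rule sat[rule_format]) (use e x(2) in auto)
        then show ?thesis unfolding comp_push * by simp
      qed
      moreover have "val (e(x := a)) u = t (\<lambda>i. e (r i))" for a
      proof -
        have "\<forall>c\<in>N1. (e(x := a)) (nu c) = c" using e(1) x(2) by auto
        from u(2)[rule_format, OF this[rule_format]] show ?thesis unfolding * .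
      qed
      ultimately show "sat e E (ExN x (Conj (Less (NVar x) u) \<phi>)) =
        (\<exists>x. x \<prec> t (\<lambda>i. e (r i)) \<and> P (push x (\<lambda>i. e (r i))) (\<lambda>i. E (tau i)))" by simp
    qed
  qed
  then show ?thesis using assms N1 by blast
qed

lemma d0_realizes:
  assumes "d0 P"
  shows "\<exists>N S. finite N \<and> finite S \<and> S \<subseteq> Sets M \<and> realizes P Sigma00 N S"
  using assms
proof induction
  case (d0_eq s t)
  then show ?case by (rule realizes_rel[where R = Eq]) (auto intro: Sigma00.intros)
next
  case (d0_less s t)
  then show ?case by (rule realizes_rel[where R = Less]) (auto intro: Sigma00.intros)
next
  case (d0_mem t A)
  then show ?case by (rule realizes_mem) (auto intro: Sigma00.intros)
next
  case (d0_var t i)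
  then show ?case by (rule realizes_var) (auto intro: Sigma00.intros)
next
  case (d0_not P)
  then obtain N S where "finite N" "finite S" "S \<subseteq> Sets M" "realizes P Sigma00 N S" by blast
  then show ?case
    by (intro exI[of _ N] exI[of _ S] conjI realizes_not) (simp_all add: Sigma00.intros)
next
  case (d0_conj P Q)
  then obtain N S N' S' where "finite N" "finite S" "S \<subseteq> Sets M" "realizes P Sigma00 N S"
    "finite N'" "finite S'" "S' \<subseteq> Sets M" "realizes Q Sigma00 N' S'" by blast
  then show ?case
    by (intro exI[of _ "N \<union> N'"] exI[of _ "S \<union> S'"] conjI realizes_conj) (auto intro: Sigma00.intros)
next
  case (d0_bex_push t P)
  then obtain N S where *: "finite N" "finite S" "S \<subseteq> Sets M" "realizes P Sigma00 N S" by blast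
  then obtain N' where "finite N'" "realizes (\<lambda>e V. \<exists>x. x \<prec> t e \<and> P (push x e) V) Sigma00 N' S"
    using realizes_bex[OF *(4) *(1) d0_bex_push(1)] by blast
  with * show ?case by (intro exI[of _ N'] exI[of _ S] conjI)
qed

lemma ar_realizes:
  assumes "ar P"
  shows "\<exists>N S. finite N \<and> finite S \<and> S \<subseteq> Sets M \<and> realizes P arithmetical N S"
  using assms
proof induction
  case (ar_eq s t)
  then show ?case by (rule realizes_rel[where R = Eq]) auto
next
  case (ar_less s t)
  then show ?case by (rule realizes_rel[where R = Less]) auto
next
  case (ar_mem t A)
  then show ?case by (rule realizes_mem) auto
next
  case (ar_var t i)
  then show ?case by (rule realizes_var) auto
next
  case (ar_not P)
  then obtain N S where "finite N" "finite S" "S \<subseteq> Sets M" "realizes P arithmetical N S" by blast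
  then show ?case
    by (intro exI[of _ N] exI[of _ S] conjI realizes_not) (simp_all add: Sigma00.intros)
next
  case (ar_conj P Q)
  then obtain N S N' S' where "finite N" "finite S" "S \<subseteq> Sets M" "realizes P arithmetical N S"
    "finite N'" "finite S'" "S' \<subseteq> Sets M" "realizes Q arithmetical N' S'" by blast
  then show ?case
    by (intro exI[of _ "N \<union> N'"] exI[of _ "S \<union> S'"] conjI realizes_conj) auto
next
  case (ar_ex_push P)
  then obtain N S where "finite N" "finite S" "S \<subseteq> Sets M" "realizes P arithmetical N S" by blast
  then show ?case by (intro exI[of _ N] exI[of _ S] conjI realizes_ex) simp_all
qed

text \<open>Parameters receive odd number names and nonzero set names, which keeps the even number
  variables and the set variable 0 free for the arguments of the predicate.\<close>

lemma naming:
  assumes N: "finite (N :: 'a set)" and S: "finite S" "S \<subseteq> Sets M"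
  obtains nu :: "'a \<Rightarrow> nat" and sg :: "'a set \<Rightarrow> nat" and e :: "nat \<Rightarrow> 'a" and E :: "nat \<Rightarrow> 'a set" where "\<And>c. c \<in> N \<Longrightarrow> e (nu c) = c" "\<And>A. A \<in> S \<Longrightarrow> E (sg A) = A"
    "range E \<subseteq> Sets M" "\<And>c. odd (nu c)" "\<And>A. sg A \<noteq> (0::nat)"
proof -
  obtain A0 where A0: "A0 \<in> Sets M" using rca0 unfolding RCA0_def by blast
  obtain f :: "'a \<Rightarrow> nat" where f: "inj_on f N" using finite_imp_inj_to_nat_seg[OF N] by blast
  obtain g :: "'a set \<Rightarrow> nat" where g: "inj_on g S" using finite_imp_inj_to_nat_seg[OF S(1)] by blast
  show ?thesis
  proof (rule that[of "\<lambda>j. inv_into N f (j div 2)" "\<lambda>c. 2 * f c + 1"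
        "\<lambda>j. if j - 1 \<in> g ` S then inv_into S g (j - 1) else A0" "\<lambda>A. Suc (g A)"])
    show "range (\<lambda>j. if j - 1 \<in> g ` S then inv_into S g (j - 1) else A0) \<subseteq> Sets M"
      using A0 S inv_into_into[of _ g S] by auto
  qed (use f g in auto)
qed

text \<open>\<open>Delta01_CA\<close> evaluates its two formulas under one assignment, so the
  parameters of both predicates are named jointly. The renaming \<open>2 * i\<close> makes variable
  0 the witness and variable 2 the argument.\<close>

lemma realize2:
  assumes "d0 (\<lambda>e V. P (e 0) (e 1))" "d0 (\<lambda>e V. Q (e 0) (e 1))"
  obtains \<phi> \<psi> e E where "Sigma00 \<phi>" "Sigma00 \<psi>" "range E \<subseteq> Sets M"
    "\<And>x y. sat (e(2 := x, 0 := y)) E \<phi> = P y x" "\<And>x y. sat (e(2 := x, 0 := y)) E \<psi> = Q y x"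
proof -
  obtain N S where 1: "finite N" "finite S" "S \<subseteq> Sets M" "realizes (\<lambda>e V. P (e 0) (e 1)) Sigma00 N S"
    using d0_realizes[OF assms(1)] by blast
  obtain N' S' where 2: "finite N'" "finite S'" "S' \<subseteq> Sets M" "realizes (\<lambda>e V. Q (e 0) (e 1)) Sigma00 N' S'"
    using d0_realizes[OF assms(2)] by blast
  have fin: "finite (N \<union> N')" "finite (S \<union> S')" "S \<union> S' \<subseteq> Sets M" using 1 2 by auto
  from fin obtain nu :: "'a \<Rightarrow> nat" and sg :: "'a set \<Rightarrow> nat" and e :: "nat \<Rightarrow> 'a" and E where n: "\<And>c. c \<in> N \<union> N' \<Longrightarrow> e (nu c) = c" "\<And>A. A \<in> S \<union> S' \<Longrightarrow> E (sg A) = A"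
    "range E \<subseteq> Sets M" "\<And>c. odd (nu c)" "\<And>A. sg A \<noteq> (0::nat)" by (rule naming) blast
  let ?r = "\<lambda>i::nat. 2 * i"
  have "range (\<lambda>i. 2 * i + 1) \<subseteq> - range ?r" by (auto dest: arg_cong[where f = even])
  moreover have "infinite (range (\<lambda>i::nat. 2 * i + 1))"
    using finite_imageD[of "\<lambda>i::nat. 2 * i + 1" UNIV] by (auto simp: inj_def)
  ultimately have r: "infinite (- range ?r)" by (rule infinite_super)
  obtain \<phi> where \<phi>: "Sigma00 \<phi>" "\<forall>e E. (\<forall>c\<in>N. e (nu c) = c) \<longrightarrow> (\<forall>A\<in>S. E (sg A) = A) \<longrightarrow>
          sat e E \<phi> = P (e (2 * 0)) (e (2 * 1))"
    using realizesD[OF 1(4) r, where nu = nu and sg = sg] .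
  obtain \<psi> where \<psi>: "Sigma00 \<psi>" "\<forall>e E. (\<forall>c\<in>N'. e (nu c) = c) \<longrightarrow> (\<forall>A\<in>S'. E (sg A) = A) \<longrightarrow>
          sat e E \<psi> = Q (e (2 * 0)) (e (2 * 1))"
    using realizesD[OF 2(4) r, where nu = nu and sg = sg] .
  have nu [simp]: "nu c \<noteq> 0" "nu c \<noteq> 2" for c using n(4)[of c] by (metis even_zero, metis even_numeral)
  show ?thesis
  proof (rule that[OF \<phi>(1) \<psi>(1) n(3), of e])
    fix x y
    show "sat (e(2 := x, 0 := y)) E \<phi> = P y x" by (subst \<phi>(2)[rule_format]) (use n(1,2) in auto)
    show "sat (e(2 := x, 0 := y)) E \<psi> = Q y x" by (subst \<psi>(2)[rule_format]) (use n(1,2) in auto)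
  qed
qed

section \<open>Comprehension and induction without syntax\<close>

lemma comprehension2:
  assumes "d0 (\<lambda>e V. P (e 0) (e 1))" "d0 (\<lambda>e V. Q (e 0) (e 1))"
    and "\<And>x. (\<exists>y. P y x) \<longleftrightarrow> \<not> (\<exists>y. Q y x)"
  shows "{x. \<exists>y. P y x} \<in> Sets M"
proof -
  obtain \<phi> \<psi> e E where *: "Sigma00 \<phi>" "Sigma00 \<psi>" "range E \<subseteq> Sets M"
    "\<And>x y. sat (e(2 := x, 0 := y)) E \<phi> = P y x" "\<And>x y. sat (e(2 := x, 0 := y)) E \<psi> = Q y x"
    by (rule realize2[OF assms(1,2)], rule that)
  have D: Delta01_CA using rca0 unfolding RCA0_def by blast
  have "Sigma01 (ExN 0 \<phi>)" "Pi01 (AllN 0 (Neg \<psi>))"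
    using * unfolding Sigma01_def Pi01_def by (blast intro: Sigma00.intros)+
  moreover have "sat (e(2 := n)) E (ExN 0 \<phi>) = sat (e(2 := n)) E (AllN 0 (Neg \<psi>))" for n
    using *(4,5) assms(3) by simp
  ultimately obtain Z where "Z \<in> Sets M" "\<forall>n. n \<in> Z \<longleftrightarrow> sat (e(2 := n)) E (ExN 0 \<phi>)"
    using D *(3) unfolding Delta01_CA_def by blast
  moreover then have "Z = {x. \<exists>y. P y x}" using *(4) by auto
  ultimately show ?thesis by simp
qed

lemma induction_ex:
  assumes "d0 (\<lambda>e V. P (e 0) (e 1))" and "\<exists>y. P y \<zero>"
    and "\<And>n. \<exists>y. P y n \<Longrightarrow> \<exists>y. P y (n \<oplus> \<one>)"
  shows "\<exists>y. P y n"
proof -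
  obtain \<phi> \<psi> e E where *: "Sigma00 \<phi>" "Sigma00 \<psi>" "range E \<subseteq> Sets M"
    "\<And>x y. sat (e(2 := x, 0 := y)) E \<phi> = P y x"
    by (rule realize2[OF assms(1,1)], rule that)
  have D: Sigma01_IND using rca0 unfolding RCA0_def by blast
  have 1: "Sigma01 (ExN 0 \<phi>)" using * unfolding Sigma01_def by blast
  have 2: "sat (e(2 := n)) E (ExN 0 \<phi>) \<longleftrightarrow> (\<exists>y. P y n)" for n
    using *(4) by simp
  from D[unfolded Sigma01_IND_def, rule_format, OF 1 *(3), of e 2 n] assms(2,3)
  show ?thesis unfolding 2 by blast
qed

lemma induction_d0:
  assumes "d0 (\<lambda>e V. P (e 0))" and "P \<zero>" and "\<And>n. P n \<Longrightarrow> P (n \<oplus> \<one>)"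
  shows "P n"
proof -
  have "d0 (\<lambda>e V. P (e 1))" using d0_tl[OF assms(1)] by simp
  from induction_ex[of "\<lambda>y n. P n", OF this] assms show ?thesis by simp
qed

lemma ar_realize:
  assumes "ar (\<lambda>e V. P (e 0) (V 0))"
  obtains \<phi> e E where "arithmetical \<phi>" "range E \<subseteq> Sets M"
    "\<And>x A. sat (e(0 := x)) (E(0 := A)) \<phi> = P x A"
proof -
  obtain N S where 1: "finite N" "finite S" "S \<subseteq> Sets M" "realizes (\<lambda>e V. P (e 0) (V 0)) arithmetical N S"
    using ar_realizes[OF assms(1)] by blast
  from 1(1-3) obtain nu :: "'a \<Rightarrow> nat" and sg :: "'a set \<Rightarrow> nat" and e :: "nat \<Rightarrow> 'a" and E where n: "\<And>c. c \<in> N \<Longrightarrow> e (nu c) = c" "\<And>A. A \<in> S \<Longrightarrow> E (sg A) = A"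
    "range E \<subseteq> Sets M" "\<And>c. odd (nu c)" "\<And>A. sg A \<noteq> (0::nat)" by (rule naming) blast
  \<comment> \<open>The predicate reads only position 0, so a constant renaming loses nothing and
    leaves infinitely many names free.\<close>
  let ?r = "\<lambda>i::nat. 0::nat"
  have r: "infinite (- range ?r)" by (simp add: infinite_UNIV_nat)
  obtain \<phi> where \<phi>: "arithmetical \<phi>" "\<forall>e E. (\<forall>c\<in>N. e (nu c) = c) \<longrightarrow> (\<forall>A\<in>S. E (sg A) = A) \<longrightarrow>
          sat e E \<phi> = P (e 0) (E 0)"
    using realizesD[OF 1(4) r, where nu = nu and sg = sg and tau = "\<lambda>_. 0"] .
  have nu [simp]: "nu c \<noteq> 0" for c using n(4)[of c] by (metis even_zero)
  show ?thesis
  proof (rule that[OF \<phi>(1) n(3), of e])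
    fix x A
    have [simp]: "sg A \<noteq> 0" for A using n(5) .
    show "sat (e(0 := x)) (E(0 := A)) \<phi> = P x A" by (subst \<phi>(2)[rule_format]) (use n(1,2) in auto)
  qed
qed


abbreviation suc :: "'a \<Rightarrow> 'a" where
  "suc n \<equiv> n \<oplus> \<one>"

lemmas d0_intros = d0_eq d0_less d0_mem d0_var d0_not d0_conj d0_disj d0_imp d0_iff d0_bex d0_ball
  tm_var tm_const tm_add tm_mul

section \<open>Arithmetic\<close>

lemma
  shows succ_neq_zero: "suc n \<noteq> \<zero>"
    and succ_inj: "suc m = suc n \<Longrightarrow> m = n"
    and add_zero_ax: "m \<oplus> \<zero> = m"
    and add_succ_ax: "m \<oplus> suc n = (m \<oplus> n) \<oplus> \<one>"
    and mul_zero_ax: "m \<otimes> \<zero> = \<zero>"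
    and mul_succ_ax: "m \<otimes> suc n = (m \<otimes> n) \<oplus> m"
    and not_less_zero_ax: "\<not> m \<prec> \<zero>"
    and less_succ_ax: "m \<prec> suc n \<longleftrightarrow> m \<prec> n \<or> m = n"
  using rca0 unfolding RCA0_def basic_axioms_def by blast+

lemma zero_add: "\<zero> \<oplus> n = n"
  by (rule induction_d0[where P = "\<lambda>n. \<zero> \<oplus> n = n"], intro d0_intros)
    (simp_all add: add_zero_ax add_succ_ax)

lemma succ_add: "suc m \<oplus> n = (m \<oplus> n) \<oplus> \<one>"
  by (rule induction_d0[where P = "\<lambda>n. suc m \<oplus> n = (m \<oplus> n) \<oplus> \<one>"], intro d0_intros)
    (simp_all add: add_zero_ax add_succ_ax)

lemma add_comm: "m \<oplus> n = n \<oplus> m"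
  by (rule induction_d0[where P = "\<lambda>n. m \<oplus> n = n \<oplus> m"], intro d0_intros)
    (simp_all add: add_zero_ax add_succ_ax zero_add succ_add)

lemma add_assoc_M: "(a \<oplus> b) \<oplus> n = a \<oplus> (b \<oplus> n)"
  by (rule induction_d0[where P = "\<lambda>n. (a \<oplus> b) \<oplus> n = a \<oplus> (b \<oplus> n)"], intro d0_intros)
    (simp_all add: add_zero_ax add_succ_ax)

lemma add_cancel: "a \<oplus> n = b \<oplus> n \<Longrightarrow> a = b"
proof -
  have "a \<oplus> n = b \<oplus> n \<longrightarrow> a = b"
    by (rule induction_d0[where P = "\<lambda>n. a \<oplus> n = b \<oplus> n \<longrightarrow> a = b"], intro d0_intros)
    (auto simp add: add_zero_ax add_succ_ax dest: succ_inj)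
  then show "a \<oplus> n = b \<oplus> n \<Longrightarrow> a = b" by blast
qed

lemma zero_mul: "\<zero> \<otimes> n = \<zero>"
  by (rule induction_d0[where P = "\<lambda>n. \<zero> \<otimes> n = \<zero>"], intro d0_intros)
    (simp_all add: add_zero_ax mul_zero_ax mul_succ_ax)

lemma add_lcomm: "a \<oplus> (b \<oplus> c) = b \<oplus> (a \<oplus> c)"
  by (metis add_comm add_assoc_M)

lemma succ_mul: "suc m \<otimes> n = m \<otimes> n \<oplus> n"
proof (rule induction_d0[where P = "\<lambda>n. suc m \<otimes> n = m \<otimes> n \<oplus> n"], intro d0_intros)
  fix n assume *: "suc m \<otimes> n = m \<otimes> n \<oplus> n"
  show "suc m \<otimes> suc n = m \<otimes> suc n \<oplus> suc n"
    unfolding mul_succ_ax * by (simp only: add_assoc_M add_comm add_lcomm)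
qed (simp add: add_zero_ax mul_zero_ax)

lemma mul_comm: "m \<otimes> n = n \<otimes> m"
  by (rule induction_d0[where P = "\<lambda>n. m \<otimes> n = n \<otimes> m"], intro d0_intros)
    (simp_all add: mul_zero_ax mul_succ_ax zero_mul succ_mul)

lemma mul_add: "m \<otimes> (n \<oplus> k) = m \<otimes> n \<oplus> m \<otimes> k"
  by (rule induction_d0[where P = "\<lambda>k. m \<otimes> (n \<oplus> k) = m \<otimes> n \<oplus> m \<otimes> k"], intro d0_intros)
    (simp add: mul_zero_ax add_zero_ax, simp only: add_succ_ax mul_succ_ax, simp only: add_assoc_M)

lemma mul_one: "m \<otimes> \<one> = m"
  by (metis mul_succ_ax mul_zero_ax zero_add)

lemma mul_assoc: "(m \<otimes> n) \<otimes> k = m \<otimes> (n \<otimes> k)"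
  by (rule induction_d0[where P = "\<lambda>k. (m \<otimes> n) \<otimes> k = m \<otimes> (n \<otimes> k)"], intro d0_intros)
    (simp_all add: mul_zero_ax mul_one mul_add)

lemma less_add: "m \<prec> m \<oplus> suc k"
  by (rule induction_d0[where P = "\<lambda>k. m \<prec> m \<oplus> suc k"], intro d0_intros)
    (simp_all add: zero_add add_succ_ax less_succ_ax)

lemma zero_or_succ: "n = \<zero> \<or> (\<exists>m. n = suc m)"
proof -
  have "\<exists>m. n = \<zero> \<or> n = suc m"
    by (rule induction_ex[where P = "\<lambda>m n. n = \<zero> \<or> n = suc m"], intro d0_intros) auto
  then show ?thesis by blast
qed

lemma less_iff_add: "m \<prec> n \<longleftrightarrow> (\<exists>k. n = m \<oplus> suc k)"
proof
  \<comment> \<open>With the quantifier in front of the implication, the induction predicate is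
    visibly \<open>\<Sigma>\<^sup>0\<^sub>1\<close>.\<close>
  have "\<exists>k. m \<prec> n \<longrightarrow> n = m \<oplus> suc k"
  proof (rule induction_ex[where P = "\<lambda>k n. m \<prec> n \<longrightarrow> n = m \<oplus> suc k"], intro d0_intros)
    fix n assume "\<exists>k. m \<prec> n \<longrightarrow> n = m \<oplus> suc k"
    then show "\<exists>k. m \<prec> suc n \<longrightarrow> n \<oplus> \<one> = m \<oplus> suc k"
      unfolding less_succ_ax by (metis add_succ_ax add_zero_ax zero_add)
  qed (simp add: not_less_zero_ax)
  then show "m \<prec> n \<Longrightarrow> \<exists>k. n = m \<oplus> suc k" by blast
qed (auto simp: less_add)

section \<open>Order and truncated subtraction\<close>

definition le :: "'a \<Rightarrow> 'a \<Rightarrow> bool" (infix "\<preceq>" 50) where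
  "a \<preceq> b \<longleftrightarrow> a \<prec> b \<or> a = b"

text \<open>The class \<open>linordered_semidom\<close>, interpreted below, includes a subtraction;
  later this one also provides the predecessor.\<close>

definition monus :: "'a \<Rightarrow> 'a \<Rightarrow> 'a" (infixl "\<ominus>" 65) where
  "a \<ominus> b = (if b \<preceq> a then THE c. a = b \<oplus> c else \<zero>)"

lemma le_iff_add: "a \<preceq> b \<longleftrightarrow> (\<exists>c. b = a \<oplus> c)"
  unfolding le_def less_iff_add by (metis add_zero_ax zero_or_succ)

lemma add_eq_zero: "a \<oplus> b = \<zero> \<Longrightarrow> b = \<zero>"
  by (metis zero_or_succ add_succ_ax succ_neq_zero)

lemma less_irrefl_M: "\<not> a \<prec> a"
  unfolding less_iff_add by (metis add_cancel add_comm add_zero_ax succ_neq_zero)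

lemma le_antisym_M: "a \<preceq> b \<Longrightarrow> b \<preceq> a \<Longrightarrow> a = b"
  unfolding le_iff_add by (metis add_cancel add_assoc_M add_comm add_zero_ax add_eq_zero)

lemma le_trans_M: "a \<preceq> b \<Longrightarrow> b \<preceq> c \<Longrightarrow> a \<preceq> c"
  unfolding le_iff_add by (metis add_assoc_M)

lemma less_le_M: "a \<prec> b \<longleftrightarrow> a \<preceq> b \<and> \<not> b \<preceq> a"
  using le_antisym_M less_irrefl_M unfolding le_def by blast

lemma le_linear_M: "a \<preceq> n \<or> n \<preceq> a"
proof -
  have "a \<prec> n \<or> a = n \<or> n \<prec> a"
  proof (rule induction_d0[where P = "\<lambda>n. a \<prec> n \<or> a = n \<or> n \<prec> a"], intro d0_intros)
    show "a \<prec> \<zero> \<or> a = \<zero> \<or> \<zero> \<prec> a"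
      using zero_or_succ[of a] less_iff_add zero_add by metis
    fix n assume "a \<prec> n \<or> a = n \<or> n \<prec> a"
    moreover have "a = suc n \<or> n \<oplus> \<one> \<prec> a" if h: "n \<prec> a"
    proof -
      obtain k where k: "a = n \<oplus> suc k" using h unfolding less_iff_add by blast
      consider "k = \<zero>" | m where "k = suc m" using zero_or_succ by blast
      then show ?thesis
      proof cases
        case 1 then show ?thesis using k by (simp add: zero_add)
      next
        case 2
        then have "a = suc n \<oplus> suc m" using k by (simp only: add_assoc_M add_comm add_lcomm)
        then show ?thesis unfolding less_iff_add by blast
      qed
    qed
    ultimately show "a \<prec> suc n \<or> a = suc n \<or> n \<oplus> \<one> \<prec> a"
      unfolding less_succ_ax by blast
  qed
  then show ?thesis unfolding le_def by blast
qed

lemma monus_add: "a \<oplus> b \<ominus> a = b"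
  unfolding monus_def using le_iff_add add_cancel add_comm by (auto intro!: the_equality, metis)

lemma add_monus: "a \<preceq> b \<Longrightarrow> b \<ominus> a \<oplus> a = b"
  unfolding le_iff_add using monus_add add_comm by metis

lemma monus_monus: "a \<ominus> b \<ominus> c = a \<ominus> (b \<oplus> c)"
proof (cases "b \<oplus> c \<preceq> a")
  case True
  then obtain d where "a = b \<oplus> (c \<oplus> d)" unfolding le_iff_add by (metis add_assoc_M)
  then show ?thesis by (metis monus_add add_assoc_M)
next
  case False
  show ?thesis
  proof (cases "b \<preceq> a")
    case True
    then obtain d where d: "a = b \<oplus> d" unfolding le_iff_add by blast
    have "\<not> c \<preceq> d" using False unfolding d le_iff_add by (metis add_assoc_M)
    then show ?thesis using False unfolding d monus_add by (simp add: monus_def d)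
  next
    case f: False
    then have "a \<ominus> b = \<zero>" by (simp add: monus_def)
    moreover have "\<zero> \<ominus> c = \<zero>"
      unfolding monus_def le_iff_add
      by (auto intro!: the_equality) (metis add_comm add_eq_zero add_zero_ax)+
    ultimately show ?thesis using False by (simp add: monus_def)
  qed
qed

lemma less_imp_succ_le: "a \<prec> b \<longleftrightarrow> a \<oplus> \<one> \<preceq> b"
  unfolding less_iff_add le_iff_add by (metis add_assoc_M add_comm)

lemma mul_eq_zero: "a \<otimes> b = \<zero> \<Longrightarrow> a = \<zero> \<or> b = \<zero>"
  by (metis zero_or_succ mul_succ_ax add_eq_zero)

lemma mul_mono: "a \<preceq> b \<Longrightarrow> c \<otimes> a \<preceq> c \<otimes> b"
  unfolding le_iff_add by (metis mul_add)

lemma mul_less: "a \<prec> b \<Longrightarrow> \<zero> \<prec> c \<Longrightarrow> c \<otimes> a \<prec> c \<otimes> b"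
  unfolding less_iff_add by (metis mul_add mul_succ_ax zero_add add_succ_ax)

lemma mul_monus: "a \<otimes> (b \<ominus> c) = a \<otimes> b \<ominus> a \<otimes> c"
proof (cases "c \<preceq> b")
  case True
  then obtain d where "b = c \<oplus> d" unfolding le_iff_add by blast
  then show ?thesis by (simp add: monus_add mul_add)
next
  case False
  then have "b \<preceq> c" using le_linear_M by blast
  then have "a \<otimes> b \<preceq> a \<otimes> c" by (rule mul_mono)
  then have "a \<otimes> b \<ominus> a \<otimes> c = \<zero>"
    using le_antisym_M[of "a \<otimes> b" "a \<otimes> c"] monus_add[of "a \<otimes> b" \<zero>] by (auto simp: monus_def add_zero_ax)
  then show ?thesis using False by (simp add: monus_def mul_zero_ax)
qed

text \<open>This makes the algebraic simplification rules and the method \<open>order\<close>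
  available for the possibly nonstandard numbers.\<close>

sublocale M: linordered_semidom where plus = "l2_add M" and times = "l2_mul M" and zero = \<zero> and one = \<one>
  and minus = monus and less_eq = le and less = "l2_less M"
proof unfold_locales
  show "\<zero> \<noteq> \<one>" using succ_neq_zero[of \<zero>] by (simp add: zero_add)
  show "\<zero> \<prec> \<one>" using less_add[of \<zero> \<zero>] by (simp add: zero_add)
  fix a b c
  show "(a \<oplus> b) \<otimes> c = a \<otimes> c \<oplus> b \<otimes> c" by (simp add: mul_add mul_comm)
  show "\<one> \<otimes> a = a" using mul_one mul_comm by metis
  show "a \<preceq> a" by (simp add: le_def)
  show "a \<preceq> b \<Longrightarrow> c \<oplus> a \<preceq> c \<oplus> b" unfolding le_iff_add by (metis add_assoc_M)
  show "a \<noteq> \<zero> \<Longrightarrow> b \<noteq> \<zero> \<Longrightarrow> a \<otimes> b \<noteq> \<zero>" using mul_eq_zero by blast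
qed (assumption | rule add_assoc_M mul_assoc add_comm mul_comm mul_add monus_add monus_monus mul_monus
  add_monus zero_add zero_mul mul_zero_ax mul_less less_le_M le_linear_M le_trans_M le_antisym_M)+

lemma zero_le [simp]: "\<zero> \<preceq> a"
  unfolding le_iff_add using zero_add by metis


lemma less_succ_iff: "a \<prec> suc b \<longleftrightarrow> a \<preceq> b"
  by (simp add: less_succ_ax le_def)

lemma le_add1 [simp]: "a \<preceq> a \<oplus> b"
  unfolding le_iff_add by blast

lemma le_add2 [simp]: "a \<preceq> b \<oplus> a"
  unfolding le_iff_add using add_comm by blast

lemma tm_if: "tm a \<Longrightarrow> tm b \<Longrightarrow> tm (\<lambda>e. if c then a e else b e)"
  by (cases c) simp_all

lemma push_case: "(\<lambda>i. (case i of 0 \<Rightarrow> t | Suc j \<Rightarrow> s j) e) = push (t e) (\<lambda>i. s i e)"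
  by (rule ext) (simp add: push_def split: nat.split)

lemma d0_push:
  assumes "d0 Q" "tm t" "\<And>i. tm (s i)"
  shows "d0 (\<lambda>e V. Q (push (t e) (\<lambda>i. s i e)) V)"
proof -
  have "d0 (\<lambda>e V. Q (\<lambda>i. (case i of 0 \<Rightarrow> t | Suc j \<Rightarrow> s j) e) V)"
    by (rule d0_subst_tm[OF assms(1)]) (simp add: tm_case assms)
  then show ?thesis by (simp add: push_case)
qed

lemma d0_push2:
  assumes "d0 Q" "tm t" "tm u" "\<And>i. tm (s i)"
  shows "d0 (\<lambda>e V. Q (push (t e) (push (u e) (\<lambda>i. s i e))) V)"
  using d0_push[OF assms(1,2), of "\<lambda>i. case i of 0 \<Rightarrow> u | Suc j \<Rightarrow> s j"] assms(3,4)
  by (simp add: tm_case push_case)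

section \<open>Sigma-1 and Delta-1 predicates\<close>

text \<open>
  \<open>s1\<close> and \<open>d1\<close> are the classes of \<open>\<Sigma>\<^sup>0\<^sub>1\<close> and \<open>\<Delta>\<^sup>0\<^sub>1\<close> predicates, and \<open>f1\<close> is the class of functions with
  \<open>\<Sigma>\<^sup>0\<^sub>1\<close>, hence \<open>\<Delta>\<^sup>0\<^sub>1\<close>, graph.  Being closed under composition and bounded quantification (the
  latter by \<open>\<Sigma>\<^sup>0\<^sub>1\<close> collection), they allow definability proofs by unfolding definitions.
\<close>

lemma d0_const: "d0 (\<lambda>e V. c)"
proof (cases c)
  case True
  have "d0 (\<lambda>e V. \<zero> = \<zero>)" by (intro d0_eq tm_const)
  with True show ?thesis by simp
next
  case False
  have "d0 (\<lambda>e V. \<not> \<zero> = \<zero>)" by (intro d0_not d0_eq tm_const)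
  with False show ?thesis by simp
qed

definition s1 :: "((nat \<Rightarrow> 'a) \<Rightarrow> bool) \<Rightarrow> bool" where
  "s1 P \<longleftrightarrow> (\<exists>Q. d0 (\<lambda>e V. Q e) \<and> (\<forall>e. P e \<longleftrightarrow> (\<exists>a. Q (push a e))))"

definition d1 :: "((nat \<Rightarrow> 'a) \<Rightarrow> bool) \<Rightarrow> bool" where
  "d1 P \<longleftrightarrow> s1 P \<and> s1 (\<lambda>e. \<not> P e)"

definition f1 :: "((nat \<Rightarrow> 'a) \<Rightarrow> 'a) \<Rightarrow> bool" where
  "f1 f \<longleftrightarrow> s1 (\<lambda>e. e 0 = f (shift e))"

text \<open>Set parameters from \<open>Sets M\<close> are allowed, so this is computability relative
  to the structure: it amounts to the graph of \<open>h\<close> being one of its sets.\<close>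

abbreviation computable :: "('a \<Rightarrow> 'a) \<Rightarrow> bool" where
  "computable h \<equiv> f1 (\<lambda>e. h (e 0))"

lemma s1I:
  assumes "d0 (\<lambda>e V. Q e)" "\<And>e. P e \<longleftrightarrow> (\<exists>a. Q (push a e))"
  shows "s1 P"
  using assms unfolding s1_def by (intro exI[of _ Q]) simp

lemma s1E:
  assumes "s1 P"
  obtains Q where "d0 (\<lambda>e V. Q e)" "P = (\<lambda>e. \<exists>a. Q (push a e))"
proof -
  obtain Q where "d0 (\<lambda>e V. Q e)" "\<forall>e. P e \<longleftrightarrow> (\<exists>a. Q (push a e))"
    using assms unfolding s1_def by (elim exE conjE)
  moreover from this have "P = (\<lambda>e. \<exists>a. Q (push a e))" by (intro ext) simp
  ultimately show ?thesis using that by blast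
qed

lemma s1_d0: "d0 (\<lambda>e V. P e) \<Longrightarrow> s1 P"
  using d0_tl[of "\<lambda>e V. P e"] by (intro s1I[where Q = "\<lambda>e. P (shift e)"]) simp_all

lemma s1_ren:
  assumes "s1 P" "\<And>i. tm (s i)" shows "s1 (\<lambda>e. P (\<lambda>i. s i e))"
proof -
  obtain Q where Q: "d0 (\<lambda>e V. Q e)" "P = (\<lambda>e. \<exists>a. Q (push a e))" using assms(1) by (rule s1E)
  show ?thesis
    by (rule s1I[where Q = "\<lambda>e. Q (push (e 0) (\<lambda>i. s i (shift e)))"])
     (simp_all add: d0_push[OF Q(1)] tm_var tm_tl assms(2) Q(2))
qed

text \<open>One unbounded quantifier over a common bound replaces the two witnesses, which are then
  searched for below the bound. The same contraction is used for \<open>s1_ex\<close>.\<close>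

lemma s1_conj:
  assumes "s1 P" "s1 P'" shows "s1 (\<lambda>e. P e \<and> P' e)"
proof -
  obtain Q where Q: "d0 (\<lambda>e V. Q e)" "P = (\<lambda>e. \<exists>a. Q (push a e))" using assms(1) by (rule s1E)
  obtain Q' where Q': "d0 (\<lambda>e V. Q' e)" "P' = (\<lambda>e. \<exists>a. Q' (push a e))" using assms(2) by (rule s1E)
  show ?thesis
  proof (rule s1I[where Q = "\<lambda>e. (\<exists>a. a \<prec> e 0 \<and> Q (push a (shift e))) \<and> (\<exists>a. a \<prec> e 0 \<and> Q' (push a (shift e)))"])
    fix e
    have "\<exists>c. a \<prec> c \<and> b \<prec> c" for a b
      by (intro exI[of _ "a \<oplus> b \<oplus> \<one>"]) (simp add: less_succ_iff)
    then show "(P e \<and> P' e) = (\<exists>a. (\<exists>aa. aa \<prec> push a e 0 \<and> Q (push aa (\<lambda>i. push a e (Suc i)))) \<and>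
                   (\<exists>aa. aa \<prec> push a e 0 \<and> Q' (push aa (\<lambda>i. push a e (Suc i)))))"
      unfolding Q Q' by simp blast
  qed (intro d0_intros d0_push[OF Q(1)] d0_push[OF Q'(1)])
qed

lemma s1_disj:
  assumes "s1 P" "s1 P'" shows "s1 (\<lambda>e. P e \<or> P' e)"
proof -
  obtain Q where Q: "d0 (\<lambda>e V. Q e)" "P = (\<lambda>e. \<exists>a. Q (push a e))" using assms(1) by (rule s1E)
  obtain Q' where Q': "d0 (\<lambda>e V. Q' e)" "P' = (\<lambda>e. \<exists>a. Q' (push a e))" using assms(2) by (rule s1E)
  show ?thesis
    by (rule s1I[where Q = "\<lambda>e. Q e \<or> Q' e"]) (auto intro: d0_disj Q Q' simp: Q(2) Q'(2))
qed

lemma s1_ex: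
  assumes "s1 (\<lambda>e. P (e 0) (shift e))" shows "s1 (\<lambda>e. \<exists>x. P x e)"
proof -
  obtain Q where Q: "d0 (\<lambda>e V. Q e)" "(\<lambda>e. P (e 0) (shift e)) = (\<lambda>e. \<exists>a. Q (push a e))" using assms(1) by (rule s1E)
  have P: "P x e \<longleftrightarrow> (\<exists>a. Q (push a (push x e)))" for x e
    using fun_cong[OF Q(2), of "push x e"] by simp
  show ?thesis
  proof (rule s1I[where Q = "\<lambda>e. \<exists>x. x \<prec> e 0 \<and> (\<exists>a. a \<prec> e 0 \<and> Q (push a (push x (shift e))))"])
    fix e
    have "\<exists>c. a \<prec> c \<and> b \<prec> c" for a b
      by (intro exI[of _ "a \<oplus> b \<oplus> \<one>"]) (simp add: less_succ_iff)
    then show "(\<exists>x. P x e) = (\<exists>a x. x \<prec> push a e 0 \<and> (\<exists>aa. aa \<prec> push a e 0 \<and> Q (push aa (push x (\<lambda>i. push a e (Suc i))))))"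
      unfolding P by simp blast
    have "d0 (\<lambda>e V. Q (push (e 0) (push (e 1) (\<lambda>i. e (Suc (Suc (Suc i)))))))"
      using d0_push2[OF Q(1), of "\<lambda>e. e 0" "\<lambda>e. e 1" "\<lambda>i e. e (Suc (Suc (Suc i)))"] by (simp add: tm_var tm_const)
    then show "d0 (\<lambda>e V. \<exists>x. x \<prec> e 0 \<and> (\<exists>a. a \<prec> e 0 \<and> Q (push a (push x (shift e)))))"
      by (intro d0_intros) simp
  qed
qed

lemma s1_push:
  assumes "s1 P" "tm t" "\<And>i. tm (s i)"
  shows "s1 (\<lambda>e. P (push (t e) (\<lambda>i. s i e)))"
proof -
  have "s1 (\<lambda>e. P (\<lambda>i. (case i of 0 \<Rightarrow> t | Suc j \<Rightarrow> s j) e))"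
    by (rule s1_ren[OF assms(1)]) (simp add: tm_case assms)
  then show ?thesis by (simp add: push_case)
qed

lemma f1_tm: "tm t \<Longrightarrow> f1 t"
  unfolding f1_def by (intro s1_d0 d0_intros tm_tl)

text \<open>The value of \<open>f\<close> is named by an existential quantifier, which the class
  absorbs. Applied to a predicate and to its complement, this gives closure of \<open>d1\<close>
  under composition.\<close>

lemma s1_subst:
  assumes "f1 f" "s1 (\<lambda>e. P (e 0) (shift e))" shows "s1 (\<lambda>e. P (f e) e)"
proof -
  have "s1 (\<lambda>e. \<exists>y. y = f e \<and> P y e)"
    using assms by (intro s1_ex s1_conj) (simp_all add: f1_def)
  then show ?thesis by simp
qed

text \<open>Sigma-1 collection, by induction on the number \<open>n\<close> of arguments already
  handled. Retaining the restriction to \<open>x \<prec> z\<close> makes the claim hold for every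
  \<open>n\<close>, and only the bound \<open>b\<close> is quantified unboundedly.\<close>

lemma s1_collection:
  assumes Q: "d0 (\<lambda>e V. Q e)" and *: "\<forall>x. x \<prec> z \<longrightarrow> (\<exists>a. Q (push a (push x e)))"
  shows "\<exists>b. \<forall>x. x \<prec> z \<longrightarrow> (\<exists>a. a \<prec> b \<and> Q (push a (push x e)))"
proof -
  let ?P = "\<lambda>b n. \<forall>x. x \<prec> n \<longrightarrow> x \<prec> z \<longrightarrow> (\<exists>a. a \<prec> b \<and> Q (push a (push x e)))"
  have "\<exists>b. ?P b z"
  proof (rule induction_ex[where P = "\<lambda>b n. ?P b n"])
    have "d0 (\<lambda>e' V. Q (push (e' 0) (push (e' 1) e)))"
      using d0_push2[OF Q, of "\<lambda>e. e 0" "\<lambda>e. e 1" "\<lambda>i _. e i"] by (simp add: tm_var tm_const)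
    then show "d0 (\<lambda>e' V. ?P (e' 0) (e' 1))"
      by (intro d0_intros) simp
    show "\<exists>b. ?P b \<zero>" by (simp add: not_less_zero_ax)
    fix n assume "\<exists>b. ?P b n"
    then obtain b where b: "?P b n" by blast
    show "\<exists>b. ?P b (suc n)"
    proof (cases "n \<prec> z")
      case True
      then obtain a where a: "Q (push a (push n e))" using * by blast
      let ?c = "b \<oplus> a \<oplus> \<one>"
      have "a \<prec> ?c" by (simp add: less_succ_iff)
      moreover have "x \<prec> ?c" if "x \<prec> b" for x
        using that le_add1[of b a] unfolding less_succ_iff by order
      ultimately have "?P ?c (suc n)"
        using a b unfolding less_succ_ax[of _ n] by blast
      then show ?thesis by blast
    next
      case False
      then have "?P b (suc n)" using b unfolding less_succ_ax[of _ n] by blast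
      then show ?thesis by blast
    qed
  qed
  then show ?thesis by blast
qed

lemma s1_ball_tm:
  assumes "tm t" "s1 (\<lambda>e. P (e 0) (shift e))" shows "s1 (\<lambda>e. \<forall>x. x \<prec> t e \<longrightarrow> P x e)"
proof -
  obtain Q where Q: "d0 (\<lambda>e V. Q e)" "(\<lambda>e. P (e 0) (shift e)) = (\<lambda>e. \<exists>a. Q (push a e))" using assms(2) by (rule s1E)
  have P: "P x e \<longleftrightarrow> (\<exists>a. Q (push a (push x e)))" for x e
    using fun_cong[OF Q(2), of "push x e"] by simp
  show ?thesis
  proof (rule s1I[where Q = "\<lambda>e. \<forall>x. x \<prec> t (shift e) \<longrightarrow> (\<exists>a. a \<prec> e 0 \<and> Q (push a (push x (shift e))))"])
    fix e
    show "(\<forall>x. x \<prec> t e \<longrightarrow> P x e) = (\<exists>b. \<forall>x. x \<prec> t (\<lambda>i. push b e (Suc i)) \<longrightarrow> (\<exists>aa. aa \<prec> push b e 0 \<and> Q (push aa (push x (\<lambda>i. push b e (Suc i))))))"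
      using s1_collection[OF Q(1), of "t e" e] unfolding P by simp blast
    have "d0 (\<lambda>e V. Q (push (e 0) (push (e 1) (\<lambda>i. e (Suc (Suc (Suc i)))))))"
      using d0_push2[OF Q(1), of "\<lambda>e. e 0" "\<lambda>e. e 1" "\<lambda>i e. e (Suc (Suc (Suc i)))"] by (simp add: tm_var tm_const)
    then show "d0 (\<lambda>e V. \<forall>x. x \<prec> t (shift e) \<longrightarrow> (\<exists>a. a \<prec> e 0 \<and> Q (push a (push x (shift e)))))"
      by (intro d0_intros tm_tl[OF assms(1)]) simp
  qed
qed

lemma s1_ball:
  assumes "f1 t" "s1 (\<lambda>e. P (e 0) (shift e))" shows "s1 (\<lambda>e. \<forall>x. x \<prec> t e \<longrightarrow> P x e)"
proof (rule s1_subst[OF assms(1), of "\<lambda>y e. \<forall>x. x \<prec> y \<longrightarrow> P x e"])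
  show "s1 (\<lambda>e. \<forall>x. x \<prec> e 0 \<longrightarrow> P x (shift e))"
  proof (rule s1_ball_tm)
    show "s1 (\<lambda>e. P (e 0) (\<lambda>i. e (Suc (Suc i))))"
      using s1_push[OF assms(2), of "\<lambda>e. e 0" "\<lambda>i e. e (Suc (Suc i))"] by (simp add: tm_var)
  qed (rule tm_var)
qed

lemma f1_tl: "f1 f \<Longrightarrow> f1 (\<lambda>e. f (shift e))"
  unfolding f1_def using s1_push[of "\<lambda>e. e 0 = f (shift e)" "\<lambda>e. e 0" "\<lambda>i e. e (Suc (Suc i))"] by (simp add: tm_var)

lemma f1_subst:
  assumes "f1 f" "f1 (\<lambda>e. g (e 0) (shift e))" shows "f1 (\<lambda>e. g (f e) e)"
  unfolding f1_def
proof (rule s1_subst[of "\<lambda>e. f (shift e)" "\<lambda>y e. e 0 = g y (shift e)"])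
  show "f1 (\<lambda>e. f (shift e))" using assms(1) by (rule f1_tl)
  have "s1 (\<lambda>e. (\<lambda>e. e 0 = g (e 1) (\<lambda>i. e (Suc (Suc i)))) (push (e 1) (push (e 0) (\<lambda>i. e (Suc (Suc i))))))"
    using assms(2) unfolding f1_def
    apply -
    apply (drule s1_push[where t = "\<lambda>e. e 1" and s = "\<lambda>i. case i of 0 \<Rightarrow> (\<lambda>e. e 0) | Suc j \<Rightarrow> (\<lambda>e. e (Suc (Suc j)))"])
    apply (simp_all add: tm_var tm_case)
    done
  then show "s1 (\<lambda>e. e (Suc 0) = g (e 0) (\<lambda>i. e (Suc (Suc i))))" by simp
qed

lemma d1_d0: "d0 (\<lambda>e V. P e) \<Longrightarrow> d1 P"
  unfolding d1_def by (intro conjI s1_d0 d0_not)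

lemma d1_ren: "d1 P \<Longrightarrow> (\<And>i. tm (s i)) \<Longrightarrow> d1 (\<lambda>e. P (\<lambda>i. s i e))"
  unfolding d1_def using s1_ren[of P s] s1_ren[of "\<lambda>e. \<not> P e" s] by simp

lemma d1_subst:
  assumes "f1 f" "d1 (\<lambda>e. P (e 0) (shift e))" shows "d1 (\<lambda>e. P (f e) e)"
  using assms(2) s1_subst[OF assms(1), of P] s1_subst[OF assms(1), of "\<lambda>x e. \<not> P x e"] unfolding d1_def by simp

lemma d1_not: "d1 P \<Longrightarrow> d1 (\<lambda>e. \<not> P e)"
  unfolding d1_def by simp

lemma d1I: "s1 P \<Longrightarrow> s1 (\<lambda>e. \<not> P e) \<Longrightarrow> d1 P"
  unfolding d1_def ..

lemma d1D: "d1 P \<Longrightarrow> s1 P" "d1 P \<Longrightarrow> s1 (\<lambda>e. \<not> P e)"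
  unfolding d1_def by blast+

lemma d1_conj: "d1 P \<Longrightarrow> d1 Q \<Longrightarrow> d1 (\<lambda>e. P e \<and> Q e)"
  by (rule d1I, erule s1_conj[OF d1D(1) d1D(1)], assumption, unfold de_Morgan_conj, erule s1_disj[OF d1D(2) d1D(2)], assumption)

lemma d1_disj:
  assumes "d1 P" "d1 Q" shows "d1 (\<lambda>e. P e \<or> Q e)"
  using d1_not[OF d1_conj[OF assms[THEN d1_not]]] by simp

lemma d1_imp:
  assumes "d1 P" "d1 Q" shows "d1 (\<lambda>e. P e \<longrightarrow> Q e)"
  using d1_not[OF d1_conj[OF assms(1) assms(2)[THEN d1_not]]] by simp

lemma d1_iff:
  assumes "d1 P" "d1 Q" shows "d1 (\<lambda>e. P e \<longleftrightarrow> Q e)"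
  using d1_conj[OF d1_imp[OF assms] d1_imp[OF assms(2,1)]] by (simp add: iff_conv_conj_imp)

lemma d1_less: "f1 s \<Longrightarrow> f1 t \<Longrightarrow> d1 (\<lambda>e. s e \<prec> t e)"
  by (rule d1_subst[of s "\<lambda>x e. x \<prec> t e"], assumption, rule d1_subst[of "\<lambda>e. t (shift e)" "\<lambda>x e. e 0 \<prec> x"]) (erule f1_tl, intro d1_d0 d0_intros)

lemma d1_eq: "f1 s \<Longrightarrow> f1 t \<Longrightarrow> d1 (\<lambda>e. s e = t e)"
  by (rule d1_subst[of s "\<lambda>x e. x = t e"], assumption, rule d1_subst[of "\<lambda>e. t (shift e)" "\<lambda>x e. e 0 = x"]) (erule f1_tl, intro d1_d0 d0_intros)

lemma d1_le: "f1 s \<Longrightarrow> f1 t \<Longrightarrow> d1 (\<lambda>e. s e \<preceq> t e)"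
  unfolding le_def by (intro d1_disj d1_less d1_eq)

lemma d1_mem: "f1 s \<Longrightarrow> A \<in> Sets M \<Longrightarrow> d1 (\<lambda>e. s e \<in> A)"
  by (rule d1_subst[of s "\<lambda>x e. x \<in> A"], assumption) (intro d1_d0 d0_intros)

lemmas s1_less = d1D(1)[OF d1_less]

lemma s1_bex:
  assumes "f1 t" "s1 (\<lambda>e. P (e 0) (shift e))" shows "s1 (\<lambda>e. \<exists>x. x \<prec> t e \<and> P x e)"
  by (intro s1_ex s1_conj s1_less f1_tl f1_tm tm_var assms)

lemma d1_bex:
  assumes "f1 t" "d1 (\<lambda>e. P (e 0) (shift e))" shows "d1 (\<lambda>e. \<exists>x. x \<prec> t e \<and> P x e)"
  using assms(2) s1_bex[OF assms(1), of P] s1_ball[OF assms(1), of "\<lambda>x e. \<not> P x e"] unfolding d1_def by simp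

lemma d1_ball:
  assumes "f1 t" "d1 (\<lambda>e. P (e 0) (shift e))" shows "d1 (\<lambda>e. \<forall>x. x \<prec> t e \<longrightarrow> P x e)"
  using assms(2) s1_ball[OF assms(1), of P] s1_bex[OF assms(1), of "\<lambda>x e. \<not> P x e"] unfolding d1_def by simp

lemma f1_app1:
  assumes "computable g" "f1 s" shows "f1 (\<lambda>e. g (s e))"
  by (rule f1_subst[of s "\<lambda>x e. g x"]) (simp_all add: assms)

lemma f1_ren: "f1 f \<Longrightarrow> (\<And>i. tm (s i)) \<Longrightarrow> f1 (\<lambda>e. f (\<lambda>i. s i e))"
  unfolding f1_def using s1_push[of "\<lambda>e. e 0 = f (shift e)" "\<lambda>e. e 0" "\<lambda>i e. s i (shift e)"]
  by (simp add: tm_var tm_tl)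

lemma f1_app2:
  assumes "f1 (\<lambda>e. g (e 0) (e 1))" "f1 s" "f1 t" shows "f1 (\<lambda>e. g (s e) (t e))"
proof (rule f1_subst[of s "\<lambda>x e. g x (t e)"])
  have "f1 (\<lambda>e. g (e 1) (e 0))"
    using f1_ren[OF assms(1), of "\<lambda>i e. if i = 0 then e 1 else e 0"] by (simp add: tm_var tm_if)
  then show "f1 (\<lambda>e. g (e 0) (t (shift e)))"
    by (intro f1_subst[of "\<lambda>e. t (shift e)" "\<lambda>x e. g (e 0) x"] f1_tl assms) simp
qed (rule assms)

lemma d1_app1:
  assumes "d1 (\<lambda>e. g (e 0))" "f1 s" shows "d1 (\<lambda>e. g (s e))"
  by (rule d1_subst[of s "\<lambda>x e. g x"]) (simp_all add: assms)

lemma d1_app2: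
  assumes "d1 (\<lambda>e. g (e 0) (e 1))" "f1 s" "f1 t" shows "d1 (\<lambda>e. g (s e) (t e))"
proof (rule d1_subst[of s "\<lambda>x e. g x (t e)"])
  have "d1 (\<lambda>e. g (e 1) (e 0))"
    using d1_ren[OF assms(1), of "\<lambda>i e. if i = 0 then e 1 else e 0"] by (simp add: tm_var tm_if)
  then show "d1 (\<lambda>e. g (e 0) (t (shift e)))"
    by (intro d1_subst[of "\<lambda>e. t (shift e)" "\<lambda>x e. g (e 0) x"] f1_tl assms) simp
qed (rule assms)

lemma f1_add: "f1 s \<Longrightarrow> f1 t \<Longrightarrow> f1 (\<lambda>e. s e \<oplus> t e)"
  by (rule f1_app2) (intro f1_tm tm.intros)

lemma f1_mul: "f1 s \<Longrightarrow> f1 t \<Longrightarrow> f1 (\<lambda>e. s e \<otimes> t e)"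
  by (rule f1_app2) (intro f1_tm tm.intros)

lemmas f1_var = f1_tm[OF tm_var]
lemmas f1_const = f1_tm[OF tm_const]

lemma f1I:
  assumes "d1 (\<lambda>e. e 0 = f (shift e))" shows "f1 f"
  using assms unfolding f1_def d1_def by blast

lemma f1_if:
  assumes "d1 P" "f1 s" "f1 t" shows "f1 (\<lambda>e. if P e then s e else t e)"
proof (rule f1I)
  have "d1 (\<lambda>e. (P (shift e) \<longrightarrow> e 0 = s (shift e)) \<and> (\<not> P (shift e) \<longrightarrow> e 0 = t (shift e)))"
    by (intro d1_conj d1_imp d1_eq d1_not d1_ren[OF assms(1)] f1_tl assms f1_tm tm_var)
  then show "d1 (\<lambda>e. e 0 = (if P (shift e) then s (shift e) else t (shift e)))"
    by (rule back_subst[of d1]) (rule ext, simp)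
qed

lemmas d1_intros = d1_less d1_le d1_mem d1_not d1_conj d1_disj d1_imp d1_iff d1_bex d1_ball d1_eq
lemmas f1_intros = f1_var f1_const f1_add f1_mul f1_if

lemma d0_push1: "d0 (\<lambda>e V. Q e) \<Longrightarrow> d0 (\<lambda>e V. Q (push (e 0) (push (e 1) (\<lambda>i. c))))"
  using d0_push2[of "\<lambda>e V. Q e" "\<lambda>e. e 0" "\<lambda>e. e 1" "\<lambda>i _. c"] by (simp add: tm_var tm_const)

section \<open>Comprehension, induction and least elements for Delta-1 predicates\<close>

lemma comprehension:
  assumes "d1 (\<lambda>e. P (e 0))" shows "{x. P x} \<in> Sets M"
proof -
  obtain Q where Q: "d0 (\<lambda>e V. Q e)" "(\<lambda>e. P (e 0)) = (\<lambda>e. \<exists>a. Q (push a e))" using assms unfolding d1_def by (blast elim: s1E)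
  obtain Q' where Q': "d0 (\<lambda>e V. Q' e)" "(\<lambda>e. \<not> P (e 0)) = (\<lambda>e. \<exists>a. Q' (push a e))" using assms unfolding d1_def by (blast elim: s1E)
  \<comment> \<open>Since \<open>P\<close> reads only position 0, the other positions can be filled
    with \<open>\<zero>\<close>.\<close>
  have P: "P x \<longleftrightarrow> (\<exists>a. Q (push a (push x (\<lambda>_. \<zero>))))" "\<not> P x \<longleftrightarrow> (\<exists>a. Q' (push a (push x (\<lambda>_. \<zero>))))" for x
    using fun_cong[OF Q(2), of "push x (\<lambda>_. \<zero>)"] fun_cong[OF Q'(2), of "push x (\<lambda>_. \<zero>)"] by simp_all
  have "{x. \<exists>a. Q (push a (push x (\<lambda>_. \<zero>)))} \<in> Sets M"
    by (rule comprehension2[OF d0_push1[OF Q(1), of \<zero>] d0_push1[OF Q'(1), of \<zero>]]) (simp add: P[symmetric])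
  then show ?thesis by (simp add: P(1)[symmetric])
qed

lemma induction_s1:
  assumes "s1 (\<lambda>e. P (e 0))" "P \<zero>" "\<And>n. P n \<Longrightarrow> P (suc n)" shows "P n"
proof -
  obtain Q where Q: "d0 (\<lambda>e V. Q e)" "(\<lambda>e. P (e 0)) = (\<lambda>e. \<exists>a. Q (push a e))" using assms(1) by (blast elim: s1E)
  have P: "P x \<longleftrightarrow> (\<exists>a. Q (push a (push x (\<lambda>_. \<zero>))))" for x
    using fun_cong[OF Q(2), of "push x (\<lambda>_. \<zero>)"] by simp_all
  have "\<exists>a. Q (push a (push n (\<lambda>_. \<zero>)))"
    by (rule induction_ex[OF d0_push1[OF Q(1), of \<zero>]]) (use assms(2,3) in \<open>simp_all add: P[symmetric]\<close>)
  then show ?thesis by (simp add: P)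
qed

lemma induction_d1:
  assumes "d1 (\<lambda>e. P (e 0))" "P \<zero>" "\<And>n. P n \<Longrightarrow> P (suc n)" shows "P n"
  using assms unfolding d1_def by (blast intro: induction_s1)

text \<open>The induction shows that an example below \<open>n\<close> yields a least example. That
  conclusion does not mention \<open>n\<close>, hence counts as a constant truth value, and the
  induction predicate stays \<open>\<Sigma>\<^sup>0\<^sub>1\<close>.\<close>

lemma least_d1:
  assumes "d1 (\<lambda>e. P (e 0))" "P n" shows "\<exists>m. P m \<and> (\<forall>k. k \<prec> m \<longrightarrow> \<not> P k)"
proof -
  have "(\<exists>x. x \<prec> suc n \<and> P x) \<longrightarrow> (\<exists>m. P m \<and> (\<forall>k. k \<prec> m \<longrightarrow> \<not> P k))"
  proof (rule induction_s1[where P = "\<lambda>n. (\<exists>x. x \<prec> n \<and> P x) \<longrightarrow> (\<exists>m. P m \<and> (\<forall>k. k \<prec> m \<longrightarrow> \<not> P k))"])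
    have "s1 (\<lambda>e. \<not> (\<exists>x. x \<prec> e 0 \<and> P x))"
      using d1_bex[OF f1_var[of 0], of "\<lambda>x e. P x"] assms unfolding d1_def by simp
    then have "s1 (\<lambda>e. \<not> (\<exists>x. x \<prec> e 0 \<and> P x) \<or> (\<exists>m. P m \<and> (\<forall>k. k \<prec> m \<longrightarrow> \<not> P k)))"
      by (rule s1_disj[OF _ s1_d0[OF d0_const]])
    then show "s1 (\<lambda>e. (\<exists>x. x \<prec> e 0 \<and> P x) \<longrightarrow> (\<exists>m. P m \<and> (\<forall>k. k \<prec> m \<longrightarrow> \<not> P k)))"
      by (rule back_subst[of s1]) (intro ext, blast)
    fix n assume IH: "(\<exists>x. x \<prec> n \<and> P x) \<longrightarrow> (\<exists>m. P m \<and> (\<forall>k. k \<prec> m \<longrightarrow> \<not> P k))"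
    show "(\<exists>x. x \<prec> suc n \<and> P x) \<longrightarrow> (\<exists>m. P m \<and> (\<forall>k. k \<prec> m \<longrightarrow> \<not> P k))"
      using IH unfolding less_succ_ax by blast
  qed (simp add: not_less_zero_ax)
  then show ?thesis using assms(2) less_succ_ax by blast
qed


lemmas semiring_M = mul_add M.distrib_right add_assoc_M add_comm add_lcomm mul_assoc mul_comm M.mult.left_commute mul_one

section \<open>Pairs\<close>

lemma le_square: "x \<preceq> x \<otimes> x"
proof -
  consider "x = \<zero>" | m where "x = suc m" using zero_or_succ by blast
  then show ?thesis
  proof cases
    case (2 m)
    then have "x \<otimes> x = x \<otimes> m \<oplus> x" using mul_succ_ax by simp
    then show ?thesis by simp
  qed simp
qed

text \<open>The gap between consecutive squares: \<open>a \<otimes> a \<oplus> i\<close> with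
  \<open>i \<preceq> a\<close> is below the square of \<open>suc a\<close>. Hence the code of a pair
  determines the sum of its components, and then the components.\<close>

lemma square_less:
  assumes "a \<prec> b" "i \<preceq> a" shows "a \<otimes> a \<oplus> i \<prec> b \<otimes> b \<oplus> k"
proof -
  have "suc a \<preceq> b" using assms(1) by (simp add: less_imp_succ_le)
  then have "suc a \<otimes> suc a \<preceq> b \<otimes> b" by (intro M.mult_mono) simp_all
  moreover have "suc a \<otimes> suc a = (a \<otimes> a \<oplus> a) \<oplus> a \<oplus> \<one>" by (simp only: semiring_M)
  moreover have "(a \<otimes> a \<oplus> a) \<prec> (a \<otimes> a \<oplus> a) \<oplus> a \<oplus> \<one>" by (simp add: less_succ_iff)
  moreover have "a \<otimes> a \<oplus> i \<preceq> a \<otimes> a \<oplus> a" using assms(2) by simp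
  moreover have "b \<otimes> b \<preceq> b \<otimes> b \<oplus> k" by simp
  ultimately show ?thesis by order
qed

lemma pair_inj [simp]: "\<langle>i, j\<rangle> = \<langle>k, l\<rangle> \<longleftrightarrow> i = k \<and> j = l"
proof
  assume *: "\<langle>i, j\<rangle> = \<langle>k, l\<rangle>"
  have 1: "\<not> i \<oplus> j \<prec> k \<oplus> l" using square_less[of "i \<oplus> j" "k \<oplus> l" i k] * unfolding pair_def by auto
  have "\<not> k \<oplus> l \<prec> i \<oplus> j" using square_less[of "k \<oplus> l" "i \<oplus> j" k i] * unfolding pair_def by auto
  with 1 have "i \<oplus> j = k \<oplus> l" by order
  moreover from * this have "i = k" unfolding pair_def by simp
  ultimately show "i = k \<and> j = l" by simp
qed simp

lemma pair_ge1: "i \<preceq> \<langle>i, j\<rangle>"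
  unfolding pair_def by simp

lemma pair_ge2: "j \<preceq> \<langle>i, j\<rangle>"
proof -
  have "j \<preceq> i \<oplus> j" by simp
  moreover have "(i \<oplus> j) \<otimes> (i \<oplus> j) \<preceq> \<langle>i, j\<rangle>" unfolding pair_def by simp
  moreover note le_square[of "i \<oplus> j"]
  ultimately show ?thesis by order
qed

lemma tm_pair: "tm s \<Longrightarrow> tm t \<Longrightarrow> tm (\<lambda>e. \<langle>s e, t e\<rangle>)"
  unfolding pair_def by (intro tm.intros)

lemma f1_pair: "f1 s \<Longrightarrow> f1 t \<Longrightarrow> f1 (\<lambda>e. \<langle>s e, t e\<rangle>)"
  unfolding pair_def by (intro f1_intros)

section \<open>Codes of finite sets\<close>

text \<open>Bounding the quotient makes divisibility \<open>\<Sigma>\<^sup>0\<^sub>0\<close>. If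
  \<open>a = \<zero>\<close>, any quotient is possible, and \<open>\<zero>\<close> is taken.\<close>

lemma divides_bounded: "divides a b \<longleftrightarrow> (\<exists>q. q \<prec> suc b \<and> b = a \<otimes> q)"
proof
  assume "divides a b"
  then obtain q where q: "b = a \<otimes> q" unfolding divides_def by blast
  show "\<exists>q. q \<prec> suc b \<and> b = a \<otimes> q"
  proof (cases "a = \<zero>")
    case True
    then have "b = a \<otimes> \<zero>" using q by simp
    then show ?thesis by (intro exI[of _ \<zero>]) (simp add: less_succ_iff)
  next
    case False
    then obtain m where "a = suc m" using zero_or_succ by blast
    then have "b = m \<otimes> q \<oplus> q" using q by (simp add: succ_mul)
    then show ?thesis using q by (intro exI[of _ q]) (simp add: less_succ_iff)
  qed
qed (auto simp: divides_def)

lemma divides_mult: "divides a b \<Longrightarrow> divides a (b \<otimes> c)" "divides a b \<Longrightarrow> divides a (c \<otimes> b)"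
  unfolding divides_def by (metis mul_assoc mul_comm)+

lemma divides_add_cancel:
  assumes "divides a (b \<oplus> c)" "divides a b" shows "divides a c"
proof -
  obtain x y where "b = a \<otimes> x" "b \<oplus> c = a \<otimes> y" using assms unfolding divides_def by blast
  then have "a \<otimes> (y \<ominus> x) = c" by (metis mul_monus monus_add)
  then show ?thesis unfolding divides_def by blast
qed

lemma d0_divides: "tm s \<Longrightarrow> tm t \<Longrightarrow> d0 (\<lambda>e V. divides (s e) (t e))"
  unfolding divides_bounded by (intro d0_intros tm_tl)

text \<open>A substitute for the factorial that presupposes no coding of sequences: each induction
  step multiplies by the next number.\<close>

lemma common_multiple: "\<exists>m. m \<noteq> \<zero> \<and> (\<forall>d. d \<prec> suc k \<longrightarrow> d \<noteq> \<zero> \<longrightarrow> divides d m)" (is "?P k")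
proof (rule induction_s1[where P = "?P"])
  show "s1 (\<lambda>e. ?P (e 0))"
    by (intro s1_ex s1_d0 d0_intros d0_divides)
  show "?P \<zero>"
    by (intro exI[of _ \<one>]) (simp only: less_succ_ax, simp add: not_less_zero_ax)
  fix k assume "?P k"
  then obtain m where m: "m \<noteq> \<zero>" "\<And>d. d \<prec> suc k \<Longrightarrow> d \<noteq> \<zero> \<Longrightarrow> divides d m" by blast
  have "m \<otimes> suc k \<noteq> \<zero>" using m(1) succ_neq_zero mul_eq_zero by blast
  moreover have "divides d (m \<otimes> suc k)" if "d \<prec> suc k \<oplus> \<one>" "d \<noteq> \<zero>" for d
    using that(1) m(2)[OF _ that(2)] unfolding less_succ_ax[of _ "suc k"]
    by (metis divides_mult divides_def mul_comm)
  ultimately show "?P (suc k)" by blast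
qed

text \<open>Neighbours are coprime, because x = x (p + 1) - x p.\<close>

lemma divides_cancel_succ:
  assumes "divides (suc p) (x \<otimes> p)" shows "divides (suc p) x"
proof -
  have "x \<otimes> suc p = x \<otimes> p \<oplus> x" by (simp add: mul_add mul_one)
  then have "divides (suc p) (x \<otimes> p \<oplus> x)" unfolding divides_def by (metis mul_comm)
  then show ?thesis using assms by (rule divides_add_cancel)
qed

abbreviation modulus :: "'a \<Rightarrow> 'a \<Rightarrow> 'a" where
  "modulus m i \<equiv> m \<otimes> suc i \<oplus> \<one>"

text \<open>The numbers \<open>modulus m i = m (i + 1) + 1\<close>, \<open>i < k\<close>, are pairwise coprime when \<open>m\<close> is divisible by all
  positive \<open>d \<le> k\<close>: modulo the \<open>i\<close>-th one, \<open>m (i + 1)\<close> is \<open>-1\<close>, and the difference of two of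
  them divides a power of \<open>m\<close>.\<close>

lemma divides_moduli:
  assumes m: "\<And>d. d \<prec> suc k \<Longrightarrow> d \<noteq> \<zero> \<Longrightarrow> divides d m"
    and ij: "i \<prec> k" "j \<prec> k" "i \<noteq> j"
    and dv: "divides (modulus m i) (n \<otimes> (modulus m j))"
  shows "divides (modulus m i) n"
proof -
  let ?a = "modulus m i"
  have self: "divides ?a (n \<otimes> ?a)" unfolding divides_def by (metis mul_comm)
  have "\<exists>d. d \<noteq> \<zero> \<and> d \<prec> suc k \<and> divides ?a (n \<otimes> (m \<otimes> d))"
  proof (cases "i \<prec> j")
    case True
    then obtain c where j: "j = i \<oplus> suc c" unfolding less_iff_add by blast
    have "n \<otimes> (modulus m j) = n \<otimes> ?a \<oplus> n \<otimes> (m \<otimes> suc c)" unfolding j by (simp only: semiring_M)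
    then have "divides ?a (n \<otimes> (m \<otimes> suc c))" using divides_add_cancel dv self by metis
    moreover have "suc c \<prec> suc k" using ij(2) le_add2[of "suc c" i] unfolding j less_succ_iff by order
    ultimately show ?thesis using succ_neq_zero by blast
  next
    case False
    then have "j \<prec> i" using ij(3) by order
    then obtain c where i: "i = j \<oplus> suc c" unfolding less_iff_add by blast
    have "n \<otimes> ?a = n \<otimes> (modulus m j) \<oplus> n \<otimes> (m \<otimes> suc c)" unfolding i by (simp only: semiring_M)
    then have "divides ?a (n \<otimes> (m \<otimes> suc c))" using divides_add_cancel dv self by metis
    moreover have "suc c \<prec> suc k" using ij(1) le_add2[of "suc c" j] unfolding i less_succ_iff by order
    ultimately show ?thesis using succ_neq_zero by blast
  qed
  then obtain d where d: "d \<noteq> \<zero>" "d \<prec> suc k" "divides ?a (n \<otimes> (m \<otimes> d))" by blast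
  then obtain q where q: "m = d \<otimes> q" using m unfolding divides_def by blast
  \<comment> \<open>As m = d q, multiplying n m d by q and the square of i + 1 gives n times the
    square of m (i + 1). The two factors m (i + 1) are then cancelled one after the other.\<close>
  have eq: "(n \<otimes> (m \<otimes> d)) \<otimes> (q \<otimes> ((suc i) \<otimes> suc i)) = (n \<otimes> (m \<otimes> suc i)) \<otimes> ((d \<otimes> q) \<otimes> suc i)"
    by (simp only: semiring_M)
  have "divides ?a ((n \<otimes> (m \<otimes> suc i)) \<otimes> (m \<otimes> suc i))"
    using divides_mult(1)[OF d(3), of "q \<otimes> ((suc i) \<otimes> suc i)"] unfolding eq q[symmetric] .
  then show ?thesis by (rule divides_cancel_succ[OF divides_cancel_succ])
qed

text \<open>The code is the product of the moduli whose index is below \<open>l\<close> and in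
  \<open>A\<close>; by coprimality no other modulus divides it.\<close>

lemma moduli_code:
  assumes m: "m \<noteq> \<zero>" "\<And>d. d \<prec> suc k \<Longrightarrow> d \<noteq> \<zero> \<Longrightarrow> divides d m" and A: "A \<in> Sets M"
  shows "\<exists>n. \<forall>i. i \<prec> k \<longrightarrow> (divides (modulus m i) n \<longleftrightarrow> i \<prec> l \<and> i \<in> A)" (is "?P l")
proof (rule induction_s1[where P = "?P"])
  show "s1 (\<lambda>e. ?P (e 0))"
    by (intro s1_ex s1_d0 d0_intros d0_divides A)
  \<comment> \<open>The induction starts with the empty product; \<open>m \<noteq> \<zero>\<close>
    makes every modulus exceed 1.\<close>
  have "\<not> divides (modulus m i) \<one>" for i
  proof
    assume "divides (modulus m i) \<one>"
    then obtain q where q: "\<one> = (modulus m i) \<otimes> q" unfolding divides_def by blast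
    then have "q \<noteq> \<zero>" by (metis mul_zero_ax M.zero_neq_one)
    then obtain p where "q = suc p" using zero_or_succ by blast
    with q have "\<zero> \<oplus> \<one> = ((modulus m i) \<otimes> p \<oplus> m \<otimes> suc i) \<oplus> \<one>"
      by (simp add: mul_succ_ax add_assoc_M zero_add)
    then have "m \<otimes> suc i = \<zero>" using succ_inj add_eq_zero by metis
    then show False using m(1) succ_neq_zero mul_eq_zero by blast
  qed
  then show "?P \<zero>"
    by (intro exI[of _ \<one>]) (simp add: not_less_zero_ax)
  fix l assume "?P l"
  then obtain n where n: "\<And>i. i \<prec> k \<Longrightarrow> (divides (modulus m i) n \<longleftrightarrow> i \<prec> l \<and> i \<in> A)" by blast
  show "?P (suc l)"
  proof (cases "l \<prec> k \<and> l \<in> A")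
    case True
    let ?n = "n \<otimes> (modulus m l)"
    have "divides (modulus m i) ?n \<longleftrightarrow> i \<prec> suc l \<and> i \<in> A" if "i \<prec> k" for i
    proof (cases "i = l")
      case i: True
      have "divides (modulus m i) ?n" unfolding i divides_def by (metis mul_comm)
      then show ?thesis using i True by (simp add: less_succ_iff)
    next
      case False
      have "divides (modulus m i) ?n \<longleftrightarrow> divides (modulus m i) n"
        using divides_moduli[OF m(2) \<open>i \<prec> k\<close> _ False] True divides_mult(1) by blast
      then show ?thesis using n[OF that] False by (simp add: less_succ_ax)
    qed
    then show ?thesis by blast
  next
    case False
    then show ?thesis using n by (intro exI[of _ n]) (auto simp: less_succ_ax)
  qed
qed

lemma elem_triple: "elem i \<langle>k, \<langle>m, n\<rangle>\<rangle> \<longleftrightarrow> i \<prec> k \<and> divides (modulus m i) n"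
  unfolding elem_def by auto

lemma elem_less: "elem i c \<Longrightarrow> i \<prec> c"
  unfolding elem_def using pair_ge1 M.less_le_trans by blast

text \<open>Components never exceed the code, which is why \<open>elem\<close> and
  \<open>is_triple\<close> turn out to be \<open>\<Sigma>\<^sup>0\<^sub>0\<close>.\<close>

lemma triple_bounded:
  "(\<exists>k m n. c = \<langle>k, \<langle>m, n\<rangle>\<rangle> \<and> P k m n) \<longleftrightarrow>
   (\<exists>k. k \<prec> suc c \<and> (\<exists>m. m \<prec> suc c \<and> (\<exists>n. n \<prec> suc c \<and> c = \<langle>k, \<langle>m, n\<rangle>\<rangle> \<and> P k m n)))"
proof -
  have "k \<preceq> \<langle>k, \<langle>m, n\<rangle>\<rangle>" "m \<preceq> \<langle>k, \<langle>m, n\<rangle>\<rangle>" "n \<preceq> \<langle>k, \<langle>m, n\<rangle>\<rangle>" for k m n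
    using pair_ge1[of k "\<langle>m, n\<rangle>"] pair_ge2[of "\<langle>m, n\<rangle>" k] pair_ge1[of m n] pair_ge2[of n m] by order+
  then show ?thesis unfolding less_succ_iff by blast
qed

lemma d0_elem: "tm s \<Longrightarrow> tm t \<Longrightarrow> d0 (\<lambda>e V. elem (s e) (t e))"
  unfolding elem_def triple_bounded by (intro d0_intros d0_divides tm_pair tm_tl)

lemma d0_is_triple: "tm t \<Longrightarrow> d0 (\<lambda>e V. is_triple (t e))"
  using triple_bounded[of _ "\<lambda>_ _ _. True"] unfolding is_triple_def
  by simp (intro d0_intros tm_pair tm_tl)

lemma code_exists:
  assumes "A \<in> Sets M" shows "\<exists>c. is_triple c \<and> (\<forall>i. elem i c \<longleftrightarrow> i \<prec> k \<and> i \<in> A)"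
proof -
  obtain m where m: "m \<noteq> \<zero>" "\<And>d. d \<prec> suc k \<Longrightarrow> d \<noteq> \<zero> \<Longrightarrow> divides d m" using common_multiple by blast
  obtain n where n: "\<And>i. i \<prec> k \<Longrightarrow> (divides (modulus m i) n \<longleftrightarrow> i \<prec> k \<and> i \<in> A)"
    using moduli_code[OF m assms] by blast
  have "elem i \<langle>k, \<langle>m, n\<rangle>\<rangle> \<longleftrightarrow> i \<prec> k \<and> i \<in> A" for i
    using n unfolding elem_triple by blast
  then show ?thesis unfolding is_triple_def by blast
qed

lemma finset_exists:
  assumes "A \<in> Sets M" shows "\<exists>c. is_finset c \<and> (\<forall>i. elem i c \<longleftrightarrow> i \<prec> k \<and> i \<in> A)"
proof -
  obtain c0 where c0: "is_triple c0" "\<And>i. elem i c0 \<longleftrightarrow> i \<prec> k \<and> i \<in> A" using code_exists[OF assms] by blast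
  \<comment> \<open>The elements of a code are smaller than the code, so agreement below
    \<open>c \<oplus> c0\<close> is full agreement, and the least number principle applies to the
    bounded form.\<close>
  let ?P = "\<lambda>c. is_triple c \<and> (\<forall>i. i \<prec> c \<oplus> c0 \<longrightarrow> (elem i c \<longleftrightarrow> elem i c0))"
  have "d1 (\<lambda>e. ?P (e 0))" by (intro d1_d0 d0_intros d0_elem d0_is_triple)
  then obtain c where c: "?P c" "\<And>d. d \<prec> c \<Longrightarrow> \<not> ?P d"
    using least_d1[of ?P c0] c0(1) by blast
  have 1: "i \<prec> d \<oplus> c0" if "elem i d \<or> elem i c0" for i d
    using that
  proof
    assume "elem i d" from elem_less[OF this] show ?thesis using le_add1[of d c0] by order
  next
    assume "elem i c0" from elem_less[OF this] show ?thesis using le_add2[of c0 d] by order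
  qed
  have 2: "elem i c \<longleftrightarrow> elem i c0" for i using c(1) 1 by blast
  have "is_finset c" unfolding is_finset_def
  proof (intro conjI allI impI)
    fix d assume d: "d \<prec> c \<and> is_triple d"
    then show "\<exists>i. elem i d \<noteq> elem i c" using c(2)[of d] 2 by blast
  qed (use c in blast)
  with 2 c0(2) show ?thesis by blast
qed

lemma finset_ext:
  assumes "is_finset c" "is_finset d" "\<And>i. elem i c \<longleftrightarrow> elem i d" shows "c = d"
proof -
  have "\<not> c \<prec> d" "\<not> d \<prec> c" using assms unfolding is_finset_def by blast+
  then show ?thesis by order
qed

lemma d0_is_finset:
  assumes "tm t" shows "d0 (\<lambda>e V. is_finset (t e))"
proof -
  have *: "(\<exists>i. elem i d \<noteq> elem i c) \<longleftrightarrow> (\<exists>i. i \<prec> d \<oplus> c \<and> elem i d \<noteq> elem i c)" for c d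
    using elem_less[of _ d] elem_less[of _ c] le_add1[of d c] le_add2[of c d]
    by (metis M.less_le_trans)
  have **: "(\<forall>d. d \<prec> c \<and> is_triple d \<longrightarrow> X d) \<longleftrightarrow> (\<forall>d. d \<prec> c \<longrightarrow> is_triple d \<longrightarrow> X d)" for c X
    by blast
  show ?thesis
    unfolding is_finset_def * ** by (intro d0_intros d0_elem d0_is_triple tm_tl assms)
qed

section \<open>Finite sequences\<close>

lemma has_length_unique: "has_length s l \<Longrightarrow> has_length s l' \<Longrightarrow> l = l'"
  unfolding has_length_def by (metis M.less_irrefl M.linorder_cases)

lemma entry_less: "entry s i j \<Longrightarrow> i \<prec> s" "entry s i j \<Longrightarrow> j \<prec> s"
  using elem_less[of "\<langle>i, j\<rangle>" s] M.le_less_trans[OF pair_ge1[of i j]] M.le_less_trans[OF pair_ge2[of j i]]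
  unfolding entry_def by blast+

lemma has_length_bounded:
  "has_length s l \<longleftrightarrow> (\<forall>i. i \<prec> l \<longrightarrow> (\<exists>j. j \<prec> s \<and> entry s i j)) \<and>
     (\<forall>i. i \<prec> s \<longrightarrow> (\<forall>j. j \<prec> s \<longrightarrow> entry s i j \<longrightarrow> i \<prec> l))"
  unfolding has_length_def using entry_less by blast

lemma d0_entry: "tm s \<Longrightarrow> tm t \<Longrightarrow> tm u \<Longrightarrow> d0 (\<lambda>e V. entry (s e) (t e) (u e))"
  unfolding entry_def by (intro d0_elem tm_pair)

lemma d0_has_length: "tm s \<Longrightarrow> tm t \<Longrightarrow> d0 (\<lambda>e V. has_length (s e) (t e))"
  unfolding has_length_bounded by (intro d0_intros d0_entry tm_tl)

lemma has_length_le: "has_length s l \<Longrightarrow> l \<preceq> s"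
  unfolding has_length_def using entry_less by (metis M.less_irrefl M.not_less)

lemma is_seq_bounded:
  "is_seq s \<longleftrightarrow> is_finset s \<and>
     (\<forall>n. n \<prec> s \<longrightarrow> elem n s \<longrightarrow> (\<exists>i. i \<prec> s \<and> (\<exists>j. j \<prec> s \<and> n = \<langle>i, j\<rangle>))) \<and>
     (\<forall>i. i \<prec> s \<longrightarrow> (\<forall>j. j \<prec> s \<longrightarrow> (\<forall>k. k \<prec> s \<longrightarrow> entry s i j \<and> entry s i k \<longrightarrow> j = k))) \<and>
     (\<exists>l. l \<prec> suc s \<and> has_length s l)" (is "?L \<longleftrightarrow> ?R")
proof
  have *: "elem n s \<Longrightarrow> n = \<langle>i, j\<rangle> \<Longrightarrow> i \<prec> s \<and> j \<prec> s \<and> n \<prec> s" for n i j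
    using entry_less[of s i j] elem_less[of n s] unfolding entry_def by blast
  assume ?L
  then show ?R unfolding is_seq_def less_succ_iff using * has_length_le by metis
next
  assume ?R
  then show ?L unfolding is_seq_def using entry_less elem_less by metis
qed

lemma d0_is_seq: "tm t \<Longrightarrow> d0 (\<lambda>e V. is_seq (t e))"
  unfolding is_seq_bounded by (intro d0_intros d0_entry d0_has_length d0_is_finset d0_elem tm_pair tm_tl)

text \<open>On arguments that are not sequences, \<open>len\<close> and \<open>nth\<close> return \<open>\<zero>\<close>; so does \<open>nth\<close> beyond the
  length of a sequence.\<close>

definition len :: "'a \<Rightarrow> 'a" where
  "len s = (if is_seq s then THE l. has_length s l else \<zero>)"

definition nth :: "'a \<Rightarrow> 'a \<Rightarrow> 'a" where
  "nth s i = (if is_seq s \<and> i \<prec> len s then THE j. entry s i j else \<zero>)"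

lemma has_length_iff: "is_seq s \<Longrightarrow> has_length s l \<longleftrightarrow> len s = l"
proof -
  assume s: "is_seq s"
  then obtain k where k: "has_length s k" unfolding is_seq_def by blast
  then have "len s = k" using s has_length_unique unfolding len_def by (simp add: the_equality)
  then show ?thesis using k has_length_unique by blast
qed

lemma entry_iff:
  assumes "is_seq s" shows "entry s i j \<longleftrightarrow> i \<prec> len s \<and> nth s i = j"
proof -
  have "has_length s (len s)" using has_length_iff[OF assms] by blast
  then have 1: "i \<prec> len s \<longleftrightarrow> (\<exists>j. entry s i j)" unfolding has_length_def by blast
  have 2: "entry s i j \<Longrightarrow> entry s i k \<Longrightarrow> j = k" for j k using assms unfolding is_seq_def by blast
  show ?thesis
  proof (cases "i \<prec> len s")
    case True
    then obtain k where k: "entry s i k" using 1 by blast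
    then have "nth s i = k" using True assms 2 unfolding nth_def by (auto intro!: the_equality)
    then show ?thesis using k 2 True by blast
  qed (use 1 in blast)
qed

lemma seq_ext:
  assumes "is_seq s" "is_seq t" "len s = len t" "\<And>i. i \<prec> len s \<Longrightarrow> nth s i = nth t i"
  shows "s = t"
proof (rule finset_ext)
  show "is_finset s" "is_finset t" using assms unfolding is_seq_def by blast+
  have 1: "entry s i j \<longleftrightarrow> entry t i j" for i j using assms entry_iff by metis
  show "elem n s = elem n t" for n
    using assms(1,2) 1 unfolding is_seq_def entry_def by metis
qed

lemma initseg_iff:
  assumes "is_seq s" "is_seq t"
  shows "s \<sqsubseteq> t \<longleftrightarrow> len s \<preceq> len t \<and> (\<forall>i. i \<prec> len s \<longrightarrow> nth s i = nth t i)"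
proof -
  have "len s \<preceq> len t" if "\<And>i. i \<prec> len s \<Longrightarrow> i \<prec> len t"
    using that[of "len t"] by force
  then show ?thesis
    unfolding initseg_def using assms by (auto simp: entry_iff)
qed

lemma d1_is_seq: "f1 s \<Longrightarrow> d1 (\<lambda>e. is_seq (s e))"
  by (rule d1_app1[where g = is_seq]) (intro d1_d0 d0_is_seq tm_var)

lemma f1_len: "f1 s \<Longrightarrow> f1 (\<lambda>e. len (s e))"
proof (rule f1_app1[where g = len])
  have "y = len s \<longleftrightarrow> (is_seq s \<and> has_length s y) \<or> (\<not> is_seq s \<and> y = \<zero>)" for y s
    using has_length_iff[of s y] by (auto simp: len_def)
  then show "computable len"
    by (intro f1I) (simp, intro d1_d0 d0_intros d0_is_seq d0_has_length)
qed

lemma f1_nth: "f1 s \<Longrightarrow> f1 t \<Longrightarrow> f1 (\<lambda>e. nth (s e) (t e))"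
proof (rule f1_app2[where g = nth])
  have "y = nth s i \<longleftrightarrow> (is_seq s \<and> entry s i y) \<or> (\<not> (is_seq s \<and> i \<prec> len s) \<and> y = \<zero>)" for y s i
    using entry_iff[of s i y] by (auto simp: nth_def)
  moreover have "d1 (\<lambda>e. (is_seq (e (Suc 0)) \<and> entry (e (Suc 0)) (e (Suc (Suc 0))) (e 0)) \<or> (\<not> (is_seq (e (Suc 0)) \<and> e (Suc (Suc 0)) \<prec> len (e (Suc 0))) \<and> e 0 = \<zero>))"
    by (intro d1_intros d1_is_seq f1_len f1_intros) (intro d1_d0 d0_entry tm_var)
  ultimately show "f1 (\<lambda>e. nth (e 0) (e 1))"
    by (intro f1I) simp
qed

text \<open>Finite sets are cut out of sets below a bound; this supplies the bound for the graph of
  a function on an initial segment.\<close>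

lemma f1_bounded:
  assumes "computable h" shows "\<exists>b. \<forall>i. i \<prec> n \<longrightarrow> h i \<prec> b" (is "?P n")
proof (rule induction_s1[where P = "?P"])
  have h: "f1 (\<lambda>e. h (s e))" if "f1 s" for s using f1_app1[OF assms that] .
  show "s1 (\<lambda>e. ?P (e 0))"
    by (intro s1_ex s1_ball s1_less h f1_var)
  fix n assume "?P n"
  then obtain b where b: "\<And>i. i \<prec> n \<Longrightarrow> h i \<prec> b" by blast
  have "h i \<prec> b \<oplus> h n \<oplus> \<one>" if "i \<prec> suc n" for i
    using that b[of i] le_add1[of b "h n"] le_add2[of "h n" b] unfolding less_succ_iff less_succ_ax[of i n]
    by (metis M.less_le_trans le_def)
  then show "?P (suc n)" by blast
qed (simp add: not_less_zero_ax)

lemma seq_exists: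
  assumes "computable h"
  shows "\<exists>s. is_seq s \<and> len s = l \<and> (\<forall>i. i \<prec> l \<longrightarrow> nth s i = h i)"
proof -
  let ?A = "{z. \<exists>i. i \<prec> l \<and> z = \<langle>i, h i\<rangle>}"
  have h: "f1 (\<lambda>e. h (s e))" if "f1 s" for s using f1_app1[OF assms that] .
  have "?A \<in> Sets M" by (rule comprehension) (intro d1_intros f1_pair h f1_intros)
  moreover obtain b where b: "\<And>i. i \<prec> l \<Longrightarrow> \<langle>i, h i\<rangle> \<prec> b"
    using f1_bounded[of "\<lambda>i. \<langle>i, h i\<rangle>" l] f1_pair[OF f1_var assms] by blast
  ultimately obtain s where s: "is_finset s" "\<And>z. elem z s \<longleftrightarrow> z \<prec> b \<and> z \<in> ?A"
    using finset_exists by blast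
  have el: "elem z s \<longleftrightarrow> (\<exists>i. i \<prec> l \<and> z = \<langle>i, h i\<rangle>)" for z using s(2) b by auto
  have en: "entry s i j \<longleftrightarrow> i \<prec> l \<and> j = h i" for i j unfolding entry_def el by auto
  have hl: "has_length s l" unfolding has_length_def en by blast
  have sq: "is_seq s" unfolding is_seq_def by (intro conjI exI[of _ l] s(1) hl) (auto simp: el en)
  moreover have "len s = l" using has_length_iff sq hl by blast
  moreover have "nth s i = h i" if "i \<prec> l" for i using en[of i "h i"] that entry_iff[OF sq] by blast
  ultimately show ?thesis by (intro exI[of _ s]) simp
qed

definition mk :: "'a \<Rightarrow> ('a \<Rightarrow> 'a) \<Rightarrow> 'a" where
  "mk l h = (THE s. is_seq s \<and> len s = l \<and> (\<forall>i. i \<prec> l \<longrightarrow> nth s i = h i))"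

lemma mk_eq:
  assumes "computable h"
  shows "s = mk l h \<longleftrightarrow> is_seq s \<and> len s = l \<and> (\<forall>i. i \<prec> l \<longrightarrow> nth s i = h i)"
proof -
  have ex1: "\<exists>!s. is_seq s \<and> len s = l \<and> (\<forall>i. i \<prec> l \<longrightarrow> nth s i = h i)"
  proof (rule ex_ex1I)
    fix s t assume "is_seq s \<and> len s = l \<and> (\<forall>i. i \<prec> l \<longrightarrow> nth s i = h i)"
      "is_seq t \<and> len t = l \<and> (\<forall>i. i \<prec> l \<longrightarrow> nth t i = h i)"
    then show "s = t" using seq_ext[of s t] by simp
  qed (rule seq_exists[OF assms])
  show ?thesis
  proof
    assume "s = mk l h"
    then show "is_seq s \<and> len s = l \<and> (\<forall>i. i \<prec> l \<longrightarrow> nth s i = h i)"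
      unfolding mk_def by (rule ssubst) (rule theI'[OF ex1])
  next
    assume "is_seq s \<and> len s = l \<and> (\<forall>i. i \<prec> l \<longrightarrow> nth s i = h i)"
    then show "s = mk l h" unfolding mk_def by (rule the1_equality[OF ex1, symmetric])
  qed
qed

lemma mk_seq:
  assumes "computable h"
  shows "is_seq (mk l h)" "len (mk l h) = l" "i \<prec> l \<Longrightarrow> nth (mk l h) i = h i"
  using mk_eq[OF assms, of "mk l h" l] by blast+

text \<open>Freezing the environment turns a function with further arguments into a unary one, as
  \<open>mk_eq\<close> requires.\<close>

lemma f1_inst:
  assumes "f1 (\<lambda>e. h (e 0) (shift e))" shows "f1 (\<lambda>e'. h (e' 0) e)"
  using f1_ren[OF assms, of "\<lambda>i. case i of 0 \<Rightarrow> (\<lambda>e. e 0) | Suc j \<Rightarrow> (\<lambda>_. e j)"] by (simp add: tm_case tm_var tm_const)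

lemma f1_mk:
  assumes "f1 l" "f1 (\<lambda>e. h (e 0) (shift e))"
  shows "f1 (\<lambda>e. mk (l e) (\<lambda>i. h i e))"
proof (rule f1I)
  have "f1 (\<lambda>e. h (e 0) (\<lambda>i. e (Suc (Suc i))))"
    using f1_ren[OF assms(2), of "\<lambda>i. case i of 0 \<Rightarrow> (\<lambda>e. e 0) | Suc j \<Rightarrow> (\<lambda>e. e (Suc (Suc j)))"]
    by (simp add: tm_case tm_var)
  then show "d1 (\<lambda>e. e 0 = mk (l (shift e)) (\<lambda>i. h i (shift e)))"
    unfolding mk_eq[OF f1_inst[OF assms(2)]]
    by (intro d1_intros d1_is_seq f1_len f1_nth f1_var f1_tl[OF assms(1)])
qed

section \<open>Functions and paths\<close>

definition fn :: "'a set \<Rightarrow> 'a \<Rightarrow> 'a" where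
  "fn f i = (THE j. \<langle>i, j\<rangle> \<in> f)"

lemma fn_iff:
  assumes "is_fun f" shows "\<langle>i, j\<rangle> \<in> f \<longleftrightarrow> j = fn f i"
proof -
  have ex1: "\<exists>!j. \<langle>i, j\<rangle> \<in> f" using assms unfolding is_fun_def by blast
  have "\<langle>i, fn f i\<rangle> \<in> f" unfolding fn_def by (rule theI'[OF ex1])
  with ex1 show ?thesis by blast
qed

lemma f1_fn: "is_fun f \<Longrightarrow> f \<in> Sets M \<Longrightarrow> f1 s \<Longrightarrow> f1 (\<lambda>e. fn f (s e))"
  by (rule f1_app1[where g = "fn f"], rule f1I) (simp add: fn_iff[symmetric], intro d1_mem f1_pair f1_var)

definition graph :: "('a \<Rightarrow> 'a) \<Rightarrow> 'a set" where
  "graph h = {z. \<exists>i. z = \<langle>i, h i\<rangle>}"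

lemma graph_fun: "is_fun (graph h)" "\<langle>i, j\<rangle> \<in> graph h \<longleftrightarrow> j = h i"
  unfolding is_fun_def graph_def by auto

lemma graph_sets:
  assumes "computable h" shows "graph h \<in> Sets M"
proof -
  have "graph h = {z. \<exists>i. i \<prec> suc z \<and> z = \<langle>i, h i\<rangle>}"
    unfolding graph_def less_succ_iff using pair_ge1 by blast
  also have "\<dots> \<in> Sets M"
    by (rule comprehension) (intro d1_intros f1_intros f1_pair f1_app1[OF assms])
  finally show ?thesis .
qed

text \<open>From here on, a path is a function of the structure whose restrictions are taken by
  \<open>mk\<close>, instead of a set of pairs.\<close>

lemma has_path_iff:
  assumes "is_tree T"
  shows "has_path T \<longleftrightarrow> (\<exists>h. computable h \<and> (\<forall>k. mk k h \<in> T))"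
proof
  assume "has_path T"
  then obtain f where f: "f \<in> Sets M" "is_fun f"
    "\<And>k. \<exists>s\<in>T. has_length s k \<and> (\<forall>i j. entry s i j \<longrightarrow> \<langle>i, j\<rangle> \<in> f)"
    unfolding has_path_def is_path_def by blast
  have h: "f1 (\<lambda>e. fn f (e 0))" by (intro f1_fn f f1_var)
  have "mk k (fn f) \<in> T" for k
  proof -
    obtain s where s: "s \<in> T" "has_length s k" "\<And>i j. entry s i j \<Longrightarrow> \<langle>i, j\<rangle> \<in> f" using f(3) by blast
    have sq: "is_seq s" using assms s unfolding is_tree_def by blast
    have "s = mk k (fn f)" unfolding mk_eq[OF h]
      using sq s(2,3) has_length_iff[OF sq] entry_iff[OF sq] fn_iff[OF f(2)] by metis
    then show ?thesis using s by simp
  qed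
  then show "\<exists>h. computable h \<and> (\<forall>k. mk k h \<in> T)" using h by blast
next
  assume "\<exists>h. computable h \<and> (\<forall>k. mk k h \<in> T)"
  then obtain h where h: "computable h" "\<And>k. mk k h \<in> T" by blast
  note mk = mk_seq[OF h(1)]
  have "has_length (mk k h) k \<and> (\<forall>i j. entry (mk k h) i j \<longrightarrow> \<langle>i, j\<rangle> \<in> graph h)" for k
    by (simp add: has_length_iff entry_iff graph_fun mk)
  then have "is_path (graph h) T" using h graph_fun(1) unfolding is_path_def by blast
  then show "has_path T" using graph_sets[OF h(1)] unfolding has_path_def by blast
qed


lemma compl_sets: "A \<in> Sets M \<Longrightarrow> - A \<in> Sets M"
  using comprehension[of "\<lambda>x. x \<notin> A"] by (simp add: Compl_eq d1_not d1_mem f1_var)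

lemma rows_exist:
  assumes "d1 (\<lambda>e. Q (e 0) (e 1))" obtains T where "T \<in> Sets M" "\<And>n. row T n = {s. Q s n}"
proof
  let ?T = "{z. \<exists>s. s \<prec> suc z \<and> (\<exists>n. n \<prec> suc z \<and> z = \<langle>s, n\<rangle> \<and> Q s n)}"
  show "?T \<in> Sets M"
    by (rule comprehension) (intro d1_intros f1_intros f1_pair d1_app2[OF assms])
  show "row ?T n = {s. Q s n}" for n
    unfolding row_def less_succ_iff using pair_ge1 pair_ge2 by auto
qed

lemma mem_row: "s \<in> row T n \<longleftrightarrow> \<langle>s, n\<rangle> \<in> T"
  unfolding row_def by simp

section \<open>Consequences of Pi-1-1 comprehension\<close>

lemmas ar_intros = ar_all ar_ex ar_conj ar_disj ar_imp ar_not ar_var ar_mem ar_eq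
lemmas ar_seq = ar_d0[OF d0_is_seq] ar_d0[OF d0_entry] ar_d0[OF d0_has_length]

lemma Pi11_comprehension:
  assumes "Pi11_CA" "ar (\<lambda>e V. P (e 0) (V 0))"
  shows "{n. \<forall>A\<in>Sets M. P n A} \<in> Sets M"
proof -
  obtain \<phi> e E where *: "arithmetical \<phi>" "range E \<subseteq> Sets M"
    "\<And>x A. sat (e(0 := x)) (E(0 := A)) \<phi> = P x A" by (rule ar_realize[OF assms(2)]) (rule that)
  have "Pi11 (AllS 0 \<phi>)" using *(1) unfolding Pi11_def by blast
  then obtain Z where "Z \<in> Sets M" "\<forall>n. n \<in> Z \<longleftrightarrow> sat (e(0 := n)) E (AllS 0 \<phi>)"
    using assms(1) *(2) unfolding Pi11_CA_def by blast
  moreover from this(2) have "Z = {n. \<forall>A\<in>Sets M. P n A}" by (auto simp: *(3))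
  ultimately show ?thesis by simp
qed

lemma Pi11_WF_hat: "Pi11_CA \<Longrightarrow> WF_hat"
  unfolding WF_hat_def
proof (intro ballI impI)
  fix T assume ca: "Pi11_CA" and T: "T \<in> Sets M"
  have "ar (\<lambda>e V. \<not> is_path (V 0) (row T (e 0)))"
    unfolding is_path_def is_fun_def Ball_def Bex_def Ex1_def mem_row
    by (intro ar_intros ar_seq tm_pair tm_var T)
  from Pi11_comprehension[OF ca this]
  show "\<exists>Z\<in>Sets M. \<forall>n. n \<in> Z \<longleftrightarrow> \<not> has_path (row T n)"
    unfolding has_path_def by (rule rev_bexI) simp
qed

lemma Pi11_PK: "Pi11_CA \<Longrightarrow> PK"
  unfolding PK_def
proof (intro ballI impI)
  fix T assume ca: "Pi11_CA" and T: "T \<in> Sets M"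
  have "ar (\<lambda>e V. \<not> (is_tree (V 0) \<and> V 0 \<subseteq> T \<and> perfect (V 0) \<and> e 0 \<in> V 0))"
    unfolding is_tree_def perfect_def compatible_def initseg_def subset_eq Ball_def Bex_def
    by (intro ar_intros ar_seq tm_pair tm_var T)
  \<comment> \<open>Membership in the kernel is a \<open>\<Sigma>\<^sup>1\<^sub>1\<close> condition,
    so comprehension produces the complement of the kernel first.\<close>
  from compl_sets[OF Pi11_comprehension[OF ca this]]
  show "perfect_kernel T \<in> Sets M"
    by (rule back_subst[of "\<lambda>A. A \<in> Sets M"]) (auto simp: perfect_kernel_def)
qed

section \<open>Sequences and trees\<close>

lemma less_one_iff: "a \<prec> \<one> \<longleftrightarrow> a = \<zero>"
  using less_succ_ax[of a \<zero>] by (simp add: zero_add not_less_zero_ax)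

lemma zero_less_iff: "\<zero> \<prec> a \<longleftrightarrow> a \<noteq> \<zero>"
  using zero_le[of a] unfolding le_def using less_irrefl_M by blast

lemma treeI:
  assumes "\<And>s. s \<in> T \<Longrightarrow> is_seq s"
    and "\<And>s t. s \<in> T \<Longrightarrow> is_seq s \<Longrightarrow> is_seq t \<Longrightarrow> len t \<preceq> len s \<Longrightarrow> (\<And>i. i \<prec> len t \<Longrightarrow> nth t i = nth s i) \<Longrightarrow> t \<in> T"
  shows "is_tree T"
  unfolding is_tree_def
proof (intro conjI ballI allI impI)
  fix s t assume s: "s \<in> T" and ts: "t \<sqsubseteq> s"
  have "is_seq t" "is_seq s" using ts unfolding initseg_def by blast+
  then show "t \<in> T" using assms(2)[OF s] ts initseg_iff by blast
qed (rule assms(1))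

lemma treeD:
  assumes "is_tree T" "s \<in> T"
  shows "is_seq s" "is_seq t \<Longrightarrow> len t \<preceq> len s \<Longrightarrow> (\<And>i. i \<prec> len t \<Longrightarrow> nth t i = nth s i) \<Longrightarrow> t \<in> T"
proof -
  show s: "is_seq s" using assms unfolding is_tree_def by blast
  show "is_seq t \<Longrightarrow> len t \<preceq> len s \<Longrightarrow> (\<And>i. i \<prec> len t \<Longrightarrow> nth t i = nth s i) \<Longrightarrow> t \<in> T"
    using assms initseg_iff[of t s] s unfolding is_tree_def by blast
qed

definition app :: "'a \<Rightarrow> 'a \<Rightarrow> 'a" where
  "app s a = mk (len s \<oplus> \<one>) (\<lambda>i. if i = len s then a else nth s i)"

lemma app_seq:
  shows "is_seq (app s a)" "len (app s a) = len s \<oplus> \<one>" "nth (app s a) (len s) = a"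
    "i \<prec> len s \<Longrightarrow> nth (app s a) i = nth s i"
proof -
  have f: "f1 (\<lambda>e. if e 0 = len s then a else nth s (e 0))"
    by (intro f1_if d1_eq f1_nth f1_var f1_const)
  show "is_seq (app s a)" "len (app s a) = len s \<oplus> \<one>" "nth (app s a) (len s) = a"
    using mk_seq[OF f] unfolding app_def by (simp_all add: less_succ_iff)
  show "nth (app s a) i = nth s i" if i: "i \<prec> len s"
  proof -
    have "i \<noteq> len s" "i \<prec> len s \<oplus> \<one>" using i by (auto simp: less_succ_iff le_def)
    then show ?thesis using mk_seq(3)[OF f, of i "len s \<oplus> \<one>"] unfolding app_def by simp
  qed
qed

lemma app_ext:
  assumes "is_seq s" shows "s \<sqsubseteq> app s a" "app s a \<noteq> s"
proof -
  show "s \<sqsubseteq> app s a"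
    unfolding initseg_iff[OF assms app_seq(1)] app_seq(2) by (simp add: app_seq(4))
  have "len s \<noteq> len s \<oplus> \<one>" using less_add[of "len s" \<zero>] by (auto simp: zero_add)
  then show "app s a \<noteq> s" using app_seq(2)[of s a] by metis
qed

section \<open>Arithmetical comprehension from well-foundedness\<close>

text \<open>In the \<open>n\<close>-th tree, every \<open>\<langle>m\<rangle>\<close> is extended by all \<open>\<langle>m, 0, \<dots>, 0\<rangle>\<close> if \<open>\<langle>n, m\<rangle> \<in> A\<close>, and is a
  leaf otherwise.  So the leaf sets exist, whether or not \<open>n\<close> is in the projection of \<open>A\<close>.\<close>

lemma WF_hat_L_projection:
  assumes WF_hat_L and A: "A \<in> Sets M"
  shows "{n. \<exists>m. \<langle>n, m\<rangle> \<in> A} \<in> Sets M"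
proof -
  define Q where "Q s n \<longleftrightarrow> is_seq s \<and> (\<one> \<prec> len s \<longrightarrow> \<langle>n, nth s \<zero>\<rangle> \<in> A \<and> (\<forall>i. i \<prec> len s \<longrightarrow> i \<noteq> \<zero> \<longrightarrow> nth s i = \<zero>))" for s n
  have dQ: "d1 (\<lambda>e. Q (e 0) (e 1))" unfolding Q_def
    by (intro d1_intros d1_is_seq f1_intros f1_len f1_nth f1_pair A)
  obtain T where T: "T \<in> Sets M" "\<And>n. row T n = {s. Q s n}" using rows_exist[OF dQ] by blast
  have "d1 (\<lambda>e. Q (e 0) (e 1) \<and> len (e 0) = \<one> \<and> \<langle>e 1, nth (e 0) \<zero>\<rangle> \<notin> A)"
    by (intro d1_intros dQ f1_intros f1_len f1_nth f1_pair A)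
  from rows_exist[OF this] obtain L where L: "L \<in> Sets M"
     "\<And>n. row L n = {s. Q s n \<and> len s = \<one> \<and> \<langle>n, nth s \<zero>\<rangle> \<notin> A}" by blast
  have tree: "is_tree (row T n)" for n
    unfolding T(2)
  proof (rule treeI)
    fix s t assume s: "s \<in> {s. Q s n}" and t: "is_seq t" "len t \<preceq> len s" "\<And>i. i \<prec> len t \<Longrightarrow> nth t i = nth s i"
    have "Q t n" unfolding Q_def
    proof (intro conjI impI allI)
      assume l: "\<one> \<prec> len t"
      then have "\<one> \<prec> len s" using t(2) by order
      moreover have "\<zero> \<prec> len t" using l zero_less_iff not_less_zero_ax by metis
      ultimately show "\<langle>n, nth t \<zero>\<rangle> \<in> A" "i \<prec> len t \<Longrightarrow> i \<noteq> \<zero> \<Longrightarrow> nth t i = \<zero>" for i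
        using s t(2,3) M.less_le_trans[of i "len t" "len s"] unfolding Q_def by simp_all
    qed (rule t)
    then show "t \<in> {s. Q s n}" by simp
  qed (simp add: Q_def)
  have lf: "row L n = leaf (row T n)" for n
  proof (intro set_eqI iffI)
    fix s assume "s \<in> row L n"
    then have s: "Q s n" "len s = \<one>" "\<langle>n, nth s \<zero>\<rangle> \<notin> A" unfolding L(2) by auto
    have "t = s" if "Q t n" "s \<sqsubseteq> t" for t
    proof -
      have sq: "is_seq s" "is_seq t" using s(1) that(1) unfolding Q_def by auto
      then have st: "\<one> \<preceq> len t" "nth s \<zero> = nth t \<zero>" "\<And>i. i \<prec> \<one> \<Longrightarrow> nth s i = nth t i"
        using that(2) s(2) by (simp_all add: initseg_iff)
      have "\<not> \<one> \<prec> len t" using that(1) s(3) st(2) unfolding Q_def by auto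
      then have "len t = \<one>" using st(1) by order
      then show ?thesis using s(2) st(3) by (intro seq_ext[OF sq(2,1)]) simp_all
    qed
    then show "s \<in> leaf (row T n)" using s(1) unfolding leaf_def T(2) by blast
  next
    fix s assume "s \<in> leaf (row T n)"
    then have s: "Q s n" "\<And>t. Q t n \<Longrightarrow> s \<sqsubseteq> t \<Longrightarrow> t = s" unfolding leaf_def T(2) by auto
    have sq: "is_seq s" using s(1) unfolding Q_def by blast
    have "\<not> Q (app s \<zero>) n" using s(2) app_ext[OF sq, of \<zero>] by blast
    \<comment> \<open>Appending \<open>\<zero>\<close> stays in the tree in both cases: it turns the
      empty sequence into one of length 1, and above an entry \<open>m\<close> with
      \<open>\<langle>n, m\<rangle> \<in> A\<close> it adds another zero.\<close>
    then have "\<not> (len s = \<zero> \<or> \<langle>n, nth s \<zero>\<rangle> \<in> A)"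
    proof (rule contrapos_nn)
      assume *: "len s = \<zero> \<or> \<langle>n, nth s \<zero>\<rangle> \<in> A"
      show "Q (app s \<zero>) n"
        unfolding Q_def app_seq(2)
      proof (intro conjI impI allI app_seq(1))
        assume "\<one> \<prec> len s \<oplus> \<one>"
        then have l: "\<zero> \<prec> len s" unfolding less_succ_iff zero_less_iff using less_one_iff by force
        then show "\<langle>n, nth (app s \<zero>) \<zero>\<rangle> \<in> A" using * app_seq(4) by auto
        show "nth (app s \<zero>) i = \<zero>" if "i \<prec> len s \<oplus> \<one>" "i \<noteq> \<zero>" for i
        proof (cases "i = len s")
          case False
          then have i: "i \<prec> len s" using that(1) by (simp add: less_succ_ax)
          have "\<not> i \<prec> \<one>" using that(2) less_one_iff by blast
          then have "\<one> \<prec> len s" using i by order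
          then show ?thesis using s(1) i that(2) app_seq(4)[OF i] unfolding Q_def by simp
        qed (simp add: app_seq)
      qed
    qed
    then have nz: "len s \<noteq> \<zero>" "\<langle>n, nth s \<zero>\<rangle> \<notin> A" by auto
    then have "\<not> \<one> \<prec> len s" using s(1) unfolding Q_def by blast
    moreover have "\<not> len s \<prec> \<one>" using nz(1) less_one_iff by blast
    ultimately have "len s = \<one>" by order
    then show "s \<in> row L n" unfolding L(2) using s(1) nz by simp
  qed
  have path: "has_path (row T n) \<longleftrightarrow> (\<exists>m. \<langle>n, m\<rangle> \<in> A)" for n
    unfolding has_path_iff[OF tree]
  proof
    assume "\<exists>h. computable h \<and> (\<forall>k. mk k h \<in> row T n)"
    \<comment> \<open>Length 2 is the first length at which membership in the tree says something
      about \<open>A\<close>.\<close>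
    then obtain h where h: "computable h" "mk (\<one> \<oplus> \<one>) h \<in> row T n" by blast
    have "\<one> \<prec> \<one> \<oplus> \<one>" by (simp add: less_succ_iff)
    then show "\<exists>m. \<langle>n, m\<rangle> \<in> A" using h(2) unfolding T(2) Q_def by (auto simp: mk_seq[OF h(1)])
  next
    assume "\<exists>m. \<langle>n, m\<rangle> \<in> A"
    then obtain m where m: "\<langle>n, m\<rangle> \<in> A" by blast
    let ?h = "\<lambda>i. if i = \<zero> then m else \<zero>"
    have h: "computable ?h" by (intro f1_if d1_eq f1_var f1_const)
    have "mk k ?h \<in> row T n" for k
      unfolding T(2) Q_def using m mk_seq[OF h] M.less_trans[OF M.zero_less_one, of k] by simp
    then show "\<exists>h. computable h \<and> (\<forall>k. mk k h \<in> row T n)"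
      using h by (intro exI[of _ ?h]) simp
  qed
  obtain Z where "Z \<in> Sets M" "\<And>n. n \<in> Z \<longleftrightarrow> \<not> has_path (row T n)"
    using assms(1) T(1) L(1) tree lf unfolding WF_hat_L_def by blast
  then have "- Z \<in> Sets M" "- Z = {n. \<exists>m. \<langle>n, m\<rangle> \<in> A}" using path compl_sets by auto
  then show ?thesis by simp
qed


section \<open>Coding of environments\<close>

definition pr1 :: "'a \<Rightarrow> 'a" where
  "pr1 z = (if \<exists>i j. z = \<langle>i, j\<rangle> then THE i. \<exists>j. z = \<langle>i, j\<rangle> else \<zero>)"

definition pr2 :: "'a \<Rightarrow> 'a" where
  "pr2 z = (if \<exists>i j. z = \<langle>i, j\<rangle> then THE j. \<exists>i. z = \<langle>i, j\<rangle> else \<zero>)"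

lemma pr_pair [simp]: "pr1 \<langle>i, j\<rangle> = i" "pr2 \<langle>i, j\<rangle> = j"
  unfolding pr1_def pr2_def by auto

lemma pr_not_pair: "\<nexists>i j. z = \<langle>i, j\<rangle> \<Longrightarrow> pr1 z = \<zero> \<and> pr2 z = \<zero>"
  unfolding pr1_def pr2_def by simp

lemma pair_less_succ: "i \<prec> \<langle>i, j\<rangle> \<oplus> \<one>" "j \<prec> \<langle>i, j\<rangle> \<oplus> \<one>"
  unfolding less_succ_iff by (rule pair_ge1 pair_ge2)+

lemma f1_pr1: "f1 s \<Longrightarrow> f1 (\<lambda>e. pr1 (s e))"
proof (rule f1_app1[where g = pr1], rule f1I)
  have "y = pr1 z \<longleftrightarrow> (\<exists>j. j \<prec> suc z \<and> z = \<langle>y, j\<rangle>) \<or> \<not> (\<exists>i. i \<prec> suc z \<and> (\<exists>j. j \<prec> suc z \<and> z = \<langle>i, j\<rangle>)) \<and> y = \<zero>" for y z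
  proof (cases "\<exists>i j. z = \<langle>i, j\<rangle>")
    case True
    then obtain i j where z: "z = \<langle>i, j\<rangle>" by blast
    show ?thesis unfolding z by (auto simp: pair_less_succ)
  next
    case False
    then have "z \<noteq> \<langle>i, j\<rangle>" for i j by blast
    then show ?thesis using pr_not_pair[OF False] by simp
  qed
  then show "d1 (\<lambda>e. e 0 = pr1 (e (Suc 0)))"
    by simp (intro d1_d0 d0_intros tm_pair)
qed

lemma f1_pr2: "f1 s \<Longrightarrow> f1 (\<lambda>e. pr2 (s e))"
proof (rule f1_app1[where g = pr2], rule f1I)
  have "y = pr2 z \<longleftrightarrow> (\<exists>j. j \<prec> suc z \<and> z = \<langle>j, y\<rangle>) \<or> \<not> (\<exists>i. i \<prec> suc z \<and> (\<exists>j. j \<prec> suc z \<and> z = \<langle>i, j\<rangle>)) \<and> y = \<zero>" for y z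
  proof (cases "\<exists>i j. z = \<langle>i, j\<rangle>")
    case True
    then obtain i j where z: "z = \<langle>i, j\<rangle>" by blast
    show ?thesis unfolding z by (auto simp: pair_less_succ)
  next
    case False
    then have "z \<noteq> \<langle>i, j\<rangle>" for i j by blast
    then show ?thesis using pr_not_pair[OF False] by simp
  qed
  then show "d1 (\<lambda>e. e 0 = pr2 (e (Suc 0)))"
    by simp (intro d1_d0 d0_intros tm_pair)
qed

text \<open>The length is a standard natural number, so that the code is a term of fixed shape,
  unlike the sequences coded inside the structure.\<close>

primrec encode :: "nat \<Rightarrow> (nat \<Rightarrow> 'a) \<Rightarrow> 'a" where
  "encode 0 e = \<zero>"
| "encode (Suc n) e = \<langle>e n, encode n e\<rangle>"

primrec decode :: "nat \<Rightarrow> 'a \<Rightarrow> nat \<Rightarrow> 'a" where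
  "decode 0 c i = \<zero>"
| "decode (Suc n) c i = (if i = n then pr1 c else decode n (pr2 c) i)"

lemma decode_encode: "i < n \<Longrightarrow> decode n (encode n e) i = e i"
  by (induction n) auto

lemma encode_cong: "(\<And>i. i < n \<Longrightarrow> e i = e' i) \<Longrightarrow> encode n e = encode n e'"
  by (induction n) simp_all

lemma tm_encode: "tm (\<lambda>e. encode n e)"
  by (induction n) (simp_all add: tm_const tm_pair tm_var)

lemma f1_if_const: "f1 a \<Longrightarrow> f1 b \<Longrightarrow> f1 (\<lambda>e. if c then a e else b e)"
  by (cases c) simp_all

lemma f1_decode: "f1 s \<Longrightarrow> f1 (\<lambda>e. decode n (s e) i)"
  by (induction n arbitrary: s) (simp_all add: f1_const f1_pr1 f1_pr2 f1_if_const)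

lemma f1_case: "f1 a \<Longrightarrow> (\<And>j. f1 (b j)) \<Longrightarrow> f1 (case i of 0 \<Rightarrow> a | Suc j \<Rightarrow> b j)"
  by (cases i) simp_all

lemma f1_tm_subst:
  assumes "tm t" "\<And>i. f1 (s i)" shows "f1 (\<lambda>e. t (\<lambda>i. s i e))"
  using assms(1) by induction (simp_all add: assms(2) f1_const f1_add f1_mul)

lemma d1_upd:
  assumes "d1 P" "f1 f" shows "d1 (\<lambda>e. P (e(n := f e)))"
proof (rule d1_subst[OF assms(2), of "\<lambda>y e. P (e(n := y))"])
  show "d1 (\<lambda>e. P ((shift e)(n := e 0)))"
    using d1_ren[OF assms(1), of "\<lambda>i e. if i = n then e 0 else e (Suc i)"]
    by (simp add: tm_if tm_var fun_upd_def)
qed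

text \<open>Composition handles one variable at a time, so finitely many positions are replaced by
  induction. Meanwhile the arguments of the substituted functions are moved up by \<open>N\<close>,
  where the updates below \<open>N\<close> cannot disturb them.\<close>

lemma d1_subst_all:
  assumes P: "d1 P" and N: "\<And>e e'. (\<And>i. i < N \<Longrightarrow> e i = e' i) \<Longrightarrow> P e = P e'" and s: "\<And>i. f1 (s i)"
  shows "d1 (\<lambda>e. P (\<lambda>i. s i e))"
proof -
  have "n \<le> N \<Longrightarrow> d1 (\<lambda>e. P (\<lambda>i. if i < n then s i (\<lambda>j. e (j + N)) else e i))" for n
  proof (induction n)
    case 0
    then show ?case using P by simp
  next
    case (Suc n)
    have "f1 (\<lambda>e. s n (\<lambda>j. e (j + N)))" by (rule f1_ren[OF s]) (rule tm_var)
    from d1_upd[OF Suc.IH this, of n] Suc.prems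
    have "d1 (\<lambda>e. P (\<lambda>i. if i < n then s i (\<lambda>j. (e(n := s n (\<lambda>j. e (j + N)))) (j + N)) else (e(n := s n (\<lambda>j. e (j + N)))) i))"
      by simp
    moreover have "(\<lambda>i. if i < n then s i (\<lambda>j. (e(n := s n (\<lambda>j. e (j + N)))) (j + N)) else (e(n := s n (\<lambda>j. e (j + N)))) i)
       = (\<lambda>i. if i < Suc n then s i (\<lambda>j. e (j + N)) else e i)" for e
    proof -
      have "(\<lambda>j. (e(n := s n (\<lambda>j. e (j + N)))) (j + N)) = (\<lambda>j. e (j + N))"
        using Suc.prems by (intro ext) simp
      then show ?thesis by (intro ext) (auto simp: less_Suc_eq)
    qed
    ultimately show ?case by simp
  qed
  from this[of N] have "d1 (\<lambda>e. P (\<lambda>i. if i < N then s i (\<lambda>j. e (j + N)) else e i))" by simp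
  \<comment> \<open>All positions that \<open>P\<close> depends on have been replaced, so the
    displacement by \<open>N\<close> can be undone.\<close>
  from d1_ren[OF this, of "\<lambda>i e. if i < N then e 0 else e (i - N)"]
  have "d1 (\<lambda>e. P (\<lambda>i. if i < N then s i (\<lambda>j. e j) else e (i - N)))"
    by (simp add: tm_if tm_var if_distrib cong: if_cong)
  moreover have "P (\<lambda>i. if i < N then s i (\<lambda>j. e j) else e (i - N)) = P (\<lambda>i. s i e)" for e
    by (rule N) simp
  ultimately show ?thesis by simp
qed

section \<open>Implicit definitions of arithmetical predicates\<close>

text \<open>One function carries several: its values at the arguments
  \<open>\<langle>i, k\<rangle>\<close> form the component \<open>k\<close>. The bounded quantifiers
  keep membership \<open>\<Sigma>\<^sup>0\<^sub>0\<close>.\<close>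

definition part :: "'a \<Rightarrow> 'a set \<Rightarrow> 'a set" where
  "part k F = {z. \<exists>i. i \<prec> suc z \<and> (\<exists>j. j \<prec> suc z \<and> z = \<langle>i, j\<rangle> \<and> \<langle>\<langle>i, k\<rangle>, j\<rangle> \<in> F)}"

lemma part_graph: "part k (graph h) = graph (\<lambda>i. h \<langle>i, k\<rangle>)"
  unfolding part_def graph_fun(2) unfolding graph_def less_succ_iff using pair_ge1 pair_ge2 by blast

abbreviation pr_env :: "'a set \<Rightarrow> 'a set \<Rightarrow> nat \<Rightarrow> 'a set" where
  "pr_env X F \<equiv> push X (\<lambda>_. F)"

abbreviation component :: "'a \<Rightarrow> (nat \<Rightarrow> 'a set) \<Rightarrow> nat \<Rightarrow> 'a set" where
  "component k V \<equiv> pr_env (V 0) (part k (V 1))"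

lemma d0_comp:
  assumes "d0 Q" "\<And>i. tm (s i)" "d0 (\<lambda>e V. e 0 \<in> A (shift e) V)" "d0 (\<lambda>e V. e 0 \<in> B (shift e) V)"
  shows "d0 (\<lambda>e V. Q (\<lambda>i. s i e) (pr_env (A e V) (B e V)))"
proof (rule d0_subst[OF assms(1,2), where G = "\<lambda>i e V. pr_env (A e V) (B e V) i"])
  show "d0 (\<lambda>e V. e 0 \<in> pr_env (A (shift e) V) (B (shift e) V) i)" for i
    by (cases i) (simp_all add: assms)
qed

lemma d0_part: "d0 (\<lambda>e V. e 0 \<in> part k (V i))"
  unfolding part_def mem_Collect_eq by (intro d0_intros tm_pair)

text \<open>
  An arithmetical predicate of a set \<open>X\<close> is implicitly defined if it becomes \<open>\<Sigma>\<^sup>0\<^sub>0\<close>, uniformly in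
  \<open>X\<close>, relative to any function satisfying a \<open>\<Pi>\<^sup>0\<^sub>1\<close> condition \<open>\<forall>e. C e\<close> that always has a solution.
  This plays the part of the Skolem functions of a prenex normal form, but it is closed under
  negation for trivial reasons.
\<close>

abbreviation solvable where
  "solvable C \<equiv> \<forall>X\<in>Sets M. \<exists>h. computable h \<and> (\<forall>e. C e (pr_env X (graph h)))"

abbreviation determines where
  "determines C D P \<equiv> \<forall>X\<in>Sets M. \<forall>h. computable h \<longrightarrow> (\<forall>e. C e (pr_env X (graph h))) \<longrightarrow>
     (\<forall>e. P e X \<longleftrightarrow> D e (pr_env X (graph h)))"

definition implicit :: "((nat \<Rightarrow> 'a) \<Rightarrow> 'a set \<Rightarrow> bool) \<Rightarrow> bool" where
  "implicit P \<longleftrightarrow> (\<exists>C D. d0 C \<and> d0 D \<and> solvable C \<and> determines C D P)"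

lemma implicitI:
  assumes "d0 C" "d0 D"
    and "\<And>X. X \<in> Sets M \<Longrightarrow> \<exists>h. computable h \<and> (\<forall>e. C e (pr_env X (graph h)))"
    and "\<And>X h e. X \<in> Sets M \<Longrightarrow> computable h \<Longrightarrow> (\<forall>e. C e (pr_env X (graph h))) \<Longrightarrow>
          P e X \<longleftrightarrow> D e (pr_env X (graph h))"
  shows "implicit P"
  unfolding implicit_def using assms by (intro exI[of _ C] exI[of _ D]) simp

lemma implicitE:
  assumes "implicit P"
  obtains C D where "d0 C" "d0 D"
    "solvable C"
    "determines C D P"
  using assms unfolding implicit_def by (elim exE conjE)

lemma implicit_d0:
  assumes "d0 D" "\<And>e X F. P e X \<longleftrightarrow> D e (pr_env X F)" shows "implicit P"
  by (rule implicitI[OF d0_const[of True] assms(1)]) (auto simp: assms(2) intro: exI[of _ "\<lambda>_. \<zero>"] f1_const)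

lemma implicit_not:
  assumes "implicit P" shows "implicit (\<lambda>e X. \<not> P e X)"
proof -
  obtain C D where *: "d0 C" "d0 D"
    "solvable C"
    "determines C D P"
    using assms by (rule implicitE)
  show ?thesis
    by (rule implicitI[OF *(1) d0_not[OF *(2)]]) (use *(3,4) in simp_all)
qed

lemma f1_join:
  assumes "computable h0" "computable h1"
  obtains h where "computable h" "\<And>i. h \<langle>i, \<zero>\<rangle> = h0 i" "\<And>i. h \<langle>i, \<one>\<rangle> = h1 i"
proof
  show "f1 (\<lambda>e. (\<lambda>z. if pr2 z = \<zero> then h0 (pr1 z) else h1 (pr1 z)) (e 0))"
    by (intro f1_if d1_eq f1_app1[OF assms(1)] f1_app1[OF assms(2)] f1_pr1 f1_pr2 f1_var f1_const)
qed simp_all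

text \<open>The two auxiliary functions are joined into one; each condition reads its own
  component.\<close>

lemma implicit_conj:
  assumes "implicit P" "implicit P'" shows "implicit (\<lambda>e X. P e X \<and> P' e X)"
proof -
  obtain C D where *: "d0 C" "d0 D"
    "solvable C"
    "determines C D P"
    using assms(1) by (rule implicitE)
  obtain C' D' where **: "d0 C'" "d0 D'"
    "solvable C'"
    "determines C' D' P'"
    using assms(2) by (rule implicitE)
  have part: "d0 (\<lambda>e V. Q e (component k V))" if "d0 Q" for Q k
    using d0_comp[OF that tm_var, of "\<lambda>e V. V 0" "\<lambda>e V. part k (V 1)"] by (simp add: d0_var tm_var d0_part)
  show ?thesis
  proof (rule implicitI[OF d0_conj[OF part[OF *(1), of \<zero>] part[OF **(1), of \<one>]]
        d0_conj[OF part[OF *(2), of \<zero>] part[OF **(2), of \<one>]]])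
    fix X assume X: "X \<in> Sets M"
    obtain h0 where h0: "computable h0" "\<forall>e. C e (pr_env X (graph h0))" using *(3) X by blast
    obtain h1 where h1: "computable h1" "\<forall>e. C' e (pr_env X (graph h1))" using **(3) X by blast
    obtain h where "computable h" "\<And>i. h \<langle>i, \<zero>\<rangle> = h0 i" "\<And>i. h \<langle>i, \<one>\<rangle> = h1 i"
      by (rule f1_join[OF h0(1) h1(1)]) (rule that)
    then show "\<exists>h. computable h \<and> (\<forall>e. C e (component \<zero> (pr_env X (graph h))) \<and>
        C' e (component \<one> (pr_env X (graph h))))"
      using h0(2) h1(2) by (intro exI[of _ h]) (simp add: part_graph)
  next
    fix X h e assume X: "X \<in> Sets M" and h: "computable h" and
      C: "\<forall>e. C e (component \<zero> (pr_env X (graph h))) \<and>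
        C' e (component \<one> (pr_env X (graph h)))"
    have f: "f1 (\<lambda>e. h \<langle>e 0, k\<rangle>)" for k
      by (intro f1_app1[OF h] f1_pair f1_var f1_const)
    have c: "\<forall>e. C e (pr_env X (graph (\<lambda>i. h \<langle>i, \<zero>\<rangle>)))" "\<forall>e. C' e (pr_env X (graph (\<lambda>i. h \<langle>i, \<one>\<rangle>)))"
      using C by (simp_all add: part_graph)
    have "P e X \<longleftrightarrow> D e (pr_env X (graph (\<lambda>i. h \<langle>i, \<zero>\<rangle>)))"
      by (rule *(4)[rule_format, OF X f c(1)[rule_format]])
    moreover have "P' e X \<longleftrightarrow> D' e (pr_env X (graph (\<lambda>i. h \<langle>i, \<one>\<rangle>)))"
      by (rule **(4)[rule_format, OF X f c(2)[rule_format]])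
    ultimately show "(P e X \<and> P' e X) = (D e (component \<zero> (pr_env X (graph h))) \<and>
        D' e (component \<one> (pr_env X (graph h))))"
      by (simp add: part_graph)
  qed
qed

lemma f1_of_graph:
  assumes "d1 (\<lambda>e. R (e 0) (e 1))" "\<And>c. \<exists>!y. R c y"
  obtains H where "computable H" "\<And>c y. R c y \<longleftrightarrow> y = H c"
proof -
  have R: "R c y \<longleftrightarrow> y = (THE y. R c y)" for c y
    using theI'[OF assms(2)[of c]] the1_equality[OF assms(2)[of c]] by metis
  have "d1 (\<lambda>e. R (e 1) (e 0))"
    by (rule d1_app2[OF assms(1)]) (rule f1_var)+
  then have "d1 (\<lambda>e. e 0 = (THE y. R (e 1) y))" by (subst R[symmetric])
  then have "f1 (\<lambda>e. THE y. R (e 0) y)" by (intro f1I) simp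
  then show ?thesis using R by (intro that[of "\<lambda>c. THE y. R c y"])
qed

text \<open>Closure under projection is equivalent to arithmetical comprehension over
  \<open>RCA0\<close>: it eliminates number quantifiers one by one.\<close>

definition ACA :: bool where
  "ACA \<longleftrightarrow> (\<forall>A\<in>Sets M. {n. \<exists>m. \<langle>n, m\<rangle> \<in> A} \<in> Sets M)"

text \<open>The function added for the quantifier maps (the code of) an environment to \<open>0\<close> if there is no
  witness, and to \<open>a + 1\<close> for the least witness \<open>a\<close> otherwise; both clauses are \<open>\<Pi>\<^sup>0\<^sub>1\<close>.\<close>

lemma implicit_ex:
  assumes "ACA" "implicit P" shows "implicit (\<lambda>e X. \<exists>a. P (e(x := a)) X)"
proof -
  obtain C D where *: "d0 C" "d0 D"
    "solvable C"
    "determines C D P"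
    using assms(2) by (rule implicitE)
  obtain N where "depends_below N D" using d0_finite_support[OF *(2)] by blast
  from depends_belowD[OF this] have N: "(\<And>i. i < N \<Longrightarrow> e i = e' i) \<Longrightarrow> D e V = D e' V" for e e' V
    by (rule fun_cong)
  let ?W = "\<lambda>V :: nat \<Rightarrow> 'a set. component \<zero> V"
  \<comment> \<open>The condition is imposed for all environments, so the positions \<open>N\<close>
    and \<open>Suc N\<close>, which \<open>D\<close> does not read, act as universally quantified
    variables: the value of the new function and a candidate for the witness.\<close>
  let ?C = "\<lambda>e V. C e (?W V) \<and> (\<langle>\<langle>encode N e, \<one>\<rangle>, e N\<rangle> \<in> V 1 \<longrightarrow>
     (e N = \<zero> \<longrightarrow> \<not> D (e(x := e (Suc N))) (?W V)) \<and> (e N = e (Suc N) \<oplus> \<one> \<longrightarrow> D (e(x := e (Suc N))) (?W V)))"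
  let ?D = "\<lambda>e V. \<langle>\<langle>encode N e, \<one>\<rangle>, \<zero>\<rangle> \<notin> V 1"
  have 1: "d0 (\<lambda>e V. C e (?W V))"
    using d0_comp[OF *(1) tm_var, of "\<lambda>e V. V 0" "\<lambda>e V. part \<zero> (V 1)"] by (simp add: d0_var tm_var d0_part)
  have 2: "d0 (\<lambda>e V. D (e(x := e (Suc N))) (?W V))"
    using d0_comp[OF *(2), of "\<lambda>i e. if i = x then e (Suc N) else e i" "\<lambda>e V. V 0" "\<lambda>e V. part \<zero> (V 1)"]
    by (simp add: d0_var tm_var tm_if d0_part fun_upd_def)
  have dC: "d0 ?C" by (intro d0_intros 1 2 tm_pair tm_encode)
  have dD: "d0 ?D" by (intro d0_intros tm_pair tm_encode)
  show ?thesis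
  proof (rule implicitI[OF dC dD])
    fix X assume X: "X \<in> Sets M"
    obtain h0 where h0: "computable h0" "\<forall>e. C e (pr_env X (graph h0))" using *(3) X by blast
    let ?S = "pr_env X (graph h0)"
    have S: "?S i \<in> Sets M" for i using X graph_sets[OF h0(1)] by (cases i) simp_all
    have d1D: "d1 (\<lambda>e. D e ?S)" by (rule d1_d0[OF d0_const_sets[OF *(2) S]])
    have "d1 (\<lambda>e. D (\<lambda>i. (if i = x then (\<lambda>e. pr2 (e 0)) else (\<lambda>e. decode N (pr1 (e 0)) i)) e) ?S)"
      by (rule d1_subst_all[OF d1D N]) (simp_all add: f1_pr1 f1_pr2 f1_decode f1_var)
    then have "d1 (\<lambda>e. D ((decode N (pr1 (e 0)))(x := pr2 (e 0))) ?S)"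
      by (rule back_subst[of d1]) (intro ext arg_cong2[where f = D] refl, simp)
    then have "{z. D ((decode N (pr1 z))(x := pr2 z)) ?S} \<in> Sets M"
      by (rule comprehension[of "\<lambda>z. D ((decode N (pr1 z))(x := pr2 z)) ?S"])
    then obtain K where K: "K \<in> Sets M"
      "\<And>c a. \<langle>c, a\<rangle> \<in> K \<longleftrightarrow> D ((decode N c)(x := a)) ?S"
      by (rule that) (simp only: mem_Collect_eq pr_pair)
    \<comment> \<open>The appeal to \<open>ACA\<close>: it decides which coded environments have a
      witness.\<close>
    obtain Y where Y: "Y \<in> Sets M" "\<And>c. c \<in> Y \<longleftrightarrow> (\<exists>a. \<langle>c, a\<rangle> \<in> K)"
      using assms(1) K(1) unfolding ACA_def by blast
    define R where "R c y \<longleftrightarrow> (c \<notin> Y \<and> y = \<zero>) \<or>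
      (c \<in> Y \<and> (\<exists>a. a \<prec> y \<and> y = suc a \<and> \<langle>c, a\<rangle> \<in> K \<and> (\<forall>b. b \<prec> a \<longrightarrow> \<langle>c, b\<rangle> \<notin> K)))" for c y
    have dR: "d1 (\<lambda>e. R (e 0) (e 1))" unfolding R_def
      by (intro d1_d0 d0_intros tm_pair Y K)
    have exR: "\<exists>!y. R c y" for c
    proof (cases "c \<in> Y")
      case True
      then obtain a0 where "\<langle>c, a0\<rangle> \<in> K" using Y by blast
      moreover have "d1 (\<lambda>e. \<langle>c, e 0\<rangle> \<in> K)" by (intro d1_d0 d0_intros tm_pair K)
      ultimately obtain a where a: "\<langle>c, a\<rangle> \<in> K" "\<forall>b. b \<prec> a \<longrightarrow> \<langle>c, b\<rangle> \<notin> K"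
        using least_d1[of "\<lambda>a. \<langle>c, a\<rangle> \<in> K"] by blast
      have "R c (suc a)" unfolding R_def using a True by (auto simp: less_succ_iff)
      moreover have "y = suc a" if Ry: "R c y" for y
      proof -
        obtain b where "y = suc b" "\<langle>c, b\<rangle> \<in> K" "\<forall>d. d \<prec> b \<longrightarrow> \<langle>c, d\<rangle> \<notin> K"
          using Ry True unfolding R_def by blast
        moreover from this a have "\<not> a \<prec> b" "\<not> b \<prec> a" by blast+
        ultimately show ?thesis by (metis M.linorder_cases)
      qed
      ultimately show ?thesis by blast
    qed (auto simp: R_def)
    obtain H where H: "computable H" "\<And>c y. R c y \<longleftrightarrow> y = H c"
      by (rule f1_of_graph[OF dR exR]) (rule that)
    obtain h where h: "computable h" "\<And>i. h \<langle>i, \<zero>\<rangle> = h0 i" "\<And>i. h \<langle>i, \<one>\<rangle> = H i"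
      by (rule f1_join[OF h0(1) H(1)]) (rule that)
    have KD: "\<langle>encode N e, a\<rangle> \<in> K \<longleftrightarrow> D (e(x := a)) ?S" for e a
      unfolding K(2) by (rule N) (simp add: decode_encode)
    have Ce: "?C e (pr_env X (graph h))" for e
    proof -
      have "\<not> D (e(x := a)) ?S" if "H (encode N e) = \<zero>" for a
      proof -
        have "R (encode N e) \<zero>" using H(2) that by simp
        then have "encode N e \<notin> Y" unfolding R_def by (simp add: not_less_zero_ax)
        then show ?thesis using Y(2) KD by blast
      qed
      moreover have "D (e(x := a)) ?S" if "H (encode N e) = suc a" for a
      proof -
        have "R (encode N e) (suc a)" using H(2) that by simp
        then have "\<langle>encode N e, a\<rangle> \<in> K" unfolding R_def using succ_neq_zero succ_inj by blast
        then show ?thesis using KD by blast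
      qed
      ultimately show ?thesis using h0(2) by (auto simp: part_graph graph_fun h)
    qed
    show "\<exists>h. computable h \<and> (\<forall>e. ?C e (pr_env X (graph h)))"
      by (rule exI[of _ h], rule conjI[OF h(1)], rule allI, rule Ce)
  next
    fix X h e assume X: "X \<in> Sets M" and h: "computable h" and C: "\<forall>e. ?C e (pr_env X (graph h))"
    let ?h = "\<lambda>i. h \<langle>i, \<zero>\<rangle>"
    have h': "computable ?h" by (intro f1_app1[OF h] f1_pair f1_var f1_const)
    have C': "\<forall>e. C e (pr_env X (graph ?h))" using C by (simp add: part_graph)
    have P: "P e X \<longleftrightarrow> D e (pr_env X (graph ?h))" for e
      using *(4)[rule_format, OF X h' C'[rule_format]] .
    let ?y = "h \<langle>encode N e, \<one>\<rangle>"
    have 3: "(?y = \<zero> \<longrightarrow> \<not> P (e(x := a)) X) \<and> (?y = suc a \<longrightarrow> P (e(x := a)) X)" for a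
    proof -
      \<comment> \<open>The spare positions are filled with the actual value of the function and the
        candidate \<open>a\<close>.\<close>
      let ?e = "e(N := ?y, Suc N := a)"
      have "encode N ?e = encode N e" by (rule encode_cong) simp
      moreover have "D (e(N := y, Suc N := a, x := a)) V = D (e(x := a)) V" for y V by (rule N) simp
      ultimately show ?thesis using C[rule_format, of ?e] unfolding P by (simp add: part_graph graph_fun)
    qed
    have "(\<exists>a. P (e(x := a)) X) \<longleftrightarrow> ?y \<noteq> \<zero>"
      using 3 zero_or_succ[of ?y] by blast
    then show "(\<exists>a. P (e(x := a)) X) = ?D e (pr_env X (graph h))" by (auto simp: graph_fun)
  qed
qed

lemma tm_val: "tm (\<lambda>e. val e t)"
  by (induction t) (simp_all add: tm.intros)

text \<open>Here variable names are themselves the positions of the environment; this is why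
  \<open>implicit_ex\<close> quantifies by an update at \<open>x\<close> instead of a push.\<close>

lemma implicit_sat:
  assumes "ACA" "arithmetical \<theta>" "range E \<subseteq> Sets M"
  shows "implicit (\<lambda>e X. sat e (E(X0 := X)) \<theta>)"
proof -
  have disj: "implicit (\<lambda>e X. P e X \<or> Q e X)" if "implicit P" "implicit Q" for P Q
    using implicit_not[OF implicit_conj[OF that[THEN implicit_not]]] by simp
  have imp: "implicit (\<lambda>e X. P e X \<longrightarrow> Q e X)" if "implicit P" "implicit Q" for P Q
    using implicit_not[OF implicit_conj[OF that(1) that(2)[THEN implicit_not]]] by simp
  show ?thesis using assms(2)
  proof (induction \<theta>)
    case (Eq s t)
    show ?case by (rule implicit_d0[OF d0_eq[OF tm_val[of s] tm_val[of t]]]) simp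
  next
    case (Less s t)
    show ?case by (rule implicit_d0[OF d0_less[OF tm_val[of s] tm_val[of t]]]) simp
  next
    case (Mem t Y)
    show ?case
    proof (cases "Y = X0")
      case True
      show ?thesis by (rule implicit_d0[OF d0_var[OF tm_val[of t], of 0]]) (simp add: True)
    next
      case False
      have "E Y \<in> Sets M" using assms(3) by blast
      then show ?thesis by (intro implicit_d0[OF d0_mem[OF tm_val[of t]]]) (simp_all add: False)
    qed
  next
    case (AllN x \<theta>)
    then have "implicit (\<lambda>e X. sat e (E(X0 := X)) \<theta>)" by (simp del: fun_upd_apply)
    from implicit_not[OF implicit_ex[OF assms(1) implicit_not[OF this], of x]]
    show ?case by (simp del: fun_upd_apply)
  next
    case (ExN x \<theta>)
    then have "implicit (\<lambda>e X. sat e (E(X0 := X)) \<theta>)" by (simp del: fun_upd_apply)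
    from implicit_ex[OF assms(1) this, of x] show ?case by (simp del: fun_upd_apply)
  next
    case (Iff \<phi> \<psi>)
    then have "implicit (\<lambda>e X. (sat e (E(X0 := X)) \<phi> \<longrightarrow> sat e (E(X0 := X)) \<psi>) \<and> (sat e (E(X0 := X)) \<psi> \<longrightarrow> sat e (E(X0 := X)) \<phi>))"
      by (intro implicit_conj imp) (simp_all del: fun_upd_apply)
    then show ?case by (simp add: iff_conv_conj_imp del: fun_upd_apply)
  qed (simp_all add: implicit_not implicit_conj disj imp del: fun_upd_apply)
qed

section \<open>Trees of attempts\<close>

lemma tm_mono:
  assumes "tm t" "\<And>i. e i \<preceq> e' i" shows "t e \<preceq> t e'"
  using assms(1) by induction (simp_all add: assms(2) M.add_mono M.mult_mono)

text \<open>The use principle: oracles are queried only below a value given by a term. Under a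
  bounded quantifier, terms being monotone, the bound computed at \<open>t e\<close> covers all
  smaller values of the variable. Set parameters do not count as oracles.\<close>

lemma d0_support:
  assumes "d0 P"
  shows "\<exists>b. tm b \<and> (\<forall>e V V'. (\<forall>i z. z \<prec> b e \<longrightarrow> (z \<in> V i \<longleftrightarrow> z \<in> V' i)) \<longrightarrow> P e V = P e V')"
  using assms
proof induction
  case (d0_var t i)
  then show ?case
    by (intro exI[of _ "\<lambda>e. t e \<oplus> \<one>"]) (simp add: tm_add tm_const less_succ_iff)
next
  case (d0_conj P Q)
  then obtain b b' where b: "tm b" "\<And>e V V'. (\<forall>i z. z \<prec> b e \<longrightarrow> (z \<in> V i \<longleftrightarrow> z \<in> V' i)) \<Longrightarrow> P e V = P e V'"
    "tm b'" "\<And>e V V'. (\<forall>i z. z \<prec> b' e \<longrightarrow> (z \<in> V i \<longleftrightarrow> z \<in> V' i)) \<Longrightarrow> Q e V = Q e V'"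
    by blast
  show ?case
  proof (intro exI[of _ "\<lambda>e. b e \<oplus> b' e"] conjI allI impI)
    fix e and V V' :: "nat \<Rightarrow> 'a set" assume *: "\<forall>i z. z \<prec> b e \<oplus> b' e \<longrightarrow> (z \<in> V i \<longleftrightarrow> z \<in> V' i)"
    have "z \<prec> b e \<Longrightarrow> z \<prec> b e \<oplus> b' e" "z \<prec> b' e \<Longrightarrow> z \<prec> b e \<oplus> b' e" for z
      using M.less_le_trans le_add1 le_add2 by blast+
    with * show "(P e V \<and> Q e V) = (P e V' \<and> Q e V')"
      using b(2)[of e V V'] b(4)[of e V V'] by simp
  qed (intro tm_add b)
next
  case (d0_bex_push t P)
  then obtain b where b: "tm b" "\<And>e V V'. (\<forall>i z. z \<prec> b e \<longrightarrow> (z \<in> V i \<longleftrightarrow> z \<in> V' i)) \<Longrightarrow> P e V = P e V'"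
    by blast
  show ?case
  proof (intro exI[of _ "\<lambda>e. b (push (t e) e)"] conjI allI impI)
    show "tm (\<lambda>e. b (push (t e) e))"
      using tm_subst[OF b(1), of "\<lambda>i. case i of 0 \<Rightarrow> t | Suc j \<Rightarrow> (\<lambda>e. e j)"] d0_bex_push(1)
      by (simp add: tm_case tm_var push_case)
    fix e and V V' :: "nat \<Rightarrow> 'a set" assume *: "\<forall>i z. z \<prec> b (push (t e) e) \<longrightarrow> (z \<in> V i \<longleftrightarrow> z \<in> V' i)"
    have "P (push y e) V = P (push y e) V'" if "y \<prec> t e" for y
    proof (rule b(2))
      have "b (push y e) \<preceq> b (push (t e) e)"
        by (rule tm_mono[OF b(1)]) (use that in \<open>simp add: push_def le_def split: nat.split\<close>)
      with * show "\<forall>i z. z \<prec> b (push y e) \<longrightarrow> (z \<in> V i \<longleftrightarrow> z \<in> V' i)"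
        using M.less_le_trans by blast
    qed
    then show "(\<exists>y. y \<prec> t e \<and> P (push y e) V) = (\<exists>y. y \<prec> t e \<and> P (push y e) V')" by blast
  qed
next
  case (d0_not P)
  then show ?case by simp
qed (rule exI[of _ "\<lambda>e. \<zero>"], simp add: tm_const)+

definition elems :: "'a \<Rightarrow> 'a set" where
  "elems s = {z. elem z s}"

text \<open>A sequence is a finite set of pairs, and a pair below \<open>k\<close> has its first
  component below \<open>k\<close>. Hence the code of a restriction is itself an approximation of
  the graph.\<close>

lemma elems_mk:
  assumes "computable h" "z \<prec> k" shows "z \<in> elems (mk k h) \<longleftrightarrow> z \<in> graph h"
proof -
  note mk = mk_seq[OF assms(1)]
  have 1: "\<langle>i, j\<rangle> \<in> elems (mk k h) \<longleftrightarrow> i \<prec> k \<and> h i = j" for i j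
    using entry_iff[OF mk(1), of k i j] mk unfolding elems_def entry_def by auto
  have "\<exists>i j. z = \<langle>i, j\<rangle>" if "z \<in> elems (mk k h)"
    using that mk(1)[of k] unfolding elems_def is_seq_def by blast
  moreover have "z \<in> elems (mk k h) \<longleftrightarrow> z \<in> graph h" if "z = \<langle>i, j\<rangle>" for i j
    using 1[of i j] assms(2) M.le_less_trans[OF pair_ge1[of i j], of k] that by (auto simp: graph_fun)
  ultimately show ?thesis unfolding graph_def by blast
qed

lemma elems_initseg:
  assumes "is_seq s" "is_seq t" "len t \<preceq> len s" "\<And>i. i \<prec> len t \<Longrightarrow> nth t i = nth s i" "z \<prec> len t"
  shows "z \<in> elems t \<longleftrightarrow> z \<in> elems s"
proof -
  have "\<exists>i j. z = \<langle>i, j\<rangle>" if "elem z s \<or> elem z t"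
    using that assms(1,2) unfolding is_seq_def by blast
  moreover have "elem \<langle>i, j\<rangle> s \<longleftrightarrow> elem \<langle>i, j\<rangle> t" if "z = \<langle>i, j\<rangle>" for i j
  proof -
    have "i \<prec> len t" "i \<prec> len s" using that assms(3,5) pair_ge1[of i j] by order+
    then show ?thesis using entry_iff assms unfolding entry_def[symmetric] by simp
  qed
  ultimately show ?thesis unfolding elems_def by blast
qed

text \<open>A finite sequence stays in the tree as long as it violates no instance of \<open>R\<close> whose truth is
  decided by it, according to the bound of \<open>d0_support\<close>.\<close>

lemma tree_of_attempts:
  assumes "d0 R"
  obtains T where "T \<in> Sets M" "\<And>n. is_tree (row T n)"
    "\<And>n. has_path (row T n) \<longleftrightarrow> (\<exists>h. computable h \<and> (\<forall>e. R (push n e) (\<lambda>_. graph h)))"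
proof -
  obtain N where "depends_below N R" using d0_finite_support[OF assms] by blast
  from depends_belowD[OF this] have N: "(\<And>i. i < N \<Longrightarrow> e i = e' i) \<Longrightarrow> R e V = R e' V" for e e' V
    by (rule fun_cong)
  obtain b where b: "tm b" "\<And>e V V'. (\<And>i z. z \<prec> b e \<Longrightarrow> (z \<in> V i \<longleftrightarrow> z \<in> V' i)) \<Longrightarrow> R e V = R e V'"
    using d0_support[OF assms] by blast
  \<comment> \<open>Considering only codes \<open>c\<close> below the length keeps \<open>Q\<close>
    decidable. Along a path nothing is lost, since every instance is considered once the length is
    large enough.\<close>
  define Q where "Q s n \<longleftrightarrow> is_seq s \<and> (\<forall>c. c \<prec> len s \<longrightarrow> b (push n (decode N c)) \<preceq> len s \<longrightarrow>
     R (push n (decode N c)) (\<lambda>_. elems s))" for s n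
  have "d0 (\<lambda>e V. R (shift e) (\<lambda>_. elems (e 0)))"
    by (rule d0_subst[OF assms tm_var, where G = "\<lambda>i e V. elems (e 0)"])
      (unfold elems_def mem_Collect_eq, intro d0_elem tm_var)
  from d1_d0[OF this] have 1: "d1 (\<lambda>e. R (shift e) (\<lambda>_. elems (e 0)))" .
  have "d1 (\<lambda>e. R (\<lambda>i. (case Suc i of 0 \<Rightarrow> (\<lambda>e. e 1) | Suc j \<Rightarrow>
      (case j of 0 \<Rightarrow> (\<lambda>e. e 2) | Suc k \<Rightarrow> (\<lambda>e. decode N (e 0) k))) e) (\<lambda>_. elems ((case 0 of 0 \<Rightarrow> (\<lambda>e. e 1) | Suc j \<Rightarrow>
      (case j of 0 \<Rightarrow> (\<lambda>e. e 2) | Suc k \<Rightarrow> (\<lambda>e. decode N (e 0) k))) e)))"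
  proof (rule d1_subst_all[OF 1, where N = "Suc N" and s = "\<lambda>i. case i of 0 \<Rightarrow> (\<lambda>e. e 1) | Suc j \<Rightarrow>
      (case j of 0 \<Rightarrow> (\<lambda>e. e 2) | Suc k \<Rightarrow> (\<lambda>e. decode N (e 0) k))"])
    fix e e' :: "nat \<Rightarrow> 'a" assume *: "\<And>i. i < Suc N \<Longrightarrow> e i = e' i"
    have "R (shift e) V = R (\<lambda>i. e' (Suc i)) V" for V by (rule N) (simp add: *)
    then show "R (shift e) (\<lambda>_. elems (e 0)) = R (\<lambda>i. e' (Suc i)) (\<lambda>_. elems (e' 0))"
      using *[of 0] by simp
  qed (intro f1_case f1_var f1_decode)
  then have 2: "d1 (\<lambda>e. R (push (e 2) (decode N (e 0))) (\<lambda>_. elems (e 1)))"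
    by (simp add: push_case)
  have 3: "f1 (\<lambda>e. b (push (e 2) (decode N (e 0))))"
    using f1_tm_subst[OF b(1), of "\<lambda>i. case i of 0 \<Rightarrow> (\<lambda>e. e 2) | Suc k \<Rightarrow> (\<lambda>e. decode N (e 0) k)"]
    by (simp add: f1_case f1_var f1_decode push_case)
  have "d1 (\<lambda>e. Q (e 0) (e 1))"
    unfolding Q_def using 2 3 by (intro d1_intros d1_is_seq f1_len f1_var) (simp_all add: numeral_2_eq_2)
  from rows_exist[OF this] obtain T where T: "T \<in> Sets M" "\<And>n. row T n = {s. Q s n}" by blast
  have tree: "is_tree (row T n)" for n
    unfolding T(2)
  proof (rule treeI)
    fix s t assume s: "s \<in> {s. Q s n}" "is_seq s" and t: "is_seq t" "len t \<preceq> len s" "\<And>i. i \<prec> len t \<Longrightarrow> nth t i = nth s i"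
    have "R (push n (decode N c)) (\<lambda>_. elems t)" if c: "c \<prec> len t" "b (push n (decode N c)) \<preceq> len t" for c
    proof -
      have "c \<prec> len s" "b (push n (decode N c)) \<preceq> len s" using c t(2) by order+
      then have "R (push n (decode N c)) (\<lambda>_. elems s)" using s(1) unfolding Q_def by blast
      moreover have "R (push n (decode N c)) (\<lambda>_. elems t) = R (push n (decode N c)) (\<lambda>_. elems s)"
      proof (rule b(2))
        fix z assume "z \<prec> b (push n (decode N c))"
        then have "z \<prec> len t" using c(2) by order
        then show "z \<in> elems t \<longleftrightarrow> z \<in> elems s" using elems_initseg[OF s(2) t] by simp
      qed
      ultimately show ?thesis by simp
    qed
    then show "t \<in> {s. Q s n}" unfolding Q_def using t(1) by simp
  qed (simp add: Q_def)
  have "has_path (row T n) \<longleftrightarrow> (\<exists>h. computable h \<and> (\<forall>e. R (push n e) (\<lambda>_. graph h)))" for n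
    unfolding has_path_iff[OF tree]
  proof (intro iff_exI conj_cong refl iffI allI)
    fix h and e :: "nat \<Rightarrow> 'a" assume h: "computable h" and p: "\<forall>k. mk k h \<in> row T n"
    let ?c = "encode N e"
    let ?e = "push n (decode N ?c)"
    \<comment> \<open>Long enough for the instance coded by \<open>?c\<close> to be both considered
      and decided.\<close>
    let ?k = "?c \<oplus> b ?e \<oplus> \<one>"
    have k: "?c \<prec> ?k" "b ?e \<preceq> ?k"
    proof -
      show "?c \<prec> ?k" by (simp add: less_succ_iff)
      have "b ?e \<preceq> ?c \<oplus> b ?e" "?c \<oplus> b ?e \<preceq> ?k" by simp_all
      then show "b ?e \<preceq> ?k" by order
    qed
    then have "R ?e (\<lambda>_. elems (mk ?k h))"
      using p[rule_format, of ?k] unfolding T(2) Q_def by (simp add: mk_seq[OF h])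
    moreover have "R ?e (\<lambda>_. elems (mk ?k h)) = R ?e (\<lambda>_. graph h)"
    proof (rule b(2))
      fix z assume "z \<prec> b ?e"
      then have "z \<prec> ?k" using k(2) by order
      then show "z \<in> elems (mk ?k h) \<longleftrightarrow> z \<in> graph h" by (rule elems_mk[OF h])
    qed
    moreover have "R ?e V = R (push n e) V" for V
      by (rule N) (simp add: push_def decode_encode split: nat.split)
    ultimately show "R (push n e) (\<lambda>_. graph h)" by simp
  next
    fix h k assume h: "computable h" and p: "\<forall>e. R (push n e) (\<lambda>_. graph h)"
    have "R (push n (decode N c)) (\<lambda>_. elems (mk k h))" if "b (push n (decode N c)) \<preceq> k" for c
    proof -
      have "R (push n (decode N c)) (\<lambda>_. elems (mk k h)) = R (push n (decode N c)) (\<lambda>_. graph h)"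
      proof (rule b(2))
        fix z assume "z \<prec> b (push n (decode N c))"
        then have "z \<prec> k" using that by order
        then show "z \<in> elems (mk k h) \<longleftrightarrow> z \<in> graph h" by (rule elems_mk[OF h])
      qed
      then show ?thesis using p by simp
    qed
    then show "mk k h \<in> row T n" unfolding T(2) Q_def by (simp add: mk_seq[OF h])
  qed
  then show ?thesis using that T(1) tree by blast
qed

text \<open>The tree searches for a counterexample \<open>X\<close> together with the auxiliary
  function that evaluates the matrix on it. Component 1 of a path is the characteristic function of
  \<open>X\<close>, component 0 is the auxiliary function.\<close>

lemma WF_hat_Pi11:
  assumes "ACA" "WF_hat" shows "Pi11_CA"
  unfolding Pi11_CA_def
proof (intro allI impI)
  fix \<phi> v and e0 :: "nat \<Rightarrow> 'a" and E :: "nat \<Rightarrow> 'a set" assume "Pi11 \<phi>" and E: "range E \<subseteq> Sets M"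
  then obtain X0 \<theta> where \<phi>: "\<phi> = AllS X0 \<theta>" "arithmetical \<theta>" unfolding Pi11_def by blast
  have "implicit (\<lambda>e X. \<not> sat e (E(X0 := X)) \<theta>)"
    by (rule implicit_not[OF implicit_sat[OF assms(1) \<phi>(2) E]])
  then obtain C D where *: "d0 C" "d0 D"
    "solvable C"
    "\<forall>X\<in>Sets M. \<forall>h. computable h \<longrightarrow> (\<forall>e. C e (pr_env X (graph h))) \<longrightarrow>
         (\<forall>e. \<not> sat e (E(X0 := X)) \<theta> \<longleftrightarrow> D e (pr_env X (graph h)))"
    by (rule implicitE)
  \<comment> \<open>Values other than \<open>\<one>\<close> count as non-membership, so every
    function codes some \<open>X\<close>.\<close>
  let ?X = "\<lambda>F. {x. \<langle>\<langle>x, \<one>\<rangle>, \<one>\<rangle> \<in> F}"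
  let ?W = "\<lambda>V :: nat \<Rightarrow> 'a set. pr_env (?X (V 0)) (part \<zero> (V 0))"
  \<comment> \<open>The defining condition \<open>C\<close> is demanded for all environments, the
    negated matrix \<open>D\<close> only at \<open>e0\<close> with the current instance put in for
    \<open>v\<close>.\<close>
  let ?R = "\<lambda>e V. C (shift e) (?W V) \<and> D (e0(v := e 0)) (?W V)"
  have X: "d0 (\<lambda>e V. e 0 \<in> ?X (V 0))"
    unfolding mem_Collect_eq by (intro d0_intros tm_pair)
  have 1: "d0 (\<lambda>e V. C (shift e) (?W V))"
    using d0_comp[OF *(1), of "\<lambda>i e. e (Suc i)" "\<lambda>e V. ?X (V 0)" "\<lambda>e V. part \<zero> (V 0)"] X
    by (simp add: tm_var d0_part)
  have 2: "d0 (\<lambda>e V. D (e0(v := e 0)) (?W V))"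
    using d0_comp[OF *(2), of "\<lambda>i e. if i = v then e 0 else e0 i" "\<lambda>e V. ?X (V 0)" "\<lambda>e V. part \<zero> (V 0)"] X
    by (simp add: tm_var tm_if tm_const d0_part fun_upd_def)
  have "d0 ?R" by (intro d0_conj 1 2)
  then obtain T where T: "T \<in> Sets M" "\<And>n. is_tree (row T n)"
    "\<And>n. has_path (row T n) \<longleftrightarrow> (\<exists>h. computable h \<and> (\<forall>e. ?R (push n e) (\<lambda>_. graph h)))"
    by (rule tree_of_attempts) blast
  obtain Z where Z: "Z \<in> Sets M" "\<And>n. n \<in> Z \<longleftrightarrow> \<not> has_path (row T n)"
    using assms(2) T(1,2) unfolding WF_hat_def by blast
  have "has_path (row T n) \<longleftrightarrow> \<not> sat (e0(v := n)) E \<phi>" for n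
  proof
    assume "has_path (row T n)"
    then obtain h where h: "computable h" "\<forall>e. ?R (push n e) (\<lambda>_. graph h)" unfolding T(3) by blast
    let ?h = "\<lambda>i. h \<langle>i, \<zero>\<rangle>"
    have h': "computable ?h" by (intro f1_app1[OF h(1)] f1_pair f1_var f1_const)
    have XS: "?X (graph h) \<in> Sets M"
      by (rule comprehension) (intro d1_d0 d0_intros tm_pair graph_sets h(1))
    have C: "C e (pr_env (?X (graph h)) (graph ?h))" "D (e0(v := n)) (pr_env (?X (graph h)) (graph ?h))" for e
      using h(2)[rule_format, of e] by (simp_all add: part_graph)
    then have "\<not> sat (e0(v := n)) (E(X0 := ?X (graph h))) \<theta>"
      using *(4)[rule_format, OF XS h' C(1)] by simp
    then show "\<not> sat (e0(v := n)) E \<phi>" using XS unfolding \<phi> by auto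
  next
    assume "\<not> sat (e0(v := n)) E \<phi>"
    then obtain A where A: "A \<in> Sets M" "\<not> sat (e0(v := n)) (E(X0 := A)) \<theta>" unfolding \<phi> by auto
    obtain h0 where h0: "computable h0" "\<forall>e. C e (pr_env A (graph h0))" using *(3) A by blast
    have "f1 (\<lambda>e. if e 0 \<in> A then \<one> else \<zero>)" by (intro f1_if d1_mem A f1_var f1_const)
    then obtain h where h: "computable h" "\<And>i. h \<langle>i, \<zero>\<rangle> = h0 i" "\<And>i. h \<langle>i, \<one>\<rangle> = (if i \<in> A then \<one> else \<zero>)"
      by (rule f1_join[OF h0(1), where ?h1.0 = "\<lambda>i. if i \<in> A then \<one> else \<zero>"]) (rule that)
    have XA: "?X (graph h) = A" by (auto simp: graph_fun h)
    have "D (e0(v := n)) (pr_env A (graph h0))"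
      using *(4)[rule_format, OF A(1) h0(1) h0(2)[rule_format]] A(2) by simp
    then have "?R (push n e) (\<lambda>_. graph h)" for e using h0(2) by (simp only: XA part_graph h push_simps push_eta)
    then show "has_path (row T n)" unfolding T(3) using h(1) by (intro exI[of _ h]) simp
  qed
  then show "\<exists>Z\<in>Sets M. \<forall>n. n \<in> Z \<longleftrightarrow> sat (e0(v := n)) E \<phi>" using Z by (intro bexI[of _ Z]) simp_all
qed

lemma WF_hat_L_WF_hat:
  assumes "ACA" "WF_hat_L" shows "WF_hat"
  unfolding WF_hat_def
proof (intro ballI impI)
  fix T assume T: "T \<in> Sets M" and tree: "\<forall>i. is_tree (row T i)"
  \<comment> \<open>Here \<open>z\<close> stands for a node paired with the index of its tree, and
    \<open>t\<close> for a proper extension of the node in that tree.\<close>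
  let ?Q = "\<lambda>z t. \<langle>t, pr2 z\<rangle> \<in> T \<and> len (pr1 z) \<prec> len t \<and> (\<forall>i. i \<prec> len (pr1 z) \<longrightarrow> nth (pr1 z) i = nth t i)"
  have "{w. ?Q (pr1 w) (pr2 w)} \<in> Sets M"
    by (rule comprehension) (intro d1_intros f1_intros f1_len f1_nth f1_pair f1_pr1 f1_pr2 T)
  then have "{z. \<exists>t. \<langle>z, t\<rangle> \<in> {w. ?Q (pr1 w) (pr2 w)}} \<in> Sets M" using assms(1) unfolding ACA_def by blast
  then have B: "{z. \<exists>t. ?Q z t} \<in> Sets M" by simp
  let ?L = "{z. z \<in> T \<and> z \<notin> {z. \<exists>t. ?Q z t}}"
  have L: "?L \<in> Sets M" by (rule comprehension) (intro d1_conj d1_not d1_mem T B f1_var)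
  have rows: "is_tree (row T i) \<and> row ?L i = leaf (row T i)" for i
  proof (intro conjI tree[rule_format])
    show "row ?L i = leaf (row T i)"
    proof (intro set_eqI)
      fix s
      have ext: "s \<sqsubseteq> t \<and> t \<noteq> s \<longleftrightarrow> len s \<prec> len t \<and> (\<forall>i. i \<prec> len s \<longrightarrow> nth s i = nth t i)"
        if "s \<in> row T i" "t \<in> row T i" for t
      proof -
        have sq: "is_seq s" "is_seq t" using tree that treeD(1) by blast+
        have "t = s" if "len s = len t" "\<forall>i. i \<prec> len s \<longrightarrow> nth s i = nth t i"
          using that by (intro seq_ext[OF sq(2,1)]) simp_all
        then show ?thesis unfolding initseg_iff[OF sq] le_def by auto
      qed
      have "s \<in> row ?L i \<longleftrightarrow> s \<in> row T i \<and>
          \<not> (\<exists>t. t \<in> row T i \<and> len s \<prec> len t \<and> (\<forall>i. i \<prec> len s \<longrightarrow> nth s i = nth t i))"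
        by (simp add: mem_row)
      then show "s \<in> row ?L i \<longleftrightarrow> s \<in> leaf (row T i)"
        unfolding leaf_def using ext by (simp only: mem_Collect_eq Bex_def) blast
    qed
  qed
  show "\<exists>Z\<in>Sets M. \<forall>n. n \<in> Z \<longleftrightarrow> \<not> has_path (row T n)"
    by (rule assms(2)[unfolded WF_hat_L_def, rule_format, OF T L rows])
qed

lemma WF_hat_L_Pi11: "WF_hat_L \<Longrightarrow> Pi11_CA"
proof -
  assume wf: "WF_hat_L"
  have "ACA" unfolding ACA_def using WF_hat_L_projection[OF wf] by blast
  then show ?thesis using WF_hat_Pi11 WF_hat_L_WF_hat wf by blast
qed


section \<open>Primitive recursion\<close>

lemma initseg_alt:
  "s \<sqsubseteq> t \<longleftrightarrow> is_seq s \<and> is_seq t \<and> len s \<preceq> len t \<and> (\<forall>i. i \<prec> len s \<longrightarrow> nth s i = nth t i)"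
  using initseg_iff unfolding initseg_def by blast

lemma d1_initseg: "f1 s \<Longrightarrow> f1 t \<Longrightarrow> d1 (\<lambda>e. s e \<sqsubseteq> t e)"
  unfolding initseg_alt by (intro d1_intros d1_is_seq f1_len f1_nth f1_var f1_tl)

lemma initseg_trans: "s \<sqsubseteq> t \<Longrightarrow> t \<sqsubseteq> u \<Longrightarrow> s \<sqsubseteq> u"
  unfolding initseg_def by blast

lemma initseg_refl: "is_seq s \<Longrightarrow> s \<sqsubseteq> s"
  unfolding initseg_def by blast

lemma initseg_neq: "s \<sqsubseteq> t \<Longrightarrow> t \<noteq> s \<Longrightarrow> len s \<prec> len t"
proof -
  assume *: "s \<sqsubseteq> t" "t \<noteq> s"
  have "len s \<noteq> len t"
  proof
    assume "len s = len t"
    then have "t = s" using *(1) unfolding initseg_alt by (intro seq_ext[of t s]) simp_all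
    with *(2) show False by simp
  qed
  moreover have "len s \<preceq> len t" using *(1) unfolding initseg_alt by blast
  ultimately show ?thesis by order
qed

text \<open>Finite computation sequences exist by \<open>\<Sigma>\<^sup>0\<^sub>1\<close> induction
  and agree where both are defined, so the values can be read off any of them.\<close>

lemma prim_rec:
  assumes G: "computable G"
  obtains r where "computable r" "r \<zero> = x0" "\<And>k. r (suc k) = G (r k)"
proof -
  define W where "W s k \<longleftrightarrow> is_seq s \<and> len s = suc k \<and> nth s \<zero> = x0 \<and>
    (\<forall>i. i \<prec> k \<longrightarrow> nth s (suc i) = G (nth s i))" for s k
  have dW: "d1 (\<lambda>e. W (e 0) (e 1))" unfolding W_def
    by (intro d1_intros d1_is_seq f1_intros f1_len f1_nth f1_app1[OF G])
  have ex: "\<exists>s. W s k" for k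
  proof (rule induction_s1[where P = "\<lambda>k. \<exists>s. W s k"])
    have "d1 (\<lambda>e. W (e 0) (e (Suc 0)))" using dW by simp
    then show "s1 (\<lambda>e. \<exists>s. W s (e 0))" by (intro s1_ex d1D(1))
    obtain s where s: "is_seq s" "len s = \<zero>" using mk_seq[OF f1_const, of \<zero>] by blast
    have "W (app s x0) \<zero>" unfolding W_def using app_seq[of s x0] s by (simp add: not_less_zero_ax)
    then show "\<exists>s. W s \<zero>" by blast
    fix k assume "\<exists>s. W s k"
    then obtain s where s: "W s k" by blast
    have l: "len s = suc k" using s unfolding W_def by blast
    let ?s = "app s (G (nth s k))"
    have a: "nth ?s i = nth s i" if "i \<preceq> k" for i using app_seq(4)[of i s] l that by (simp add: less_succ_iff)
    have b: "nth ?s (suc k) = G (nth s k)" using app_seq(3)[of s] l by simp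
    have "W ?s (suc k)" unfolding W_def
    proof (intro conjI allI impI)
      show "nth ?s \<zero> = x0" using a[of \<zero>] s unfolding W_def by simp
      fix i assume "i \<prec> suc k"
      then have i: "i \<prec> k \<or> i = k" by (simp add: less_succ_ax)
      then show "nth ?s (suc i) = G (nth ?s i)"
      proof
        assume i: "i \<prec> k"
        then have "suc i \<preceq> k" "i \<preceq> k" using less_imp_succ_le le_def by blast+
        then show ?thesis using a i s unfolding W_def by simp
      next
        assume "i = k" then show ?thesis using a[of k] b by simp
      qed
    qed (use app_seq(1,2) l in simp_all)
    then show "\<exists>s. W s (suc k)" by blast
  qed
  \<comment> \<open>Sequences of different lengths are compared, because values of \<open>r\<close>
    are later read off longer sequences.\<close>
  have uniq: "i \<preceq> k \<longrightarrow> i \<preceq> k' \<longrightarrow> nth s i = nth s' i" if s: "W s k" "W s' k'" for s k s' k' i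
  proof (rule induction_d1[where P = "\<lambda>i. i \<preceq> k \<longrightarrow> i \<preceq> k' \<longrightarrow> nth s i = nth s' i"])
    show "d1 (\<lambda>e. e 0 \<preceq> k \<longrightarrow> e 0 \<preceq> k' \<longrightarrow> nth s (e 0) = nth s' (e 0))"
      by (intro d1_intros f1_intros f1_nth)
    show "\<zero> \<preceq> k \<longrightarrow> \<zero> \<preceq> k' \<longrightarrow> nth s \<zero> = nth s' \<zero>" using s unfolding W_def by simp
    fix i assume IH: "i \<preceq> k \<longrightarrow> i \<preceq> k' \<longrightarrow> nth s i = nth s' i"
    show "suc i \<preceq> k \<longrightarrow> i \<oplus> \<one> \<preceq> k' \<longrightarrow> nth s (suc i) = nth s' (suc i)"
      unfolding less_imp_succ_le[symmetric]
    proof (intro impI)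
      assume i: "i \<prec> k" "i \<prec> k'"
      then have "nth s i = nth s' i" using IH by (simp add: le_def)
      then show "nth s (suc i) = nth s' (suc i)" using i s unfolding W_def by simp
    qed
  qed
  \<comment> \<open>The choice is arbitrary, but by \<open>uniq\<close> the value does not depend on
    it; this makes the graph of \<open>r\<close> \<open>\<Sigma>\<^sup>0\<^sub>1\<close>.\<close>
  define r where "r k = nth (SOME s. W s k) k" for k
  have someW: "W (SOME s. W s k) k" for k using ex by (rule someI_ex)
  have r: "(\<exists>s. W s k \<and> nth s k = y) \<longleftrightarrow> y = r k" for k y
  proof
    assume "\<exists>s. W s k \<and> nth s k = y"
    then obtain s where s: "W s k" "nth s k = y" by blast
    then show "y = r k" using uniq[OF s(1) someW[of k], of k] unfolding r_def by simp
  next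
    assume "y = r k"
    then show "\<exists>s. W s k \<and> nth s k = y" using someW[of k] unfolding r_def by blast
  qed
  have val: "r k = nth s i" if "W s k'" "k = i" "i \<preceq> k'" for s i k k'
  proof -
    obtain s' where s': "W s' k" using ex by blast
    then have "nth s' k = r k" using r by blast
    then show ?thesis using uniq[OF that(1) s', of i] that(2,3) by simp
  qed
  have "d1 (\<lambda>e. W (e 0) (e 2))" by (rule d1_app2[OF dW]) (rule f1_var)+
  then have "s1 (\<lambda>e. \<exists>s. W s (e 1) \<and> nth s (e 1) = e 0)"
    by (intro s1_ex d1D(1) d1_conj d1_eq f1_nth f1_var) (simp add: numeral_2_eq_2)
  then have "computable r" unfolding r f1_def by simp
  moreover have "r \<zero> = x0"
  proof -
    obtain s where s: "W s \<zero>" using ex by blast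
    then show ?thesis using val[OF s, of \<zero> \<zero>] unfolding W_def by simp
  qed
  moreover have "r (suc k) = G (r k)" for k
  proof -
    obtain s where s: "W s (suc k)" using ex by blast
    have "k \<preceq> suc k" "k \<prec> suc k" by (simp_all add: less_succ_iff)
    then show ?thesis using val[OF s, of k k] val[OF s, of "suc k" "suc k"] s unfolding W_def by simp
  qed
  ultimately show ?thesis by (rule that)
qed

section \<open>Well-foundedness from perfect kernels\<close>

lemma monus_one [simp]: "suc i \<ominus> \<one> = i"
  using monus_add[of \<one> i] add_comm by metis

lemma f1_monus: "f1 s \<Longrightarrow> f1 t \<Longrightarrow> f1 (\<lambda>e. s e \<ominus> t e)"
proof (rule f1_app2[where g = monus], rule f1I)
  have "y = a \<ominus> b \<longleftrightarrow> (b \<preceq> a \<and> a = y \<oplus> b) \<or> (\<not> b \<preceq> a \<and> y = \<zero>)" for y a b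
    using add_monus[of b a] monus_add[of b y] add_comm[of b y] by (auto simp: monus_def)
  then show "d1 (\<lambda>e. e 0 = e (Suc 0) \<ominus> e (Suc 1))"
    by simp (intro d1_intros f1_intros)
qed

text \<open>Undoes the coding of a sequence of trees in one tree: the leading index and the bits are
  dropped, and what remains is to be tested for membership in the indexed tree.\<close>

definition tail :: "'a \<Rightarrow> 'a" where
  "tail t = mk (len t \<ominus> \<one>) (\<lambda>i. pr1 (nth t (suc i)))"

lemma tail_seq:
  assumes "len t = suc l"
  shows "is_seq (tail t)" "len (tail t) = l" "i \<prec> l \<Longrightarrow> nth (tail t) i = pr1 (nth t (suc i))"
proof -
  have f: "f1 (\<lambda>e. pr1 (nth t (e 0 \<oplus> \<one>)))" by (intro f1_pr1 f1_nth f1_intros)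
  show "is_seq (tail t)" "len (tail t) = l" "i \<prec> l \<Longrightarrow> nth (tail t) i = pr1 (nth t (suc i))"
    using mk_seq[OF f] unfolding tail_def assms by simp_all
qed

lemma f1_tail: "f1 s \<Longrightarrow> f1 (\<lambda>e. tail (s e))"
  unfolding tail_def by (intro f1_mk f1_monus f1_len f1_pr1 f1_nth f1_intros f1_tl)

text \<open>A nonempty element of \<open>doubled T\<close> is a number \<open>n\<close> followed by an element of \<open>row T n\<close> whose
  entries have been paired with arbitrary bits.  All sequences of length at most \<open>1\<close> belong to
  \<open>doubled T\<close>, even if \<open>row T n\<close> is empty.\<close>

definition bit_pairs :: "'a \<Rightarrow> bool" where
  "bit_pairs t \<longleftrightarrow> (\<forall>i. i \<prec> len t \<longrightarrow> i \<noteq> \<zero> \<longrightarrow> nth t i = \<langle>pr1 (nth t i), pr2 (nth t i)\<rangle> \<and> pr2 (nth t i) \<preceq> \<one>)"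

definition doubled :: "'a set \<Rightarrow> 'a set" where
  "doubled T = {t. is_seq t \<and> bit_pairs t \<and> (\<one> \<prec> len t \<longrightarrow> \<langle>tail t, nth t \<zero>\<rangle> \<in> T)}"

lemma d1_bit_pairs: "f1 s \<Longrightarrow> d1 (\<lambda>e. bit_pairs (s e))"
  unfolding bit_pairs_def by (intro d1_intros f1_len f1_pr1 f1_pr2 f1_pair f1_nth f1_intros f1_tl)

lemma doubled_sets: "T \<in> Sets M \<Longrightarrow> doubled T \<in> Sets M"
  unfolding doubled_def
  by (rule comprehension) (intro d1_intros d1_is_seq d1_bit_pairs f1_len f1_nth f1_pair f1_tail f1_intros)

lemma len_pos: "\<one> \<prec> l \<Longrightarrow> \<exists>k. l = suc k \<and> k \<noteq> \<zero>"
  using zero_or_succ[of l] not_less_zero_ax[of \<one>] by (auto simp: zero_add)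

lemma pos_succ: "k \<noteq> \<zero> \<Longrightarrow> \<one> \<prec> suc k"
  unfolding less_succ_iff using less_one_iff[of k] by (metis M.not_le)

lemma bit_pairs_initseg: "bit_pairs s \<Longrightarrow> len t \<preceq> len s \<Longrightarrow> (\<And>i. i \<prec> len t \<Longrightarrow> nth t i = nth s i) \<Longrightarrow> bit_pairs t"
  unfolding bit_pairs_def using M.less_le_trans by simp

lemma tail_initseg:
  assumes "t \<sqsubseteq> s" "len t = suc l" shows "tail t \<sqsubseteq> tail s"
proof -
  have ts: "len t \<preceq> len s" "\<And>i. i \<prec> len t \<Longrightarrow> nth t i = nth s i" using assms(1) unfolding initseg_alt by blast+
  then have "l \<prec> len s" using assms(2) by (simp add: less_imp_succ_le)
  then obtain k where k: "len s = suc k" using zero_or_succ[of "len s"] not_less_zero_ax[of l] by auto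
  have "l \<preceq> k" using ts(1) unfolding assms(2) k by simp
  moreover have "i \<prec> k" if "i \<prec> l" for i using that \<open>l \<preceq> k\<close> by order
  ultimately show ?thesis
    unfolding initseg_alt using tail_seq[OF assms(2)] tail_seq[OF k] ts(2) assms(2) by simp
qed

lemma doubled_tree:
  assumes "\<And>n. is_tree (row T n)" shows "is_tree (doubled T)"
proof (rule treeI)
  fix s t assume s: "s \<in> doubled T" "is_seq s" and t: "is_seq t" "len t \<preceq> len s" "\<And>i. i \<prec> len t \<Longrightarrow> nth t i = nth s i"
  have ts: "t \<sqsubseteq> s" using s t unfolding initseg_alt by blast
  have "\<langle>tail t, nth t \<zero>\<rangle> \<in> T" if l: "\<one> \<prec> len t"
  proof -
    obtain k where k: "len t = suc k" using len_pos[OF l] by blast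
    have "\<one> \<prec> len s" using l t(2) by order
    then have "tail s \<in> row T (nth s \<zero>)" using s(1) unfolding doubled_def mem_row by blast
    then have "tail t \<in> row T (nth s \<zero>)"
      using tail_initseg[OF ts k] assms unfolding is_tree_def by blast
    moreover have "nth t \<zero> = nth s \<zero>" using t(3)[of \<zero>] k by (simp add: less_succ_iff)
    ultimately show ?thesis unfolding mem_row by simp
  qed
  moreover have "bit_pairs t" using s(1) t(2,3) bit_pairs_initseg unfolding doubled_def by blast
  ultimately show "t \<in> doubled T" unfolding doubled_def using t(1) by blast
qed (simp add: doubled_def)

lemma app_bit_pairs:
  assumes "bit_pairs t" "len t = \<zero> \<or> (\<exists>a b. x = \<langle>a, b\<rangle> \<and> b \<preceq> \<one>)" shows "bit_pairs (app t x)"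
  unfolding bit_pairs_def app_seq(2)
proof (intro allI impI)
  fix i assume i: "i \<prec> len t \<oplus> \<one>" "i \<noteq> \<zero>"
  show "nth (app t x) i = \<langle>pr1 (nth (app t x) i), pr2 (nth (app t x) i)\<rangle> \<and> pr2 (nth (app t x) i) \<preceq> \<one>"
  proof (cases "i = len t")
    case True
    then show ?thesis using assms(2) i(2) app_seq(3) by auto
  next
    case False
    then have "i \<prec> len t" using i(1) by (simp add: less_succ_ax)
    then show ?thesis using assms(1) i(2) app_seq(4) unfolding bit_pairs_def by simp
  qed
qed

lemma tail_app:
  assumes "len t = suc l"
  shows "len (tail (app t x)) = suc l" "nth (tail (app t x)) l = pr1 x"
    "i \<prec> l \<Longrightarrow> nth (tail (app t x)) i = nth (tail t) i"
proof -
  have l: "len (app t x) = suc l \<oplus> \<one>" using app_seq(2) assms by simp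
  show "len (tail (app t x)) = suc l" by (rule tail_seq[OF l])
  have "nth (tail (app t x)) l = pr1 (nth (app t x) (suc l))" by (rule tail_seq[OF l]) (simp add: less_succ_iff)
  then show "nth (tail (app t x)) l = pr1 x" using app_seq(3)[of t x] assms by simp
  assume i: "i \<prec> l"
  then have "i \<prec> suc l" by (simp add: less_succ_iff le_def)
  from tail_seq(3)[OF l this] have "nth (tail (app t x)) i = pr1 (nth (app t x) (suc i))" .
  moreover have "suc i \<prec> len t" using i assms by simp
  ultimately show "nth (tail (app t x)) i = nth (tail t) i"
    using app_seq(4) tail_seq(3)[OF assms i] by simp
qed

text \<open>The root is never a leaf. A longer node is a leaf either because its tail is one, or
  because it has length 1 and its index names an empty tree; in the latter case its tail, the empty
  sequence, is not in that tree.\<close>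

lemma doubled_leaf:
  assumes tree: "\<And>n. is_tree (row T n)" and L: "\<And>n. row L n = leaf (row T n)"
  shows "leaf (doubled T) = {t. t \<in> doubled T \<and> len t \<noteq> \<zero> \<and> (\<langle>tail t, nth t \<zero>\<rangle> \<notin> T \<or> \<langle>tail t, nth t \<zero>\<rangle> \<in> L)}"
proof (intro set_eqI iffI)
  fix t assume "t \<in> {t. t \<in> doubled T \<and> len t \<noteq> \<zero> \<and> (\<langle>tail t, nth t \<zero>\<rangle> \<notin> T \<or> \<langle>tail t, nth t \<zero>\<rangle> \<in> L)}"
  then have t: "t \<in> doubled T" "len t \<noteq> \<zero>" "tail t \<notin> row T (nth t \<zero>) \<or> tail t \<in> leaf (row T (nth t \<zero>))"
    unfolding L[symmetric] mem_row by auto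
  obtain l where l: "len t = suc l" using t(2) zero_or_succ by blast
  have False if u: "u \<in> doubled T" "t \<sqsubseteq> u" "u \<noteq> t" for u
  proof -
    have lu: "len t \<prec> len u" using initseg_neq[OF u(2,3)] .
    then obtain m where m: "len u = suc m" using zero_or_succ[of "len u"] not_less_zero_ax[of "len t"] by auto
    have lm: "l \<prec> m" using lu unfolding l m by simp
    then have "m \<noteq> \<zero>" using not_less_zero_ax by blast
    then have "\<one> \<prec> len u" unfolding m by (rule pos_succ)
    then have "tail u \<in> row T (nth u \<zero>)" using u(1) unfolding doubled_def mem_row by blast
    moreover have "nth t \<zero> = nth u \<zero>" using u(2) l unfolding initseg_alt by (simp add: less_succ_iff)
    moreover note tail_initseg[OF u(2) l]
    moreover have "tail u \<noteq> tail t" using tail_seq(2)[OF l] tail_seq(2)[OF m] lm by auto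
    ultimately show False using t(3) tree[of "nth u \<zero>"] unfolding leaf_def is_tree_def by auto
  qed
  then show "t \<in> leaf (doubled T)" using t(1) unfolding leaf_def by blast
next
  fix t assume "t \<in> leaf (doubled T)"
  then have t: "t \<in> doubled T" "\<And>u. u \<in> doubled T \<Longrightarrow> t \<sqsubseteq> u \<Longrightarrow> u = t" unfolding leaf_def by auto
  have sq: "is_seq t" and bp: "bit_pairs t" using t(1) unfolding doubled_def by blast+
  have no: "app t x \<notin> doubled T" for x using t(2) app_ext[OF sq] by blast
  have ne: "len t \<noteq> \<zero>"
  proof
    assume z: "len t = \<zero>"
    have "app t \<zero> \<in> doubled T"
      unfolding doubled_def using app_bit_pairs[OF bp, of \<zero>] app_seq(1,2)[of t \<zero>] z by (simp add: zero_add)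
    then show False using no by blast
  qed
  then obtain l where l: "len t = suc l" using zero_or_succ by blast
  have "tail t \<in> leaf (row T (nth t \<zero>))" if tl: "tail t \<in> row T (nth t \<zero>)"
  proof (rule ccontr)
    assume "tail t \<notin> leaf (row T (nth t \<zero>))"
    then obtain s where s: "s \<in> row T (nth t \<zero>)" "tail t \<sqsubseteq> s" "s \<noteq> tail t" using tl unfolding leaf_def by blast
    have ls: "suc l \<preceq> len s" using initseg_neq[OF s(2,3)] tail_seq(2)[OF l] by (simp add: less_imp_succ_le)
    \<comment> \<open>One further entry of \<open>s\<close>, with the bit \<open>\<zero>\<close>,
      already extends \<open>t\<close> properly.\<close>
    let ?u = "app t \<langle>nth s l, \<zero>\<rangle>"
    note ta = tail_app[OF l, where x = "\<langle>nth s l, \<zero>\<rangle>"]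
    have "len ?u = suc l \<oplus> \<one>" using app_seq(2) l by simp
    note squ = tail_seq(1)[OF this]
    have "tail ?u \<in> row T (nth t \<zero>)"
    proof (rule treeD(2)[OF tree s(1) squ])
      show "len (tail ?u) \<preceq> len s" using ta(1) ls by simp
      fix i assume "i \<prec> len (tail ?u)"
      then have "i \<prec> l \<or> i = l" using ta(1) by (simp add: less_succ_ax)
      then show "nth (tail ?u) i = nth s i"
      proof
        assume i: "i \<prec> l"
        then have "nth (tail t) i = nth s i" using s(2) tail_seq(2)[OF l] unfolding initseg_alt by simp
        then show ?thesis using ta(3)[OF i] by simp
      qed (simp add: ta)
    qed
    moreover have "nth ?u \<zero> = nth t \<zero>" using app_seq(4) l by (simp add: less_succ_iff)
    moreover have "bit_pairs ?u" using app_bit_pairs[OF bp] zero_le by blast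
    ultimately have "?u \<in> doubled T" unfolding doubled_def mem_row using app_seq(1) by simp
    then show False using no by blast
  qed
  then show "t \<in> {t. t \<in> doubled T \<and> len t \<noteq> \<zero> \<and> (\<langle>tail t, nth t \<zero>\<rangle> \<notin> T \<or> \<langle>tail t, nth t \<zero>\<rangle> \<in> L)}"
    using t(1) ne unfolding L[symmetric] mem_row by blast
qed

section \<open>Paths and perfect subtrees of the doubled tree\<close>

definition single :: "'a \<Rightarrow> 'a" where
  "single n = mk \<one> (\<lambda>_. n)"

lemma single_seq: "is_seq (single n)" "len (single n) = \<one>" "nth (single n) \<zero> = n"
  unfolding single_def by (simp_all add: mk_seq[OF f1_const])

lemma f1_single: "f1 s \<Longrightarrow> f1 (\<lambda>e. single (s e))"
  unfolding single_def by (intro f1_mk f1_const f1_tl)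

lemma perfect_extension:
  assumes "is_tree S" "perfect S" "t \<in> S" shows "\<exists>u\<in>S. t \<sqsubseteq> u \<and> len t \<prec> len u"
proof -
  obtain u v where uv: "u \<in> S" "v \<in> S" "t \<sqsubseteq> u" "t \<sqsubseteq> v" "\<not> compatible u v"
    using assms(2,3) unfolding perfect_def by blast
  have "u \<noteq> t" using uv unfolding compatible_def by blast
  then show ?thesis using initseg_neq uv by blast
qed

text \<open>Perfectness provides every node of \<open>S\<close> with a proper extension in
  \<open>S\<close>. Taking the one with the least code is a computable step, so primitive recursion
  climbs through \<open>S\<close>, and the chain obtained determines a path.\<close>

lemma path_of_perfect:
  assumes tree: "\<And>n. is_tree (row T n)" and S: "S \<in> Sets M" "is_tree S" "perfect S" "S \<subseteq> doubled T" and n: "single n \<in> S"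
  shows "has_path (row T n)"
proof -
  let ?E = "\<lambda>t u. u \<in> S \<and> t \<sqsubseteq> u \<and> len t \<prec> len u"
  \<comment> \<open>Outside \<open>S\<close> the step is the identity, which makes it total.\<close>
  define R where "R t u \<longleftrightarrow> (t \<in> S \<and> ?E t u \<and> (\<forall>v. v \<prec> u \<longrightarrow> \<not> ?E t v)) \<or> (t \<notin> S \<and> u = t)" for t u
  have dE: "d1 (\<lambda>e. ?E (s e) (t e))" if "f1 s" "f1 t" for s t
    by (intro d1_conj d1_mem d1_initseg d1_less f1_len that S)
  have dR: "d1 (\<lambda>e. R (e 0) (e 1))"
    unfolding R_def by (intro d1_disj d1_conj d1_not d1_ball dE d1_mem S d1_eq f1_var)
  have "\<exists>!u. R t u" for t
  proof (cases "t \<in> S")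
    case True
    then obtain u0 where "?E t u0" using perfect_extension[OF S(2,3)] by blast
    then obtain u where u: "?E t u" "\<forall>v. v \<prec> u \<longrightarrow> \<not> ?E t v"
      using least_d1[of "?E t" u0, OF dE[OF f1_const f1_var]] by blast
    show ?thesis
    proof (rule ex1I[of _ u])
      show "R t u" unfolding R_def using True u by blast
      fix w assume "R t w"
      then have "?E t w" "\<forall>v. v \<prec> w \<longrightarrow> \<not> ?E t v" using True unfolding R_def by blast+
      then have "\<not> w \<prec> u" "\<not> u \<prec> w" using u by blast+
      then show "w = u" by order
    qed
  qed (simp add: R_def)
  then obtain G where G: "computable G" "\<And>t u. R t u \<longleftrightarrow> u = G t"
    by (rule f1_of_graph[OF dR]) (rule that)
  obtain r where r: "computable r" "r \<zero> = single n" "\<And>k. r (suc k) = G (r k)"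
    by (rule prim_rec[OF G(1)]) (rule that)
  have fr: "f1 (\<lambda>e. r (s e))" if "f1 s" for s using f1_app1[OF r(1) that] .
  have step: "?E t (G t)" if "t \<in> S" for t using G(2)[of t "G t"] that unfolding R_def by blast
  have rS: "r k \<in> S" for k
    by (rule induction_d1[where P = "\<lambda>k. r k \<in> S"]) (use n r(2,3) step in \<open>simp_all add: d1_mem S r(1)\<close>)
  have E: "r k \<sqsubseteq> r (suc k)" "len (r k) \<prec> len (r (suc k))" for k using step[OF rS[of k]] r(3) by simp_all
  have sq: "is_seq (r k)" for k using S(2) rS unfolding is_tree_def by blast
  have ln: "suc k \<preceq> len (r k)" for k
  proof (rule induction_d1[where P = "\<lambda>k. k \<oplus> \<one> \<preceq> len (r k)"])
    show "d1 (\<lambda>e. e 0 \<oplus> \<one> \<preceq> len (r (e 0)))" by (intro d1_le f1_len r(1) f1_intros)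
    show "\<zero> \<oplus> \<one> \<preceq> len (r \<zero>)" by (simp add: r(2) single_seq zero_add)
    fix k assume "suc k \<preceq> len (r k)"
    then have "suc k \<prec> len (r (suc k))" using E(2)[of k] by order
    then show "suc k \<oplus> \<one> \<preceq> len (r (suc k))" by (simp add: less_imp_succ_le)
  qed
  have ini: "r k \<sqsubseteq> r (k \<oplus> j)" for k j
  proof (rule induction_d1[where P = "\<lambda>j. r k \<sqsubseteq> r (k \<oplus> j)"])
    show "d1 (\<lambda>e. r k \<sqsubseteq> r (k \<oplus> e 0))" by (intro d1_initseg fr f1_intros)
    show "r k \<sqsubseteq> r (k \<oplus> \<zero>)" using initseg_refl[OF sq] by simp
    fix j assume "r k \<sqsubseteq> r (k \<oplus> j)"
    then show "r k \<sqsubseteq> r (k \<oplus> suc j)" using E(1)[of "k \<oplus> j"] initseg_trans unfolding add_succ_ax by blast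
  qed
  \<comment> \<open>Position 0 holds \<open>n\<close>, so entry \<open>i\<close> of the path sits at
    position \<open>suc i\<close>; by \<open>ln\<close> the sequence \<open>r (suc i)\<close> has
    length at least i + 2 and is defined there.\<close>
  let ?h = "\<lambda>i. pr1 (nth (r (suc i)) (suc i))"
  have h: "computable ?h" by (intro f1_pr1 f1_nth fr f1_intros)
  have "mk k ?h \<in> row T n" for k
  proof -
    let ?u = "r (suc k)"
    obtain l where l: "len ?u = suc l"
      using ln[of "suc k"] zero_or_succ[of "len ?u"] succ_neq_zero zero_le le_antisym_M by metis
    have kl: "suc k \<preceq> l" using ln[of "suc k"] unfolding l by simp
    then have "l \<noteq> \<zero>" using succ_neq_zero zero_le le_antisym_M by metis
    then have "\<one> \<prec> len ?u" unfolding l by (rule pos_succ)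
    then have "tail ?u \<in> row T (nth ?u \<zero>)" using rS S(4) unfolding doubled_def mem_row by blast
    moreover have "nth ?u \<zero> = n"
      using ini[of \<zero> "suc k"] single_seq[of n] unfolding initseg_alt r(2) by (simp add: zero_add)
    ultimately have u: "tail ?u \<in> row T n" by simp
    show ?thesis
    proof (rule treeD(2)[OF tree u])
      show "is_seq (mk k ?h)" by (rule mk_seq[OF h])
      have "k \<preceq> l" using kl le_add1[of k \<one>] by order
      then show "len (mk k ?h) \<preceq> len (tail ?u)" using tail_seq(2)[OF l] mk_seq(2)[OF h] by simp
      fix i assume "i \<prec> len (mk k ?h)"
      then have i: "i \<prec> k" using mk_seq(2)[OF h] by simp
      have il: "i \<prec> l" using i \<open>k \<preceq> l\<close> by order
      obtain j where j: "suc k = suc i \<oplus> j"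
        using i unfolding less_imp_succ_le le_iff_add by (metis add_assoc_M add_comm)
      have "suc i \<prec> len (r (suc i))" using ln[of "suc i"] by (simp add: less_imp_succ_le)
      then have "nth (r (suc i)) (suc i) = nth ?u (suc i)"
        using ini[of "suc i" j] unfolding initseg_alt j by blast
      then show "nth (mk k ?h) i = nth (tail ?u) i"
        using mk_seq(3)[OF h i] tail_seq(3)[OF l il] by simp
    qed
  qed
  then show ?thesis unfolding has_path_iff[OF tree] using h by (intro exI[of _ ?h]) simp
qed

text \<open>The subtree consists of all ways of adding bits to the entries of the path, after the
  prefix \<open>n\<close>. Each nonempty node splits through the two choices of the next
  bit.\<close>

lemma perfect_of_path:
  assumes tree: "\<And>n. is_tree (row T n)" and path: "has_path (row T n)"
  obtains S where "S \<in> Sets M" "is_tree S" "perfect S" "S \<subseteq> doubled T" "single n \<in> S"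
proof -
  obtain h where h: "computable h" "\<And>k. mk k h \<in> row T n" using path has_path_iff[OF tree] by blast
  define S where "S = {t. is_seq t \<and> bit_pairs t \<and> (len t \<noteq> \<zero> \<longrightarrow> nth t \<zero> = n) \<and>
    (\<forall>i. i \<prec> len t \<longrightarrow> i \<noteq> \<zero> \<longrightarrow> pr1 (nth t i) = h (i \<ominus> \<one>))}"
  have "S \<in> Sets M" unfolding S_def
    by (rule comprehension) (intro d1_intros d1_is_seq d1_bit_pairs f1_len f1_nth f1_pr1 f1_monus f1_app1[OF h(1)] f1_intros)
  moreover have tS: "is_tree S"
  proof (rule treeI)
    fix s t assume s: "s \<in> S" "is_seq s" and t: "is_seq t" "len t \<preceq> len s" "\<And>i. i \<prec> len t \<Longrightarrow> nth t i = nth s i"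
    have lt: "i \<prec> len s" if "i \<prec> len t" for i using that t(2) by order
    have "bit_pairs t" using s(1) t(2,3) bit_pairs_initseg unfolding S_def by blast
    moreover have "nth t \<zero> = n" if "len t \<noteq> \<zero>"
    proof -
      have "\<zero> \<prec> len t" using that zero_less_iff by blast
      then show ?thesis using t(3)[of \<zero>] lt[of \<zero>] s(1) unfolding S_def by (simp add: zero_less_iff)
    qed
    moreover have "pr1 (nth t i) = h (i \<ominus> \<one>)" if "i \<prec> len t" "i \<noteq> \<zero>" for i
      using t(3)[OF that(1)] lt[OF that(1)] that(2) s(1) unfolding S_def by simp
    ultimately show "t \<in> S" unfolding S_def using t(1) by blast
  qed (simp add: S_def)
  moreover have "perfect S" unfolding perfect_def
  proof
    fix t assume t: "t \<in> S"
    then have sq: "is_seq t" unfolding S_def by blast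
    \<comment> \<open>Entry 0 is \<open>n\<close> and carries no bit, so the root must be extended
      once before it can split.\<close>
    have "\<exists>u. u \<in> S \<and> t \<sqsubseteq> u \<and> len u \<noteq> \<zero>"
    proof (cases "len t = \<zero>")
      case True
      have l: "len (app t n) = \<one>" using app_seq(2) True by (simp add: zero_add)
      have "bit_pairs (app t n)" using app_bit_pairs True t unfolding S_def by blast
      moreover have "nth (app t n) \<zero> = n" using app_seq(3)[of t n] True by simp
      ultimately have "app t n \<in> S" unfolding S_def using app_seq(1) l by (simp add: less_one_iff)
      then show ?thesis using app_ext(1)[OF sq] l by (intro exI[of _ "app t n"]) simp
    next
      case False
      then show ?thesis using t initseg_refl[OF sq] by blast
    qed
    then obtain u where u: "u \<in> S" "t \<sqsubseteq> u" "len u \<noteq> \<zero>" by blast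
    then obtain l where l: "len u = suc l" using zero_or_succ by blast
    have squ: "is_seq u" using u(1) unfolding S_def by blast
    let ?u = "\<lambda>b. app u \<langle>h l, b\<rangle>"
    have inS: "?u b \<in> S" if "b \<preceq> \<one>" for b
    proof -
      have "bit_pairs (?u b)" using app_bit_pairs u that unfolding S_def by blast
      moreover have "nth (?u b) \<zero> = n" using app_seq(4) u l zero_less_iff unfolding S_def by simp
      moreover have "pr1 (nth (?u b) i) = h (i \<ominus> \<one>)" if "i \<prec> len (?u b)" "i \<noteq> \<zero>" for i
      proof (cases "i = len u")
        case True
        then show ?thesis using app_seq(3)[of u "\<langle>h l, b\<rangle>"] l by simp
      next
        case False
        then have "i \<prec> len u" using that app_seq(2) by (simp add: less_succ_ax)
        then show ?thesis using that(2) u(1) app_seq(4) unfolding S_def by simp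
      qed
      ultimately show ?thesis unfolding S_def using app_seq(1) by blast
    qed
    have inc: "\<not> ?u b \<sqsubseteq> ?u c" if "b \<noteq> c" for b c
    proof
      assume "?u b \<sqsubseteq> ?u c"
      then have "nth (?u b) (len u) = nth (?u c) (len u)"
        unfolding initseg_alt app_seq(2) by (simp add: less_succ_iff)
      then show False using that unfolding app_seq(3) by simp
    qed
    have "t \<sqsubseteq> ?u b" for b using initseg_trans[OF u(2) app_ext(1)[OF squ]] .
    moreover have "\<not> compatible (?u \<zero>) (?u \<one>)"
      unfolding compatible_def using inc[of \<zero> \<one>] inc[of \<one> \<zero>] by simp
    moreover have "?u \<zero> \<in> S" "?u \<one> \<in> S" using inS by simp_all
    ultimately show "\<exists>t'\<in>S. \<exists>u\<in>S. t \<sqsubseteq> t' \<and> t \<sqsubseteq> u \<and> \<not> compatible t' u" by blast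
  qed
  moreover have "S \<subseteq> doubled T"
  proof
    fix t assume t: "t \<in> S"
    have "\<langle>tail t, nth t \<zero>\<rangle> \<in> T" if l1: "\<one> \<prec> len t"
    proof -
      obtain l where l: "len t = suc l" using len_pos[OF l1] by blast
      have "nth (tail t) i = h i" if "i \<prec> l" for i
      proof -
        have "suc i \<prec> len t" using that l by simp
        then have "pr1 (nth t (suc i)) = h i" using t succ_neq_zero[of i] unfolding S_def by simp
        then show ?thesis using tail_seq(3)[OF l that] by simp
      qed
      then have "tail t = mk l h" unfolding mk_eq[OF h(1)] using tail_seq(1,2)[OF l] by simp
      moreover have "nth t \<zero> = n" using t l succ_neq_zero unfolding S_def by simp
      ultimately show ?thesis using h(2)[of l] unfolding mem_row by simp
    qed
    then show "t \<in> doubled T" using t unfolding S_def doubled_def by simp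
  qed
  moreover have "single n \<in> S"
    unfolding S_def bit_pairs_def by (simp add: single_seq less_one_iff)
  ultimately show ?thesis by (rule that)
qed

lemma PK_L_WF_hat_L: "PK_L \<Longrightarrow> WF_hat_L"
  unfolding WF_hat_L_def
proof (intro ballI impI)
  fix T L assume pk: "PK_L" and T: "T \<in> Sets M" and L: "L \<in> Sets M" and *: "\<forall>i. is_tree (row T i) \<and> row L i = leaf (row T i)"
  have tree: "is_tree (row T n)" and lf: "row L n = leaf (row T n)" for n using * by blast+
  have "{t. t \<in> doubled T \<and> len t \<noteq> \<zero> \<and> (\<langle>tail t, nth t \<zero>\<rangle> \<notin> T \<or> \<langle>tail t, nth t \<zero>\<rangle> \<in> L)} \<in> Sets M"
    by (rule comprehension) (intro d1_intros f1_len f1_nth f1_pair f1_tail f1_intros doubled_sets T L)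
  then have "perfect_kernel (doubled T) \<in> Sets M"
    using pk doubled_sets[OF T] doubled_tree[OF tree] doubled_leaf[OF tree lf] unfolding PK_L_def by simp
  then have Z: "{n. single n \<notin> perfect_kernel (doubled T)} \<in> Sets M"
    by (intro comprehension d1_not d1_mem f1_single f1_var)
  have "single n \<in> perfect_kernel (doubled T) \<longleftrightarrow> has_path (row T n)" for n
  proof
    assume "single n \<in> perfect_kernel (doubled T)"
    then show "has_path (row T n)"
      unfolding perfect_kernel_def using path_of_perfect[OF tree] by blast
  next
    assume "has_path (row T n)"
    then obtain S where "S \<in> Sets M" "is_tree S" "perfect S" "S \<subseteq> doubled T" "single n \<in> S"
      by (rule perfect_of_path[OF tree]) (rule that)
    then show "single n \<in> perfect_kernel (doubled T)" unfolding perfect_kernel_def by blast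
  qed
  then show "\<exists>Z\<in>Sets M. \<forall>n. n \<in> Z \<longleftrightarrow> \<not> has_path (row T n)" using Z by (intro bexI[OF _ Z]) simp
qed

text \<open>Two cycles meet in \<open>Pi11_CA\<close> and \<open>WF_hat_L\<close>: one passes from
  the former to the latter through \<open>WF_hat\<close>, the other through \<open>PK\<close> and
  \<open>PK_L\<close>.\<close>

lemma equivalences:
  "(Pi11_CA \<longleftrightarrow> WF_hat) \<and> (WF_hat \<longleftrightarrow> WF_hat_L) \<and> (WF_hat_L \<longleftrightarrow> PK) \<and> (PK \<longleftrightarrow> PK_L)"
proof -
  have "WF_hat_L" if WF_hat
    unfolding WF_hat_L_def
  proof (intro ballI impI)
    fix T L assume "T \<in> Sets M" and "\<forall>i. is_tree (row T i) \<and> row L i = leaf (row T i)"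
    then show "\<exists>Z\<in>Sets M. \<forall>n. n \<in> Z \<longleftrightarrow> \<not> has_path (row T n)"
      using that[unfolded WF_hat_def, rule_format, of T] by simp
  qed
  moreover have "PK_L" if PK
    using that unfolding PK_def PK_L_def by simp
  ultimately show ?thesis
    using Pi11_WF_hat Pi11_PK WF_hat_L_Pi11 PK_L_WF_hat_L by argo
qed

end

theorem theorem8:
  fixes M :: "'a l2_structure"
  assumes "L2.RCA0 M"
  shows "(L2.Pi11_CA M \<longleftrightarrow> L2.WF_hat M) \<and>
         (L2.WF_hat M \<longleftrightarrow> L2.WF_hat_L M) \<and>
         (L2.WF_hat_L M \<longleftrightarrow> L2.PK M) \<and>
         (L2.PK M \<longleftrightarrow> L2.PK_L M)"
  by (rule rca.equivalences[OF rca.intro[OF assms]])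

end
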